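(* Let $S$ be a perfect translation surface with common modulus $M$, and let $V_M=S_M\circ R$ be its flip-shear. Consider a geodesic trajectory on $S$ whose angle $\theta$ (measured from the positive horizontal direction) satisfies $0\le\theta<\theta_S$, and its associated cutting sequence. Mark a letter in the cutting sequence if: (i) it corresponds to a gluing edge, and it is the middle letter of a $(00)$ word or of a $(11)$ word; or (ii) it corresponds to a horizontal edge. Then the derived sequence (the cutting sequence of the image of the trajectory under $V_M$) consists precisely of the marked letters, read from left to right.
   Context: **Special surfaces.** A translation surface is a compact surface obtained from finitely many planar polygons by identifying their edges in pairs by translations (opposite, parallel, congruent edges). A polygon is level if no horizontal line both contains a vertex of the polygon and crosses an edge at an interior point. It is vertically symmetric if, after a translation, $(x,y)\mapsto(-x,y)$ is a symmetry of it. It is special if it is convex, level and vertically symmetric. A special translation surface is a translation surface given by gluing pairs of parallel edges of finitely many special polygons, such that if edge $e_1$ of $P_1$ is glued to edge $e_2$ of $P_2$, then $I_1(e_1)$ is glued to $I_2(e_2)$, where $I_j$ is the vertical-axis reflection symmetry of $P_j$. This polygon decomposition is part of the data. **Cylinders.** Cutting a special surface along all horizontal segments that join two vertices of one of its polygons (horizontal edges included) divides it into horizontal flat cylinders; this is its horizontal cylinder decomposition. It cuts each polygon into vertically symmetric isosceles trapezoids (rectangles and isosceles triangles are allowed as degenerate cases), so each cylinder is partitioned into such trapezoids. The modulus of a horizontal cylinder is $W/H$, where $H$ is its height and $W$ its circumference. The surface is a perfect translation surface with common modulus $M$ if every cylinder of this decomposition either has modulus $M$ and is partitioned into two isosceles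 trapezoids (typical), or has modulus $M/2$ and is partitioned into a single rectangle (exceptional). **Automorphisms.** The flip $R$ is the automorphism of $S$ that reflects each polygon in its vertical axis of symmetry (derivative $\begin{bmatrix}-1&0\\0&1\end{bmatrix}$). The shear $S_M$ is the affine automorphism that preserves each horizontal cylinder, fixes the tops and bottoms of the cylinders pointwise, and has derivative $\begin{bmatrix}1&M\\0&1\end{bmatrix}$. The flip-shear is $V_M=S_M\circ R$. **Edges.** Letters are (labels of) the glued pairs of polygon edges. A gluing edge is a non-horizontal glued polygon edge (a non-horizontal side of a trapezoid in the partition). A horizontal edge is a horizontal polygon edge. The slanted edges are the positive-slope diagonals of the trapezoids of the partition, i.e. in each trapezoid the segment joining the bottom-left vertex to the top-right vertex (for a triangle, the two bottom or the two top vertices coincide). The number $\theta_S$ is the smallest angle between a slanted edge and the positive horizontal direction. **Cutting sequences.** The cutting sequence of a geodesic trajectory is the bi-infinite sequence of polygon edges it crosses, in order (by convention a trajectory hitting a vertex stops, and then the sequence is not bi-infinite). The derived trajectory is the image of the trajectory under $V_M$, and the derived sequence is the cutting sequence of the derived trajectory. **Words.** If $h_0<\dots<h_r$ are the heights of the vertices of a polygon, then for each $i=1,\dots,r$ the polygon has exactly one left and one right non-horizontal edge between heights $h_{i-1}$ and $h_i$; these have level $i$. A bottom horizontal edge counts as a left-side edge of level $0$, and a top horizontal edge as a right-side edge of level $r+1$. A trajectory with $\theta\in[0,\theta_S)$ crossing a polygon enters through a left-side edge and leaves through a right-side edge; the crossing is of type $(0)$ if these have the same level and of type $(1)$ if the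 right one is one level above. Three consecutive letters of the cutting sequence correspond to crossing two consecutive polygons; the three-letter word is a $(00)$, $(01)$, $(10)$ or $(11)$ word according to the types of these two crossings in order. *)

theory Defs
  imports "HOL-Analysis.Analysis"
begin

text \<open>The plane is \<^typ>\<open>complex\<close>.  Convex polygons are two-dimensional polytopes; their vertices
  and edges are the extreme points and one-dimensional faces of the library, so vertices are
  genuine corners.\<close>

definition convex_polygon :: "complex set \<Rightarrow> bool" where
  "convex_polygon P \<longleftrightarrow> polytope P \<and> interior P \<noteq> {}"

definition vertices :: "complex set \<Rightarrow> complex set" where
  "vertices P = {v. v extreme_point_of P}"

definition horizontal :: "complex set \<Rightarrow> bool" where
  "horizontal e \<longleftrightarrow> (\<exists>y. \<forall>z\<in>e. Im z = y)"

text \<open>A horizontal line through a vertex may contain a horizontal edge: it does not cross it.\<close>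

definition level_polygon :: "complex set \<Rightarrow> bool" where
  "level_polygon P \<longleftrightarrow>
     (\<forall>v\<in>vertices P. \<forall>e. e edge_of P \<and> \<not> horizontal e \<longrightarrow> (\<forall>p\<in>rel_interior e. Im p \<noteq> Im v))"

definition mirror :: "real \<Rightarrow> complex \<Rightarrow> complex" where
  "mirror c z = Complex (2 * c - Re z) (Im z)"

definition vertically_symmetric :: "complex set \<Rightarrow> bool" where
  "vertically_symmetric P \<longleftrightarrow> (\<exists>c. mirror c ` P = P)"

definition reflection :: "complex set \<Rightarrow> complex \<Rightarrow> complex" where
  "reflection P = mirror (THE c. mirror c ` P = P)"

definition special_polygon :: "complex set \<Rightarrow> bool" where
  "special_polygon P \<longleftrightarrow> convex_polygon P \<and> level_polygon P \<and> vertically_symmetric P"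


text \<open>The polygons are indexed by a finite type.  An edge is addressed by the index of its polygon
  and the edge as a set of points; \<open>glue\<close> sends it to the edge it is glued to, and its
  values at other arguments are irrelevant.\<close>

record 'i polygon_surface =
  poly :: "'i \<Rightarrow> complex set"
  glue :: "'i \<times> complex set \<Rightarrow> 'i \<times> complex set"

text \<open>The disjointness of interiors says that the glued edges are opposite: after the translation
  \<open>d\<close> the two polygons lie on different sides of their common edge.\<close>

definition special_surface :: "'i::finite polygon_surface \<Rightarrow> bool" where
  "special_surface S \<longleftrightarrow>
     (\<forall>i. special_polygon (poly S i)) \<and>
     (\<forall>i e. e edge_of poly S i \<longrightarrow>
        (\<exists>j f. glue S (i, e) = (j, f) \<and> f edge_of poly S j \<and>
           (j, f) \<noteq> (i, e) \<and> glue S (j, f) = (i, e) \<and>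
           (\<exists>d. f = (+) d ` e \<and> interior ((+) d ` poly S i) \<inter> interior (poly S j) = {}) \<and>
           glue S (i, reflection (poly S i) ` e) = (j, reflection (poly S j) ` f)))"


text \<open>Points of the surface are the classes of the equivalence relation generated by the gluings.
  The reflexive transitive closure is symmetric because \<open>glue\<close> is an involution on edges.\<close>

definition glued_points :: "'i::finite polygon_surface \<Rightarrow> (('i \<times> complex) \<times> ('i \<times> complex)) set" where
  "glued_points S = {((i, z), (j, d + z)) | i z j d.
     \<exists>e. e edge_of poly S i \<and> z \<in> e \<and> glue S (i, e) = (j, (+) d ` e)}"

definition pt :: "'i::finite polygon_surface \<Rightarrow> 'i \<times> complex \<Rightarrow> ('i \<times> complex) set" where
  "pt S p = (glued_points S)\<^sup>* `` {p}"

definition points :: "'i::finite polygon_surface \<Rightarrow> ('i \<times> complex) set set" where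
  "points S = {pt S (i, z) | i z. z \<in> poly S i}"

definition vertex_points :: "'i::finite polygon_surface \<Rightarrow> ('i \<times> complex) set set" where
  "vertex_points S = {pt S (i, v) | i v. v \<in> vertices (poly S i)}"


text \<open>Cutting a polygon along the horizontal segments that join two of its vertices leaves one
  trapezoid between any two consecutive vertex heights \<open>a < b\<close>; it is recorded as
  \<open>(i, a, b)\<close>.  The functions \<open>lft\<close> and \<open>rgt\<close> give the end points of a horizontal slice.\<close>

definition heights :: "complex set \<Rightarrow> real set" where
  "heights P = Im ` vertices P"

definition lft :: "complex set \<Rightarrow> real \<Rightarrow> real" where
  "lft P y = Inf {x. Complex x y \<in> P}"

definition rgt :: "complex set \<Rightarrow> real \<Rightarrow> real" where
  "rgt P y = Sup {x. Complex x y \<in> P}"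

definition trapezoids :: "'i::finite polygon_surface \<Rightarrow> ('i \<times> real \<times> real) set" where
  "trapezoids S = {(i, a, b). a \<in> heights (poly S i) \<and> b \<in> heights (poly S i) \<and> a < b \<and>
                              (\<forall>h\<in>heights (poly S i). \<not> (a < h \<and> h < b))}"

definition is_rectangle :: "'i::finite polygon_surface \<Rightarrow> 'i \<times> real \<times> real \<Rightarrow> bool" where
  "is_rectangle S = (\<lambda>(i, a, b). lft (poly S i) a = lft (poly S i) b \<and>
                                  rgt (poly S i) a = rgt (poly S i) b)"

text \<open>After the cuts, the trapezoids are still glued to each other along their non-horizontal
  sides.  The horizontal cylinders are the components of the result, each given as the set of its
  trapezoids.\<close>

definition side_glued :: "'i::finite polygon_surface \<Rightarrow> (('i \<times> real \<times> real) \<times> ('i \<times> real \<times> real)) set" where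
  "side_glued S = {((i, a, b), (j, c, d)).
     (i, a, b) \<in> trapezoids S \<and> (j, c, d) \<in> trapezoids S \<and>
     (\<exists>e f. e edge_of poly S i \<and> f edge_of poly S j \<and> Im ` e = {a..b} \<and> Im ` f = {c..d} \<and>
            glue S (i, e) = (j, f))}"

definition cylinders :: "'i::finite polygon_surface \<Rightarrow> ('i \<times> real \<times> real) set set" where
  "cylinders S = {(side_glued S)\<^sup>* `` {T} | T. T \<in> trapezoids S}"

definition cylinder_height :: "('i::finite \<times> real \<times> real) set \<Rightarrow> real" where
  "cylinder_height C = (THE h. \<forall>(i, a, b)\<in>C. b - a = h)"

text \<open>The bottoms of the trapezoids tile the bottom of the cylinder.\<close>

definition circumference :: "'i::finite polygon_surface \<Rightarrow> ('i \<times> real \<times> real) set \<Rightarrow> real" where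
  "circumference S C = (\<Sum>(i, a, b)\<in>C. rgt (poly S i) a - lft (poly S i) a)"

definition modulus :: "'i::finite polygon_surface \<Rightarrow> ('i \<times> real \<times> real) set \<Rightarrow> real" where
  "modulus S C = circumference S C / cylinder_height C"

text \<open>All trapezoids are isosceles by the symmetry of the polygons.\<close>

definition perfect_surface :: "'i::finite polygon_surface \<Rightarrow> real \<Rightarrow> bool" where
  "perfect_surface S M \<longleftrightarrow> special_surface S \<and>
     (\<forall>C\<in>cylinders S.
        (modulus S C = M \<and> card C = 2) \<or>
        (modulus S C = M / 2 \<and> (\<exists>T. C = {T} \<and> is_rectangle S T)))"

definition slanted_edge_angle :: "'i::finite polygon_surface \<Rightarrow> 'i \<times> real \<times> real \<Rightarrow> real" where
  "slanted_edge_angle S = (\<lambda>(i, a, b). Arg (Complex (rgt (poly S i) b) b - Complex (lft (poly S i) a) a))"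

definition theta_S :: "'i::finite polygon_surface \<Rightarrow> real" where
  "theta_S S = Min (slanted_edge_angle S ` trapezoids S)"


text \<open>\<open>straight_on S J g v\<close>: during the time set \<open>J\<close> the path \<open>g\<close> moves with constant velocity
  \<open>v\<close> inside a single closed polygon.  A geodesic avoids the vertices and around each time has
  the same velocity before and after; since the gluings are translations, this is straightness in the
  flat structure, also where the path passes from one polygon to the next.\<close>

definition straight_on ::
  "'i::finite polygon_surface \<Rightarrow> real set \<Rightarrow> (real \<Rightarrow> ('i \<times> complex) set) \<Rightarrow> complex \<Rightarrow> bool" where
  "straight_on S J g v \<longleftrightarrow> (\<exists>i z. \<forall>s\<in>J. z + s *\<^sub>R v \<in> poly S i \<and> g s = pt S (i, z + s *\<^sub>R v))"

definition geodesic_on ::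
  "'i::finite polygon_surface \<Rightarrow> real set \<Rightarrow> (real \<Rightarrow> ('i \<times> complex) set) \<Rightarrow> complex \<Rightarrow> bool" where
  "geodesic_on S J g v \<longleftrightarrow>
     (\<forall>s\<in>J. g s \<in> points S - vertex_points S \<and>
        (\<exists>\<epsilon>>0. straight_on S (J \<inter> {s - \<epsilon>..s}) g v \<and> straight_on S (J \<inter> {s..s + \<epsilon>}) g v))"

definition flip :: "'i::finite polygon_surface \<Rightarrow> ('i \<times> complex) set \<Rightarrow> ('i \<times> complex) set" where
  "flip S X = (\<lambda>(i, z). (i, reflection (poly S i) z)) ` X"

definition cylinder_region ::
  "'i::finite polygon_surface \<Rightarrow> ('i \<times> real \<times> real) set \<Rightarrow> ('i \<times> complex) set set" where
  "cylinder_region S C = {pt S (i, z) | i z a b. (i, a, b) \<in> C \<and> z \<in> poly S i \<and> a < Im z \<and> Im z < b}"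

definition cylinder_boundary ::
  "'i::finite polygon_surface \<Rightarrow> ('i \<times> real \<times> real) set \<Rightarrow> ('i \<times> complex) set set" where
  "cylinder_boundary S C = {pt S (i, z) | i z a b. (i, a, b) \<in> C \<and> z \<in> poly S i \<and> (Im z = a \<or> Im z = b)}"

text \<open>A bijection of the surface is affine with derivative \<open>A\<close> if it takes straight paths of
  velocity \<open>v\<close> to straight paths of velocity \<open>A v\<close>; for the shear below, \<open>A\<close> is the matrix with
  rows \<open>(1, M)\<close> and \<open>(0, 1)\<close>.  Continuity away from the vertices follows,
  and the shear fixes the vertices.\<close>

definition affine_automorphism ::
  "'i::finite polygon_surface \<Rightarrow> (('i \<times> complex) set \<Rightarrow> ('i \<times> complex) set) \<Rightarrow>
   (complex \<Rightarrow> complex) \<Rightarrow> bool" where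
  "affine_automorphism S F A \<longleftrightarrow>
     bij_betw F (points S) (points S) \<and>
     (\<forall>J g v. is_interval J \<and> geodesic_on S J g v \<longrightarrow> geodesic_on S J (F \<circ> g) (A v))"

definition is_shear ::
  "'i::finite polygon_surface \<Rightarrow> real \<Rightarrow> (('i \<times> complex) set \<Rightarrow> ('i \<times> complex) set) \<Rightarrow> bool" where
  "is_shear S M F \<longleftrightarrow>
     affine_automorphism S F (\<lambda>v. Complex (Re v + M * Im v) (Im v)) \<and>
     (\<forall>C\<in>cylinders S. F ` cylinder_region S C = cylinder_region S C \<and>
                      (\<forall>X\<in>cylinder_boundary S C. F X = X))"

definition is_flip_shear ::
  "'i::finite polygon_surface \<Rightarrow> real \<Rightarrow> (('i \<times> complex) set \<Rightarrow> ('i \<times> complex) set) \<Rightarrow> bool" where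
  "is_flip_shear S M V \<longleftrightarrow> (\<exists>F. is_shear S M F \<and> V = F \<circ> flip S)"


definition trajectory :: "'i::finite polygon_surface \<Rightarrow> (real \<Rightarrow> ('i \<times> complex) set) \<Rightarrow> bool" where
  "trajectory S g \<longleftrightarrow> (\<exists>v. v \<noteq> 0 \<and> geodesic_on S UNIV g v)"

definition letter_of :: "'i::finite polygon_surface \<Rightarrow> 'i \<times> complex set \<Rightarrow> ('i \<times> complex set) set" where
  "letter_of S p = {p, glue S p}"

definition on_edge ::
  "'i::finite polygon_surface \<Rightarrow> ('i \<times> complex) set \<Rightarrow> 'i \<times> complex set \<Rightarrow> bool" where
  "on_edge S X = (\<lambda>(i, e). e edge_of poly S i \<and> (\<exists>z\<in>e. X = pt S (i, z)))"

text \<open>\<open>t n\<close> is the time of the \<open>n\<close>th crossing and \<open>c n\<close> the letter crossed then.  A bi-infinite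
  sequence carries no preferred origin, so \<open>t\<close> and \<open>c\<close> are determined up to a shift of
  the index.\<close>

definition cutting_sequence ::
  "'i::finite polygon_surface \<Rightarrow> (real \<Rightarrow> ('i \<times> complex) set) \<Rightarrow> (int \<Rightarrow> real) \<Rightarrow>
   (int \<Rightarrow> ('i \<times> complex set) set) \<Rightarrow> bool" where
  "cutting_sequence S g t c \<longleftrightarrow>
     trajectory S g \<and> strict_mono t \<and> range t = {s. \<exists>p. on_edge S (g s) p} \<and>
     (\<forall>n. \<exists>p. on_edge S (g (t n)) p \<and> c n = letter_of S p)"

text \<open>If \<open>h\<^sub>0 < \<dots> < h\<^sub>r\<close> are the vertex heights, a non-horizontal edge from \<open>h\<^sub>i\<^sub>-\<^sub>1\<close> to \<open>h\<^sub>i\<close> has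
  level \<open>i\<close>, a bottom edge has level \<open>0\<close>, and a top edge has level \<open>r + 1 = card (heights P)\<close>.\<close>

definition edge_level :: "complex set \<Rightarrow> complex set \<Rightarrow> nat" where
  "edge_level P e =
     (if horizontal e then (if Im ` e = {Min (heights P)} then 0 else card (heights P))
      else card {h \<in> heights P. h < Sup (Im ` e)})"

text \<open>The type \<open>k\<close> of the crossing of a polygon between the \<open>n\<close>th and the next letter.  The polygon
  and the edges have to be read off from the trajectory, since two letters need not determine them.\<close>

definition crossing_type ::
  "'i::finite polygon_surface \<Rightarrow> (real \<Rightarrow> ('i \<times> complex) set) \<Rightarrow> (int \<Rightarrow> real) \<Rightarrow> int \<Rightarrow> nat \<Rightarrow> bool" where
  "crossing_type S g t n k \<longleftrightarrow>
     (\<exists>i z v e f. (\<forall>s\<in>{t n..t (n + 1)}. z + s *\<^sub>R v \<in> poly S i \<and> g s = pt S (i, z + s *\<^sub>R v)) \<and>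
        e edge_of poly S i \<and> z + t n *\<^sub>R v \<in> e \<and>
        f edge_of poly S i \<and> z + t (n + 1) *\<^sub>R v \<in> f \<and>
        edge_level (poly S i) f = edge_level (poly S i) e + k)"

definition middle_of_word ::
  "'i::finite polygon_surface \<Rightarrow> (real \<Rightarrow> ('i \<times> complex) set) \<Rightarrow> (int \<Rightarrow> real) \<Rightarrow> int \<Rightarrow> nat \<Rightarrow> nat \<Rightarrow> bool" where
  "middle_of_word S g t n k l \<longleftrightarrow> crossing_type S g t (n - 1) k \<and> crossing_type S g t n l"

definition horizontal_letter :: "('i::finite \<times> complex set) set \<Rightarrow> bool" where
  "horizontal_letter L \<longleftrightarrow> (\<forall>(i, e)\<in>L. horizontal e)"

definition marked ::
  "'i::finite polygon_surface \<Rightarrow> (real \<Rightarrow> ('i \<times> complex) set) \<Rightarrow> (int \<Rightarrow> real) \<Rightarrow>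
   (int \<Rightarrow> ('i \<times> complex set) set) \<Rightarrow> int \<Rightarrow> bool" where
  "marked S g t c n \<longleftrightarrow>
     (\<not> horizontal_letter (c n) \<and> (middle_of_word S g t n 0 0 \<or> middle_of_word S g t n 1 1)) \<or>
     horizontal_letter (c n)"

end

theory Submission
  imports Defs
begin

text \<open>On the parallelogram \<open>T \<union> T'\<close> formed by the two trapezoids of a cylinder on either side of a
  gluing edge, the flip-shear acts as \<open>(x, y) \<mapsto> (-x + M y, y)\<close>, and \<open>M\<close> times the height of the
  cylinder is the sum of the widths of \<open>T\<close> and \<open>T'\<close>. Hence the preimage of the gluing edge is the
  long diagonal of the parallelogram. The diagonal separates the left side and the top from the right
  side and the bottom. A trajectory flatter than the slanted edges never crosses a single
  trapezoid from bottom to top. It therefore meets the diagonal exactly when it crosses the gluing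
  edge and passes through the parallelogram either from the left to the right side, which is a
  \<open>(00)\<close> word, or from the bottom to the top, which is a \<open>(11)\<close> word. Horizontal edges are
  preserved by the flip-shear.\<close>

section \<open>Coordinates on a symmetric polygon\<close>

text \<open>The shear is known only through its properties: it takes straight paths to straight
  paths with the given derivative, and it fixes the cylinder boundaries. Its values inside a
  cylinder are recovered by carrying segments inwards from non-vertex boundary points. What this
  leaves out is the cylinder of two triangles, which needs a path through both of them. Gluing
  commutes with the reflections, so the neighbour of \<open>T\<close> on the right is also its
  neighbour on the left. An exceptional rectangle is its own neighbour and its width is counted
  twice, which is what modulus \<open>M / 2\<close> accounts for. The gluing edge splits the
  diagonal into parts in two polygons. The affine function \<open>phi\<close> of time measures the
  signed horizontal distance to both parts, so that meeting the diagonal is a zero and the types of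
  the two crossings become signs at the ends of a time interval. The diagonal may be met before or
  after the gluing edge itself. That consecutive letters keep their order is therefore a separate
  point, settled in the trapezoid shared by the two parallelograms.\<close>

definition sym_axis :: "complex set \<Rightarrow> real" where
  "sym_axis P = (THE c. mirror c ` P = P)"

definition half_width :: "complex set \<Rightarrow> real \<Rightarrow> real" where
  "half_width P y = (rgt P y - lft P y) / 2"

abbreviation ymin :: "complex set \<Rightarrow> real" where
  "ymin P \<equiv> Min (heights P)"

abbreviation ymax :: "complex set \<Rightarrow> real" where
  "ymax P \<equiv> Max (heights P)"

definition side :: "complex set \<Rightarrow> real \<Rightarrow> real \<Rightarrow> complex" where
  "side P \<sigma> y = Complex (sym_axis P + \<sigma> * half_width P y) y"

definition gap :: "complex set \<Rightarrow> real \<Rightarrow> real \<Rightarrow> bool" where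
  "gap P a b \<longleftrightarrow> a \<in> heights P \<and> b \<in> heights P \<and> a < b \<and> (\<forall>h\<in>heights P. \<not> (a < h \<and> h < b))"

lemma side_simps [simp]:
  "Re (side P \<sigma> y) = sym_axis P + \<sigma> * half_width P y" "Im (side P \<sigma> y) = y"
  by (simp_all add: side_def)

lemma mirror_simps [simp]: "Re (mirror c z) = 2 * c - Re z" "Im (mirror c z) = Im z"
  by (simp_all add: mirror_def)

lemma mirror_mirror [simp]: "mirror c (mirror c z) = z"
  by (simp add: complex_eq_iff)

lemma mirror_affine: "mirror c ((1 - t) *\<^sub>R x + t *\<^sub>R y) = (1 - t) *\<^sub>R mirror c x + t *\<^sub>R mirror c y"
  by (simp add: complex_eq_iff algebra_simps)

lemma mirror_open_segment: "x \<in> open_segment a b \<Longrightarrow> mirror c x \<in> open_segment (mirror c a) (mirror c b)"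
  by (metis in_segment(2) mirror_affine mirror_mirror)

text \<open>If \<open>d\<close> and \<open>d'\<close> differed, translation by their difference
  would carry \<open>e\<close> into itself and its iterates would leave every ball. Hence a gluing,
  given as a map on edges, determines its translation vector.\<close>

lemma bounded_translate_eq:
  fixes e :: "'a::real_normed_vector set"
  assumes "bounded e" "e \<noteq> {}" "(+) d ` e = (+) d' ` e"
  shows "d = d'"
proof (rule ccontr)
  assume ne: "d \<noteq> d'"
  obtain x where x: "x \<in> e" using assms(2) by auto
  have step: "z + (d - d') \<in> e" if "z \<in> e" for z
  proof -
    have "d + z \<in> (+) d' ` e" using that assms(3) by blast
    then obtain w where "w \<in> e" "d + z = d' + w" by blast
    then have "z + (d - d') = w" by (simp add: algebra_simps)
    then show ?thesis using \<open>w \<in> e\<close> by simp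
  qed
  have all: "x + real n *\<^sub>R (d - d') \<in> e" for n
  proof (induction n)
    case 0 then show ?case using x by simp
  next
    case (Suc n)
    from step[OF this] show ?case by (simp add: algebra_simps)
  qed
  obtain B where B: "\<And>z. z \<in> e \<Longrightarrow> norm z \<le> B" using assms(1) by (auto simp: bounded_iff)
  obtain n where n: "real n * norm (d - d') > B + norm x"
    using ne reals_Archimedean3[of "norm (d - d')"] by auto
  have "real n * norm (d - d') = norm ((x + real n *\<^sub>R (d - d')) - x)" by simp
  also have "\<dots> \<le> B + norm x" using norm_triangle_ineq4 B[OF all[of n]] by (meson add_right_mono order_trans)
  finally show False using n by simp
qed

section \<open>Edges, corners and frontier of a convex polygon\<close>

lemma edge_segment:
  assumes "polytope P" "e edge_of P"
  obtains u v where "u \<noteq> v" "e = closed_segment u v" "u \<in> vertices P" "v \<in> vertices P"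
proof -
  have f: "e face_of P" and d: "aff_dim e = 1" using assms by (auto simp: edge_of_def)
  have pe: "polytope e" using f assms(1) face_of_polytope_polytope by blast
  have "collinear e" using d by (simp add: collinear_aff_dim)
  moreover have ne: "e \<noteq> {}" using d by force
  ultimately obtain u v where uv: "e = closed_segment u v"
    using compact_convex_collinear_segment pe polytope_imp_compact polytope_imp_convex by metis
  have "u \<noteq> v" using d uv by force
  moreover have "u \<in> vertices P" "v \<in> vertices P"
    using extreme_point_of_face[OF f] uv extreme_point_of_segment[of _ u v] by (auto simp: vertices_def)
  ultimately show ?thesis using that uv by blast
qed

text \<open>The polygon is two-dimensional, so its edges are its facets, and these cover the
  frontier.\<close>

lemma frontier_edge:
  fixes P :: "complex set"
  assumes "convex_polygon P" "z \<in> P" "z \<notin> interior P"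
  obtains e where "e edge_of P" "z \<in> e"
proof -
  have poly: "polyhedron P" and ni: "interior P \<noteq> {}" and cl: "closed P"
    using assms(1) polytope_imp_polyhedron polytope_imp_closed by (auto simp: convex_polygon_def)
  have ad: "aff_dim P = 2" using aff_dim_nonempty_interior[OF ni] by simp
  have "rel_frontier P = P - interior P"
    using rel_interior_nonempty_interior[OF ni] cl by (simp add: rel_frontier_def)
  then have "z \<in> \<Union>{F. F facet_of P}"
    using rel_frontier_of_polyhedron[OF poly] assms by auto
  then obtain F where "F facet_of P" "z \<in> F" by auto
  then show ?thesis using that ad by (auto simp: facet_of_def edge_of_def)
qed

text \<open>Two distinct edges meet in a proper face of each, so in at most one point, which is then
  an extreme point of \<open>P\<close>.\<close>

lemma edge_unique:
  assumes "polytope P" "e edge_of P" "e' edge_of P" "z \<in> e" "z \<in> e'" "z \<notin> vertices P"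
  shows "e = e'"
proof (rule ccontr)
  assume ne: "e \<noteq> e'"
  have conv: "convex P" using assms(1) polytope_imp_convex by auto
  have f: "e face_of P" "e' face_of P" and d: "aff_dim e = 1" "aff_dim e' = 1"
    using assms by (auto simp: edge_of_def)
  have fi: "e \<inter> e' face_of P" using f face_of_Int by blast
  have "aff_dim (e \<inter> e') < 1"
  proof (cases "e \<inter> e' = e")
    case True
    then have "e face_of e'" using face_of_subset[OF f(1)] f(2) face_of_imp_subset by blast
    then show ?thesis using face_of_aff_dim_lt[of e' e] ne d f face_of_imp_convex by fastforce
  next
    case False
    have "e \<inter> e' face_of e" using face_of_subset[OF fi] f(1) face_of_imp_subset by blast
    then show ?thesis using face_of_aff_dim_lt[of e "e \<inter> e'"] False d f face_of_imp_convex by fastforce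
  qed
  moreover have "e \<inter> e' \<noteq> {}" using assms by auto
  then have "aff_dim (e \<inter> e') \<ge> 0" by (metis aff_dim_negative_iff linorder_not_less)
  ultimately have "aff_dim (e \<inter> e') = 0" by simp
  then obtain a where "e \<inter> e' = {a}" using aff_dim_eq_0 by blast
  then have "e \<inter> e' = {z}" using assms by auto
  then show False using fi assms(6) by (simp add: face_of_singleton vertices_def)
qed

section \<open>Horizontal slices of a special polygon and its faces in terms of them\<close>

locale special_poly =
  fixes P :: "complex set"
  assumes sp: "special_polygon P"
begin

abbreviation hw :: "real \<Rightarrow> real" where
  "hw \<equiv> half_width P"

lemma sp_polygon: "convex_polygon P" and sp_level: "level_polygon P"
  and sp_symmetric: "vertically_symmetric P"
  using sp by (auto simp: special_polygon_def)

lemma sp_polytope: "polytope P"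
  using sp_polygon by (auto simp: convex_polygon_def)

lemma sp_convex: "convex P" and sp_compact: "compact P" and sp_nonempty: "P \<noteq> {}"
  using sp_polytope sp_polygon polytope_imp_convex polytope_imp_compact by (auto simp: convex_polygon_def)

lemma finite_vertices: "finite (vertices P)"
  using finite_polyhedron_extreme_points[OF polytope_imp_polyhedron[OF sp_polytope]]
  by (simp add: vertices_def)

lemma finite_heights: "finite (heights P)"
  using finite_vertices by (simp add: heights_def)

lemma hull_vertices: "P = convex hull (vertices P)"
  using Krein_Milman_Minkowski[OF sp_compact sp_convex] by (simp add: vertices_def)

lemma vertices_subset: "vertices P \<subseteq> P"
  by (auto simp: vertices_def extreme_point_of_def)

lemma heights_nonempty: "heights P \<noteq> {}"
  by (metis hull_vertices sp_nonempty convex_hull_empty heights_def image_is_empty)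

lemma Im_bounds:
  assumes "z \<in> P" shows "ymin P \<le> Im z" "Im z \<le> ymax P"
proof -
  have "vertices P \<subseteq> {z. ymin P \<le> Im z}" "vertices P \<subseteq> {z. Im z \<le> ymax P}"
    using finite_heights by (auto simp: heights_def)
  then have "P \<subseteq> {z. ymin P \<le> Im z}" "P \<subseteq> {z. Im z \<le> ymax P}"
    using hull_minimal[of "vertices P" "{z. ymin P \<le> Im z}" convex] hull_minimal[of "vertices P" "{z. Im z \<le> ymax P}" convex]
      convex_halfspace_Im_ge[of "ymin P"] convex_halfspace_Im_le[of "ymax P"]
    by (metis hull_vertices)+
  then show "ymin P \<le> Im z" "Im z \<le> ymax P" using assms by auto
qed

lemma slice_nonempty:
  assumes "ymin P \<le> y" "y \<le> ymax P"
  shows "\<exists>x. Complex x y \<in> P"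
proof -
  obtain u v where uv: "u \<in> P" "v \<in> P" "Im u = ymin P" "Im v = ymax P"
    using Min_in[OF finite_heights heights_nonempty] Max_in[OF finite_heights heights_nonempty] vertices_subset
    by (smt (verit) heights_def imageE subsetD)
  have "connected (Im ` P)"
    using sp_convex convex_connected connected_continuous_image[OF continuous_on_Im[OF continuous_on_id]] by fastforce
  then have "y \<in> Im ` P"
    using uv assms connectedD_interval[of "Im ` P" "ymin P" "ymax P" y] by (metis imageI)
  then show ?thesis by (metis complex_surj imageE)
qed

lemma slice_compact: "compact {x. Complex x y \<in> P}"
proof -
  have "{x. Complex x y \<in> P} = Re ` (P \<inter> {z. Im z = y})"
  proof (intro subset_antisym subsetI)
    fix x assume "x \<in> {x. Complex x y \<in> P}"
    then show "x \<in> Re ` (P \<inter> {z. Im z = y})" by (intro image_eqI[of _ _ "Complex x y"]) auto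
  next
    fix x assume "x \<in> Re ` (P \<inter> {z. Im z = y})"
    then show "x \<in> {x. Complex x y \<in> P}" by auto
  qed
  moreover have c: "compact (P \<inter> {z. Im z = y})"
    using sp_compact closed_halfspace_Im_eq compact_Int_closed by blast
  moreover have "compact (Re ` (P \<inter> {z. Im z = y}))"
    by (intro compact_continuous_image continuous_intros c)
  ultimately show ?thesis by simp
qed

lemma slice_mem_iff:
  assumes "ymin P \<le> y" "y \<le> ymax P"
  shows "Complex x y \<in> P \<longleftrightarrow> lft P y \<le> x \<and> x \<le> rgt P y"
proof -
  let ?S = "{x. Complex x y \<in> P}"
  have ne: "?S \<noteq> {}" using slice_nonempty[OF assms] by auto
  have bd: "bdd_below ?S" "bdd_above ?S" "closed ?S"
    using slice_compact by (auto simp: compact_imp_bounded bounded_imp_bdd_below bounded_imp_bdd_above compact_imp_closed)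
  have l: "Complex (lft P y) y \<in> P" and r: "Complex (rgt P y) y \<in> P"
    using closed_contains_Inf[OF ne bd(1,3)] closed_contains_Sup[OF ne bd(2,3)] by (auto simp: lft_def rgt_def)
  show ?thesis
  proof
    assume "Complex x y \<in> P"
    then show "lft P y \<le> x \<and> x \<le> rgt P y"
      using bd by (auto simp: lft_def rgt_def intro!: cInf_lower cSup_upper)
  next
    assume x: "lft P y \<le> x \<and> x \<le> rgt P y"
    then have "Complex x y \<in> closed_segment (Complex (lft P y) y) (Complex (rgt P y) y)"
      by (simp add: closed_segment_same_Im closed_segment_eq_real_ivl)
    then show "Complex x y \<in> P"
      using l r sp_convex convex_contains_segment by blast
  qed
qed

lemma lft_le_rgt:
  assumes "ymin P \<le> y" "y \<le> ymax P"
  shows "lft P y \<le> rgt P y"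
  using slice_nonempty[OF assms] slice_mem_iff[OF assms] by force

lemma mirror_center:
  assumes c: "mirror c ` P = P" and y: "ymin P \<le> y" "y \<le> ymax P"
  shows "lft P y + rgt P y = 2 * c"
proof -
  have m: "Complex x y \<in> P \<Longrightarrow> Complex (2 * c - x) y \<in> P" for x
    using c by (metis imageI mirror_def complex.sel)
  have "Complex (lft P y) y \<in> P" "Complex (rgt P y) y \<in> P"
    using slice_mem_iff[OF y] lft_le_rgt[OF y] by auto
  then have "Complex (2 * c - lft P y) y \<in> P" "Complex (2 * c - rgt P y) y \<in> P" using m by auto
  then show ?thesis using slice_mem_iff[OF y] by fastforce
qed

lemma ymin_le_ymax: "ymin P \<le> ymax P"
  using finite_heights heights_nonempty by simp

text \<open>A symmetry axis bisects every slice, so the lowest slice alone shows that the axis is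
  unique.\<close>

lemma sym_axis_eq:
  assumes "ymin P \<le> y" "y \<le> ymax P"
  shows "lft P y + rgt P y = 2 * sym_axis P"
proof -
  obtain c where c: "mirror c ` P = P" using sp_symmetric by (auto simp: vertically_symmetric_def)
  have "sym_axis P = c" unfolding sym_axis_def
  proof (rule the_equality[where P = "\<lambda>c. mirror c ` P = P", OF c])
    fix c' assume "mirror c' ` P = P"
    then show "c' = c" using mirror_center[of c' "ymin P"] mirror_center[OF c, of "ymin P"] ymin_le_ymax by simp
  qed
  then show ?thesis using mirror_center[OF c assms] by simp
qed

lemma lft_rgt_eq:
  assumes "ymin P \<le> y" "y \<le> ymax P"
  shows "lft P y = sym_axis P - hw y" "rgt P y = sym_axis P + hw y"
  using sym_axis_eq[OF assms] by (auto simp: half_width_def field_simps)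

lemma half_width_nonneg:
  assumes "ymin P \<le> y" "y \<le> ymax P"
  shows "hw y \<ge> 0"
  using lft_le_rgt[OF assms] by (simp add: half_width_def)

lemma mem_iff:
  "z \<in> P \<longleftrightarrow> ymin P \<le> Im z \<and> Im z \<le> ymax P \<and> \<bar>Re z - sym_axis P\<bar> \<le> hw (Im z)"
proof (cases "ymin P \<le> Im z \<and> Im z \<le> ymax P")
  case True
  then show ?thesis using slice_mem_iff[of "Im z" "Re z"] lft_rgt_eq[of "Im z"] by (auto simp: abs_le_iff)
next
  case False
  then show ?thesis using Im_bounds by blast
qed

lemma side_mem:
  assumes "ymin P \<le> y" "y \<le> ymax P" "\<bar>\<sigma>\<bar> \<le> 1"
  shows "side P \<sigma> y \<in> P"
  using assms half_width_nonneg[OF assms(1,2)] unfolding mem_iff by (simp add: abs_mult mult_left_le_one_le)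

lemma half_width_concave:
  assumes "ymin P \<le> y0" "y0 \<le> ymax P" "ymin P \<le> y1" "y1 \<le> ymax P" "0 \<le> t" "t \<le> 1"
  shows "(1 - t) * hw y0 + t * hw y1 \<le> hw ((1 - t) * y0 + t * y1)"
proof -
  have "(1 - t) *\<^sub>R side P 1 y0 + t *\<^sub>R side P 1 y1 \<in> P"
    by (rule convexD_alt[OF sp_convex]) (simp_all add: side_mem assms)
  then have "(1 - t) * (sym_axis P + hw y0) + t * (sym_axis P + hw y1) - sym_axis P
     \<le> hw ((1 - t) * y0 + t * y1)"
    unfolding mem_iff by (simp add: abs_le_iff)
  then show ?thesis by (simp add: algebra_simps)
qed

lemma reflection_eq: "reflection P = mirror (sym_axis P)"
  by (simp add: reflection_def sym_axis_def)

lemma interior_pointE: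
  obtains y where "ymin P < y" "y < ymax P" "hw y > 0"
proof -
  obtain p where "p \<in> interior P" using sp_polygon by (auto simp: convex_polygon_def)
  then obtain \<epsilon> where e: "\<epsilon> > 0" "cball p \<epsilon> \<subseteq> P" by (auto simp: mem_interior_cball)
  have "p + Complex \<epsilon> 0 \<in> P" "p - Complex \<epsilon> 0 \<in> P" "p + Complex 0 \<epsilon> \<in> P" "p - Complex 0 \<epsilon> \<in> P"
    using e by (auto simp: subset_iff dist_norm norm_complex_def)
  then show ?thesis using that[of "Im p"] e(1) unfolding mem_iff by auto
qed

lemma ymin_less_ymax: "ymin P < ymax P"
  using interior_pointE by fastforce

lemma half_width_pos:
  assumes "ymin P < y" "y < ymax P"
  shows "hw y > 0"
proof -
  obtain y0 where y0: "ymin P < y0" "y0 < ymax P" "hw y0 > 0" by (rule interior_pointE)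
  \<comment> \<open>\<open>l\<close> is the extreme height beyond \<open>y\<close> as seen from
    \<open>y0\<close>, so \<open>y\<close> is a convex combination of the two with positive weight
    on \<open>y0\<close>.\<close>
  define l where "l = (if y \<le> y0 then ymin P else ymax P)"
  define t where "t = (y - l) / (y0 - l)"
  have l: "ymin P \<le> l" "l \<le> ymax P" "y0 \<noteq> l" using y0 ymin_le_ymax by (auto simp: l_def)
  have t: "0 < t" "t \<le> 1" using assms y0 by (auto simp: l_def t_def divide_simps)
  have "t * (y0 - l) = y - l" using l(3) by (simp add: t_def)
  then have "y = (1 - t) * l + t * y0" by (simp add: algebra_simps)
  then have "hw y \<ge> (1 - t) * hw l + t * hw y0"
    using half_width_concave[OF l(1,2), of y0 t] y0 t by simp
  moreover have "(1 - t) * hw l \<ge> 0" using t half_width_nonneg[OF l(1,2)] by simp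
  moreover have "t * hw y0 > 0" using t y0 by simp
  ultimately show ?thesis by linarith
qed

text \<open>A point strictly inside a slice lies in the open segment between the slice ends, and a
  face that meets an open segment of \<open>P\<close> contains its end points. So an edge either
  contains a whole slice or consists of slice ends.\<close>

lemma face_contains_slice_ends:
  assumes "e face_of P" "z \<in> e" "\<bar>Re z - sym_axis P\<bar> < hw (Im z)"
  shows "side P (-1) (Im z) \<in> e" "side P 1 (Im z) \<in> e"
proof -
  have z: "z \<in> P" using assms face_of_imp_subset by blast
  define w where "w = hw (Im z)"
  have w: "w > 0" "\<bar>Re z - sym_axis P\<bar> < w" using assms(3) by (auto simp: w_def)
  define t where "t = (Re z - sym_axis P + w) / (2 * w)"
  have t: "0 < t" "t < 1" using w by (auto simp: t_def divide_simps)
  have "2 * w * t = Re z - sym_axis P + w" using w by (simp add: t_def)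
  then have "z = (1 - t) *\<^sub>R side P (-1) (Im z) + t *\<^sub>R side P 1 (Im z)"
    by (simp add: complex_eq_iff w_def[symmetric] algebra_simps)
  moreover have "side P (-1) (Im z) \<noteq> side P 1 (Im z)" using w by (simp add: complex_eq_iff w_def[symmetric])
  ultimately have "z \<in> open_segment (side P (-1) (Im z)) (side P 1 (Im z))"
    using t unfolding in_segment by blast
  moreover have "side P (-1) (Im z) \<in> P" "side P 1 (Im z) \<in> P"
    using z side_mem[of "Im z"] by (auto simp: mem_iff)
  ultimately show "side P (-1) (Im z) \<in> e" "side P 1 (Im z) \<in> e"
    using assms(1,2) face_ofD by blast+
qed

lemma slice_segment:
  assumes "z \<in> P"
  shows "z \<in> closed_segment (side P (-1) (Im z)) (side P 1 (Im z))"
  using assms unfolding mem_iff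
  by (simp add: closed_segment_same_Im closed_segment_eq_real_ivl abs_le_iff)

text \<open>The midpoint of the edge lies strictly inside its slice, so the edge is the whole slice.
  At an intermediate height it would also meet the open segment of the axis and, being a face,
  contain the lowest point of the axis.\<close>

lemma horizontal_edgeE:
  assumes "e edge_of P" "horizontal e"
  obtains h where "h = ymin P \<or> h = ymax P" "e = {z \<in> P. Im z = h}" "hw h > 0"
proof -
  have f: "e face_of P" using assms(1) by (simp add: edge_of_def)
  have ce: "convex e" using f face_of_imp_convex by blast
  obtain u v where uv: "u \<noteq> v" "e = closed_segment u v" using edge_segment[OF sp_polytope assms(1)] by metis
  have u: "u \<in> e" "v \<in> e" using uv by auto
  define h where "h = Im u"
  have h: "Im z = h" if "z \<in> e" for z using assms(2) that u unfolding horizontal_def h_def by metis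
  have eP: "e \<subseteq> P" using f face_of_imp_subset by blast
  have ne: "Re u \<noteq> Re v" using uv(1) h[OF u(1)] h[OF u(2)] by (auto simp: complex_eq_iff)
  define m where "m = (1/2) *\<^sub>R u + (1/2) *\<^sub>R v"
  have me: "m \<in> e" unfolding m_def using ce u by (intro convexD) auto
  have "\<bar>Re m - sym_axis P\<bar> < hw h"
  proof -
    have "\<bar>Re u - sym_axis P\<bar> \<le> hw h" "\<bar>Re v - sym_axis P\<bar> \<le> hw h"
      using u eP h mem_iff[of u] mem_iff[of v] by auto
    then show ?thesis using ne by (simp add: m_def)
  qed
  then have s: "side P (-1) h \<in> e" "side P 1 h \<in> e" and hp: "hw h > 0"
    using face_contains_slice_ends[OF f me] h[OF me] by auto
  have "h = ymin P \<or> h = ymax P"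
  proof (rule ccontr)
    assume "\<not> ?thesis"
    then have hh: "ymin P < h" "h < ymax P" using u(1) eP h[OF u(1)] mem_iff[of u] by force+
    define t where "t = (h - ymin P) / (ymax P - ymin P)"
    have t: "0 < t" "t < 1" using hh by (auto simp: t_def)
    have "t * (ymax P - ymin P) = h - ymin P" using hh by (simp add: t_def)
    then have "side P 0 h = (1 - t) *\<^sub>R side P 0 (ymin P) + t *\<^sub>R side P 0 (ymax P)"
      by (simp add: complex_eq_iff algebra_simps)
    moreover have "side P 0 (ymin P) \<noteq> side P 0 (ymax P)" using ymin_less_ymax by (simp add: complex_eq_iff)
    ultimately have "side P 0 h \<in> open_segment (side P 0 (ymin P)) (side P 0 (ymax P))"
      using t unfolding in_segment by blast
    moreover have "side P 0 h \<in> e"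
    proof -
      have "side P 0 h = (1/2) *\<^sub>R side P (-1) h + (1/2) *\<^sub>R side P 1 h"
        by (simp add: complex_eq_iff field_simps)
      then show ?thesis using ce s by (metis convexD divide_nonneg_nonneg field_sum_of_halves zero_le_numeral zero_le_one)
    qed
    moreover have "side P 0 (ymin P) \<in> P" "side P 0 (ymax P) \<in> P"
      using side_mem ymin_le_ymax by auto
    ultimately have "side P 0 (ymin P) \<in> e" using f face_ofD by blast
    then have "ymin P = h" using h by force
    then show False using hh by simp
  qed
  moreover have "e = {z \<in> P. Im z = h}"
  proof (intro subset_antisym subsetI)
    fix z assume "z \<in> e" then show "z \<in> {z \<in> P. Im z = h}" using eP h by auto
  next
    fix z assume "z \<in> {z \<in> P. Im z = h}"
    then have "z \<in> closed_segment (side P (-1) h) (side P 1 h)" using slice_segment by blast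
    then show "z \<in> e" using s ce convex_contains_segment by blast
  qed
  ultimately show ?thesis using that hp by blast
qed

lemma gap_bounds:
  assumes "gap P a b"
  shows "ymin P \<le> a" "a < b" "b \<le> ymax P" "a \<in> heights P" "b \<in> heights P"
  using assms finite_heights by (auto simp: gap_def)

text \<open>No point of a non-horizontal edge lies strictly inside its slice, since the edge would
  then contain both slice ends at one height. Concavity of the half-width keeps the edge on one side
  of the axis, and levelness excludes a vertex height in between.\<close>

lemma slanted_edge_aux:
  assumes "e edge_of P" "e = closed_segment u v" "Im u < Im v" "u \<in> vertices P" "v \<in> vertices P"
  shows "\<exists>\<sigma>\<in>{-1,1}. \<exists>a b. gap P a b \<and> e = side P \<sigma> ` {a..b} \<and>
    (\<forall>y\<in>{a..b}. hw y = hw a + (hw b - hw a) * ((y - a) / (b - a)))"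
proof -
  have f: "e face_of P" using assms(1) by (simp add: edge_of_def)
  have eP: "e \<subseteq> P" using f face_of_imp_subset by blast
  define p where "p t = (1 - t) *\<^sub>R u + t *\<^sub>R v" for t
  have e: "e = p ` {0..1}" unfolding assms(2) p_def closed_segment_image_interval ..
  have Imp: "Im (p t) = Im u + t * (Im v - Im u)" for t by (simp add: p_def algebra_simps)
  have on: "\<bar>Re (p t) - sym_axis P\<bar> = hw (Im (p t))" if "t \<in> {0..1}" for t
  proof (rule ccontr)
    assume "\<not> ?thesis"
    moreover have pe: "p t \<in> e" using that e by blast
    ultimately have lt: "\<bar>Re (p t) - sym_axis P\<bar> < hw (Im (p t))" using eP mem_iff[of "p t"] by force
    obtain t1 t2 where t12: "p t1 = side P (-1) (Im (p t))" "p t2 = side P 1 (Im (p t))"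
      using face_contains_slice_ends[OF f pe lt] e by (metis imageE)
    then have "Im (p t1) = Im (p t2)" by simp
    then have "t1 = t2" using assms(3) by (simp add: Imp)
    then show False using t12 lt by (simp add: side_def)
  qed
  define \<sigma> :: real where "\<sigma> = (if Re (p (1/2)) \<ge> sym_axis P then 1 else -1)"
  have sig: "\<sigma> = 1 \<or> \<sigma> = -1" by (simp add: \<sigma>_def)
  have mid: "\<sigma> * (Re (p (1/2)) - sym_axis P) = hw (Im (p (1/2)))"
    using on[of "1/2"] by (auto simp: \<sigma>_def)
  have uP: "u \<in> P" "v \<in> P" using assms(4,5) vertices_subset by auto
  have ub: "ymin P \<le> Im u" "Im u \<le> ymax P" "ymin P \<le> Im v" "Im v \<le> ymax P" using uP mem_iff by auto
  have conc: "hw (Im (p t)) \<ge> (1 - t) * hw (Im u) + t * hw (Im v)"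
    if "t \<in> {0..1}" for t
    using half_width_concave[OF ub, of t] that by (simp add: p_def)
  have Rep: "\<sigma> * (Re (p t) - sym_axis P) = (1 - t) * (\<sigma> * (Re u - sym_axis P)) + t * (\<sigma> * (Re v - sym_axis P))" for t
    by (simp add: p_def algebra_simps)
  have le: "\<sigma> * (Re u - sym_axis P) \<le> hw (Im u)" "\<sigma> * (Re v - sym_axis P) \<le> hw (Im v)"
    using uP sig unfolding mem_iff by auto
  \<comment> \<open>At the midpoint the average of the two signed distances equals the half-width,
    which by concavity is at least the average of the half-widths at the ends. So both bounds in
    \<open>le\<close> are equalities.\<close>
  have eqs: "\<sigma> * (Re u - sym_axis P) = hw (Im u)" "\<sigma> * (Re v - sym_axis P) = hw (Im v)"
    using le mid conc[of "1/2"] unfolding Rep by auto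
  have hw: "\<sigma> * (Re (p t) - sym_axis P) = hw (Im (p t))"
    "hw (Im (p t)) = (1 - t) * hw (Im u) + t * hw (Im v)" if t: "t \<in> {0..1}" for t
  proof -
    have 1: "\<sigma> * (Re (p t) - sym_axis P) = (1 - t) * hw (Im u) + t * hw (Im v)"
      unfolding Rep eqs ..
    moreover have "\<dots> \<ge> 0"
      using t half_width_nonneg[OF ub(1,2)] half_width_nonneg[OF ub(3,4)] by auto
    ultimately have "\<sigma> * (Re (p t) - sym_axis P) \<ge> 0" by simp
    then have "\<sigma> * (Re (p t) - sym_axis P) = \<bar>Re (p t) - sym_axis P\<bar>" using sig by auto
    then show "\<sigma> * (Re (p t) - sym_axis P) = hw (Im (p t))" using on[OF t] by simp
    then show "hw (Im (p t)) = (1 - t) * hw (Im u) + t * hw (Im v)" using 1 by simp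
  qed
  have ps: "p t = side P \<sigma> (Im (p t))" if "t \<in> {0..1}" for t
    using hw(1)[OF that, symmetric] sig by (auto simp: complex_eq_iff)
  have param: "\<exists>t\<in>{0..1}. y = Im (p t) \<and> t = (y - Im u) / (Im v - Im u)" if "y \<in> {Im u..Im v}" for y
    using that assms(3) by (intro bexI[of _ "(y - Im u) / (Im v - Im u)"]) (auto simp: Imp)
  have range: "Im (p t) \<in> {Im u..Im v}" if "t \<in> {0..1}" for t
  proof -
    have "0 \<le> t * (Im v - Im u)" "t * (Im v - Im u) \<le> Im v - Im u"
      using that assms(3) by (auto intro: mult_left_le_one_le)
    then show ?thesis by (simp add: Imp)
  qed
  have "e = side P \<sigma> ` {Im u..Im v}"
  proof (intro subset_antisym subsetI)
    fix z assume "z \<in> e"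
    then obtain t where "t \<in> {0..1}" "z = p t" unfolding e by blast
    then show "z \<in> side P \<sigma> ` {Im u..Im v}" using ps range by blast
  next
    fix z assume "z \<in> side P \<sigma> ` {Im u..Im v}"
    then obtain y where y: "y \<in> {Im u..Im v}" "z = side P \<sigma> y" by blast
    then obtain t where "t \<in> {0..1}" "y = Im (p t)" using param by blast
    then show "z \<in> e" using ps y e by auto
  qed
  moreover have "hw y = hw (Im u) + (hw (Im v) - hw (Im u)) * ((y - Im u) / (Im v - Im u))"
    if "y \<in> {Im u..Im v}" for y
  proof -
    obtain t where t: "t \<in> {0..1}" "y = Im (p t)" "t = (y - Im u) / (Im v - Im u)" using param[OF \<open>y \<in> _\<close>] by blast
    show ?thesis using hw(2)[OF t(1)] unfolding t(3)[symmetric] t(2)[symmetric] by (simp add: algebra_simps)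
  qed
  moreover have "gap P (Im u) (Im v)"
  proof -
    have nh: "\<not> horizontal e" using assms(3) unfolding horizontal_def assms(2)
      using ends_in_segment[of u v] by fastforce
    have "\<not> (Im u < Im w \<and> Im w < Im v)" if w: "w \<in> vertices P" for w
    proof
      assume *: "Im u < Im w \<and> Im w < Im v"
      then obtain t where t: "t \<in> {0..1}" "Im w = Im (p t)" using param[of "Im w"] by fastforce
      then have "t \<noteq> 0" "t \<noteq> 1" using * by (auto simp: Imp)
      then have "0 < t" "t < 1" using t(1) by auto
      moreover have uv: "u \<noteq> v" using assms(3) by auto
      ultimately have "p t \<in> open_segment u v" unfolding p_def in_segment by blast
      with uv have "p t \<in> rel_interior e" by (simp add: assms(2) rel_interior_closed_segment)
      then show False using sp_level w nh assms(1) t(2) unfolding level_polygon_def by metis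
    qed
    then show ?thesis using assms(3,4,5) by (auto simp: gap_def heights_def)
  qed
  ultimately show ?thesis using sig by blast
qed

lemma slanted_edge_affineE:
  assumes "e edge_of P" "\<not> horizontal e"
  obtains \<sigma> a b where "\<sigma> = -1 \<or> \<sigma> = 1" "gap P a b" "e = side P \<sigma> ` {a..b}"
    "\<And>y. y \<in> {a..b} \<Longrightarrow> hw y = hw a + (hw b - hw a) * ((y - a) / (b - a))"
proof -
  obtain u v where uv: "e = closed_segment u v" "u \<in> vertices P" "v \<in> vertices P"
    using edge_segment[OF sp_polytope assms(1)] by metis
  have "Im u \<noteq> Im v"
  proof
    assume "Im u = Im v"
    then have "horizontal e" unfolding horizontal_def uv(1)
      by (intro exI[of _ "Im v"]) (auto simp: in_segment simp flip: distrib_right)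
    then show False using assms(2) by simp
  qed
  then consider "Im u < Im v" | "Im v < Im u" by linarith
  then show ?thesis
  proof cases
    case 1
    then show ?thesis using slanted_edge_aux[OF assms(1) uv(1) 1 uv(2,3)] that by blast
  next
    case 2
    have "e = closed_segment v u" using uv(1) closed_segment_commute by metis
    from slanted_edge_aux[OF assms(1) this 2 uv(3,2)] show ?thesis using that by blast
  qed
qed

lemma slanted_edgeE:
  assumes "e edge_of P" "\<not> horizontal e"
  obtains \<sigma> a b where "\<sigma> = -1 \<or> \<sigma> = 1" "gap P a b" "e = side P \<sigma> ` {a..b}"
  by (rule slanted_edge_affineE[OF assms]) (rule that)

lemma gap_unique:
  assumes "gap P a b" "gap P a' b'" "a < y" "y < b" "a' \<le> y" "y \<le> b'"
  shows "a' = a" "b' = b"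
  using assms unfolding gap_def by (metis linorder_not_le order.strict_trans2 order.strict_trans1 nle_le)+

lemma side_not_interior:
  assumes "\<sigma> = -1 \<or> \<sigma> = 1"
  shows "side P \<sigma> y \<notin> interior P"
proof
  assume "side P \<sigma> y \<in> interior P"
  then obtain \<epsilon> where e: "\<epsilon> > 0" "cball (side P \<sigma> y) \<epsilon> \<subseteq> P" by (auto simp: mem_interior_cball)
  have "side P \<sigma> y + Complex (\<sigma> * \<epsilon>) 0 \<in> P"
    using e assms by (auto simp: subset_iff dist_norm norm_complex_def)
  then show False using assms e(1) by (auto simp: mem_iff)
qed

text \<open>The slice end halfway up lies on some edge. Its height rules out a horizontal edge and
  every other pair of consecutive vertex heights, and the positive half-width there identifies the
  side.\<close>

lemma gap_side:
  assumes g: "gap P a b" and \<sigma>: "\<sigma> = -1 \<or> \<sigma> = 1"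
  shows side_edge: "side P \<sigma> ` {a..b} edge_of P"
    and half_width_affine: "y \<in> {a..b} \<Longrightarrow> hw y = hw a + (hw b - hw a) * ((y - a) / (b - a))"
proof -
  define y0 where "y0 = (a + b) / 2"
  have y0: "a < y0" "y0 < b" "ymin P < y0" "y0 < ymax P" using gap_bounds[OF g] by (auto simp: y0_def)
  have "side P \<sigma> y0 \<in> P" using side_mem y0 \<sigma> by auto
  then obtain e where e: "e edge_of P" "side P \<sigma> y0 \<in> e"
    using frontier_edge[OF sp_polygon _ side_not_interior[OF \<sigma>]] by metis
  have nh: "\<not> horizontal e"
  proof
    assume "horizontal e"
    then obtain h where "h = ymin P \<or> h = ymax P" "e = {z \<in> P. Im z = h}" by (rule horizontal_edgeE[OF e(1)])
    then show False using e(2) y0 by auto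
  qed
  obtain \<sigma>' a' b' where s: "\<sigma>' = -1 \<or> \<sigma>' = 1" "gap P a' b'" "e = side P \<sigma>' ` {a'..b'}"
    "\<And>y. y \<in> {a'..b'} \<Longrightarrow> hw y = hw a' + (hw b' - hw a') * ((y - a') / (b' - a'))"
    using slanted_edge_affineE[OF e(1) nh] by blast
  have "side P \<sigma> y0 \<in> side P \<sigma>' ` {a'..b'}" using e(2) s(3) by simp
  then have y': "y0 \<in> {a'..b'}" and eq: "side P \<sigma> y0 = side P \<sigma>' y0" by (metis imageE side_simps(2))+
  have 1: "\<sigma>' = \<sigma>" using eq half_width_pos[OF y0(3,4)] by (auto simp: side_def)
  have "a' \<le> y0" "y0 \<le> b'" using y' by auto
  then have 2: "a' = a" "b' = b" using gap_unique[OF g s(2) y0(1,2)] by blast+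
  show "side P \<sigma> ` {a..b} edge_of P" using e(1) unfolding s(3) 1 2 .
  show "y \<in> {a..b} \<Longrightarrow> hw y = hw a + (hw b - hw a) * ((y - a) / (b - a))"
    using s(4) unfolding 2 .
qed

lemma not_horizontal_side: "gap P a b \<Longrightarrow> \<not> horizontal (side P \<sigma> ` {a..b})"
  unfolding horizontal_def gap_def by (metis atLeastAtMost_iff image_eqI less_irrefl order.refl order_less_imp_le side_simps(2))

lemma vertex_abs:
  assumes "v \<in> vertices P"
  shows "Im v \<in> heights P" "\<bar>Re v - sym_axis P\<bar> = hw (Im v)"
proof -
  show "Im v \<in> heights P" using assms by (simp add: heights_def)
  have f: "{v} face_of P" using assms by (simp add: vertices_def face_of_singleton)
  show "\<bar>Re v - sym_axis P\<bar> = hw (Im v)"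
  proof (rule ccontr)
    assume *: "\<not> ?thesis"
    have "v \<in> P" using assms vertices_subset by auto
    then have lt: "\<bar>Re v - sym_axis P\<bar> < hw (Im v)" using * mem_iff by force
    show False using face_contains_slice_ends[OF f _ lt] lt by (auto simp: side_def complex_eq_iff)
  qed
qed

lemma mirror_mem [simp]: "mirror (sym_axis P) z \<in> P \<longleftrightarrow> z \<in> P"
  unfolding mem_iff by auto

lemma mirror_vertex:
  assumes "v \<in> vertices P" shows "mirror (sym_axis P) v \<in> vertices P"
proof -
  have "mirror (sym_axis P) v \<notin> open_segment a b" if "a \<in> P" "b \<in> P" for a b
  proof
    assume "mirror (sym_axis P) v \<in> open_segment a b"
    then have "v \<in> open_segment (mirror (sym_axis P) a) (mirror (sym_axis P) b)"
      using mirror_open_segment[of "mirror (sym_axis P) v" a b "sym_axis P"] by simp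
    then show False using assms that by (simp add: vertices_def extreme_point_of_def)
  qed
  then show ?thesis using assms by (simp add: vertices_def extreme_point_of_def)
qed

text \<open>The two ends of the slice at a vertex height are a vertex and its mirror image.\<close>

lemma vertices_iff:
  "v \<in> vertices P \<longleftrightarrow> Im v \<in> heights P \<and> \<bar>Re v - sym_axis P\<bar> = hw (Im v)"
proof
  assume "v \<in> vertices P"
  then show "Im v \<in> heights P \<and> \<bar>Re v - sym_axis P\<bar> = hw (Im v)" using vertex_abs by blast
next
  assume v: "Im v \<in> heights P \<and> \<bar>Re v - sym_axis P\<bar> = hw (Im v)"
  then obtain w where w: "w \<in> vertices P" "Im w = Im v" by (auto simp: heights_def)
  then have "\<bar>Re w - sym_axis P\<bar> = \<bar>Re v - sym_axis P\<bar>" using vertex_abs v by metis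
  then have "v = w \<or> v = mirror (sym_axis P) w" using w(2) by (auto simp: complex_eq_iff abs_eq_iff)
  then show "v \<in> vertices P" using w(1) mirror_vertex by blast
qed

lemma trapezoid_interior:
  assumes "gap P a b" "a < Im z" "Im z < b" "\<bar>Re z - sym_axis P\<bar> < hw (Im z)"
  shows "z \<in> interior P"
proof -
  define f where "f y = hw a + (hw b - hw a) * ((y - a) / (b - a))" for y
  have f: "hw y = f y" if "a \<le> y" "y \<le> b" for y
    using half_width_affine[OF assms(1), of 1 y] that by (simp add: f_def)
  let ?U = "{z. a < Im z} \<inter> {z. Im z < b} \<inter> {z. \<bar>Re z - sym_axis P\<bar> < f (Im z)}"
  have "open ?U"
    unfolding f_def by (intro open_Int open_Collect_less continuous_intros) (use assms(1) in \<open>auto simp: gap_def\<close>)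
  moreover have "?U \<subseteq> P" using gap_bounds[OF assms(1)] f unfolding subset_iff mem_iff by force
  moreover have "z \<in> ?U" using assms f by auto
  ultimately show ?thesis by (meson interiorI)
qed

end

section \<open>Gluing and the continuation of geodesics\<close>

context special_poly
begin

lemma mirror_side [simp]: "mirror (sym_axis P) (side P \<sigma> y) = side P (-\<sigma>) y"
  by (simp add: complex_eq_iff)

lemma mirror_edge:
  assumes "e edge_of P" shows "mirror (sym_axis P) ` e edge_of P"
proof (cases "horizontal e")
  case True
  then obtain h where "e = {z \<in> P. Im z = h}" using horizontal_edgeE[OF assms] by blast
  then have m: "mirror (sym_axis P) z \<in> e" if "z \<in> e" for z using that by auto
  have "mirror (sym_axis P) ` e = e"
  proof (intro subset_antisym subsetI)
    fix z assume "z \<in> e"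
    then have "mirror (sym_axis P) (mirror (sym_axis P) z) \<in> mirror (sym_axis P) ` e" using m by blast
    then show "z \<in> mirror (sym_axis P) ` e" by simp
  qed (use m in auto)
  then show ?thesis using assms by simp
next
  case False
  obtain \<sigma> a b where s: "\<sigma> = -1 \<or> \<sigma> = 1" "gap P a b" "e = side P \<sigma> ` {a..b}"
    by (rule slanted_edgeE[OF assms False])
  have "mirror (sym_axis P) ` e = side P (-\<sigma>) ` {a..b}" by (simp add: s(3) image_image)
  then show ?thesis using side_edge[OF s(2), of "-\<sigma>"] s(1) by auto
qed

lemma edge_bounded:
  assumes "e edge_of P" shows "bounded e" "e \<noteq> {}"
  using edge_segment[OF sp_polytope assms] by (metis bounded_closed_segment, metis segment_eq_empty(1))

end

section \<open>The gluing relation, its classes, and straight continuation\<close>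

locale special_surf =
  fixes S :: "'i::finite polygon_surface"
  assumes ss: "special_surface S"
begin

lemma special_poly_S: "special_poly (poly S i)"
  using ss by (simp add: special_surface_def special_poly.intro)

end

sublocale special_surf \<subseteq> P: special_poly "poly S i" for i
  by (rule special_poly_S)

context special_surf
begin

abbreviation P :: "'i \<Rightarrow> complex set" where
  "P i \<equiv> poly S i"

abbreviation hw :: "'i \<Rightarrow> real \<Rightarrow> real" where
  "hw i \<equiv> half_width (P i)"

abbreviation mid :: "'i \<Rightarrow> real" where
  "mid i \<equiv> sym_axis (P i)"

lemma glueE:
  assumes "e edge_of P i"
  obtains j d where "glue S (i, e) = (j, (+) d ` e)" "(+) d ` e edge_of P j"
    "(j, (+) d ` e) \<noteq> (i, e)" "glue S (j, (+) d ` e) = (i, e)"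
    "interior ((+) d ` P i) \<inter> interior (P j) = {}"
    "glue S (i, mirror (mid i) ` e) = (j, mirror (mid j) ` (+) d ` e)"
  using ss assms unfolding special_surface_def P.reflection_eq by metis

text \<open>The surface provides some polygon and some translation for each edge; since the edge is
  bounded, they are the given \<open>j\<close> and \<open>d\<close>.\<close>

lemma glue_edge:
  assumes "e edge_of P i" "glue S (i, e) = (j, (+) d ` e)"
  shows "(+) d ` e edge_of P j" "(j, (+) d ` e) \<noteq> (i, e)" "glue S (j, (+) d ` e) = (i, e)"
    "interior ((+) d ` P i) \<inter> interior (P j) = {}"
    "glue S (i, mirror (mid i) ` e) = (j, mirror (mid j) ` (+) d ` e)"
proof -
  obtain j' d' where *: "glue S (i, e) = (j', (+) d' ` e)" "(+) d' ` e edge_of P j'"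
    "(j', (+) d' ` e) \<noteq> (i, e)" "glue S (j', (+) d' ` e) = (i, e)"
    "interior ((+) d' ` P i) \<inter> interior (P j') = {}"
    "glue S (i, mirror (mid i) ` e) = (j', mirror (mid j') ` (+) d' ` e)"
    using glueE[OF assms(1)] .
  have j: "j' = j" and "(+) d' ` e = (+) d ` e" using *(1) assms(2) by auto
  then have "d' = d" using bounded_translate_eq P.edge_bounded[OF assms(1)] by blast
  with * j show "(+) d ` e edge_of P j" "(j, (+) d ` e) \<noteq> (i, e)" "glue S (j, (+) d ` e) = (i, e)"
    "interior ((+) d ` P i) \<inter> interior (P j) = {}"
    "glue S (i, mirror (mid i) ` e) = (j, mirror (mid j) ` (+) d ` e)" by auto
qed

lemma glued_points_iff:
  "((i, z), (j, w)) \<in> glued_points S \<longleftrightarrow>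
     (\<exists>e d. e edge_of P i \<and> z \<in> e \<and> glue S (i, e) = (j, (+) d ` e) \<and> w = d + z)"
  by (auto simp: glued_points_def)

lemma sym_glued_points: "sym (glued_points S)"
proof (rule symI, safe)
  fix i z j w assume "((i, z), (j, w)) \<in> glued_points S"
  then obtain e d where e: "e edge_of P i" "z \<in> e" "glue S (i, e) = (j, (+) d ` e)" "w = d + z"
    by (auto simp: glued_points_iff)
  have "(+) (- d) ` (+) d ` e = e" by (simp add: image_image)
  then show "((j, w), (i, z)) \<in> glued_points S"
    unfolding glued_points_iff using glue_edge[OF e(1,3)] e
    by (intro exI[of _ "(+) d ` e"] exI[of _ "- d"]) auto
qed

lemma pt_eq_iff: "pt S p = pt S q \<longleftrightarrow> (p, q) \<in> (glued_points S)\<^sup>*"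
proof
  assume "pt S p = pt S q"
  then have "q \<in> pt S p" by (simp add: pt_def)
  then show "(p, q) \<in> (glued_points S)\<^sup>*" by (simp add: pt_def)
next
  have sy: "sym ((glued_points S)\<^sup>*)" using sym_rtrancl[OF sym_glued_points] .
  assume pq: "(p, q) \<in> (glued_points S)\<^sup>*"
  then have "(q, p) \<in> (glued_points S)\<^sup>*" using symD[OF sy] by blast
  then show "pt S p = pt S q" using pq unfolding pt_def by (auto intro: rtrancl_trans)
qed

lemma pt_glue:
  assumes "e edge_of P i" "z \<in> e" "glue S (i, e) = (j, (+) d ` e)"
  shows "pt S (j, d + z) = pt S (i, z)"
  using assms by (metis pt_eq_iff glued_points_iff r_into_rtrancl)

lemma glued_points_vertex:
  assumes "((i, z), (j, w)) \<in> glued_points S"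
  shows "z \<in> vertices (P i) \<longleftrightarrow> w \<in> vertices (P j)"
proof -
  obtain e d where e: "e edge_of P i" "z \<in> e" "glue S (i, e) = (j, (+) d ` e)" "w = d + z"
    using assms by (auto simp: glued_points_iff)
  have f: "e face_of P i" "(+) d ` e face_of P j" using e(1) glue_edge[OF e(1,3)] by (auto simp: edge_of_def)
  have w: "w \<in> (+) d ` e" using e by auto
  have "z \<in> vertices (P i) \<longleftrightarrow> z extreme_point_of e" using extreme_point_of_face[OF f(1)] e(2) by (auto simp: vertices_def)
  also have "\<dots> \<longleftrightarrow> w extreme_point_of (+) d ` e" using extreme_point_of_translation_eq[of d z e] e(4) by simp
  also have "\<dots> \<longleftrightarrow> w \<in> vertices (P j)" using extreme_point_of_face[OF f(2)] w by (auto simp: vertices_def)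
  finally show ?thesis .
qed

lemma glued_points_star_vertex:
  assumes "((i, z), q) \<in> (glued_points S)\<^sup>*"
  shows "z \<in> vertices (P i) \<longleftrightarrow> snd q \<in> vertices (poly S (fst q))"
  using assms
proof (induction rule: rtrancl_induct)
  case (step p q)
  then show ?case using glued_points_vertex[of "fst p" "snd p" "fst q" "snd q"] by simp
qed simp

lemma pt_vertex_iff: "pt S (i, z) \<in> vertex_points S \<longleftrightarrow> z \<in> vertices (P i)"
proof
  assume "pt S (i, z) \<in> vertex_points S"
  then obtain j v where "v \<in> vertices (P j)" "pt S (i, z) = pt S (j, v)" by (auto simp: vertex_points_def)
  then show "z \<in> vertices (P i)" using glued_points_star_vertex[of i z "(j, v)"] pt_eq_iff by auto
qed (auto simp: vertex_points_def)

text \<open>Away from the vertices a class has at most two representatives: the edge through a point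
  is unique and the gluing is an involution, so a second step of the relation leads back.\<close>

lemma pt_cases:
  assumes "pt S (i, z) = pt S (j, w)" "z \<notin> vertices (P i)"
  obtains "j = i" "w = z"
  | e d where "e edge_of P i" "z \<in> e" "glue S (i, e) = (j, (+) d ` e)" "w = d + z"
proof -
  have "q = (i, z) \<or> ((i, z), q) \<in> glued_points S" if "((i, z), q) \<in> (glued_points S)\<^sup>*" for q
    using that
  proof (induction rule: rtrancl_induct)
    case (step p q)
    obtain j w k x where pq: "p = (j, w)" "q = (k, x)" by fastforce
    show ?case
    proof (cases "p = (i, z)")
      case False
      then have gp: "((i, z), (j, w)) \<in> glued_points S" using step.IH pq by auto
      then obtain e d where e: "e edge_of P i" "z \<in> e" "glue S (i, e) = (j, (+) d ` e)" "w = d + z"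
        by (auto simp: glued_points_iff)
      obtain f d' where f: "f edge_of P j" "w \<in> f" "glue S (j, f) = (k, (+) d' ` f)" "x = d' + w"
        using step.hyps(2) pq by (auto simp: glued_points_iff)
      have nv: "w \<notin> vertices (P j)" using glued_points_vertex[OF gp] assms(2) by simp
      have fe: "f = (+) d ` e"
        using edge_unique[OF P.sp_polytope f(1) glue_edge(1)[OF e(1,3)] f(2) _ nv] e by auto
      have k: "k = i" and tr: "(+) d' ` (+) d ` e = e" using f(3) glue_edge(3)[OF e(1,3)] unfolding fe by auto
      have "(+) (d' + d) ` e = (+) 0 ` e" using tr by (simp add: image_image add.assoc)
      then have "d' + d = 0" using bounded_translate_eq P.edge_bounded[OF e(1)] by blast
      then have "x = z" using f(4) e(4) by (simp add: add.assoc[symmetric])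
      then show ?thesis using pq k by simp
    qed (use step.hyps in auto)
  qed simp
  then have "(j, w) = (i, z) \<or> ((i, z), (j, w)) \<in> glued_points S" using assms(1) pt_eq_iff by blast
  then show ?thesis using that by (auto simp: glued_points_iff)
qed

text \<open>The two polygons at a gluing lie on opposite sides of the common edge, so a direction can
  point into both of them only along that edge.\<close>

lemma segment_unique:
  assumes x: "x \<in> P i" "x' \<in> P i" and y: "y \<in> P j" "y + (x' - x) \<in> P j"
    and eq: "pt S (i, x) = pt S (j, y)" and nv: "x \<notin> vertices (P i)"
  shows "pt S (i, x') = pt S (j, y + (x' - x))"
  using eq nv
proof (cases rule: pt_cases)
  case (2 e d)
  note e = this
  note ge = glue_edge[OF e(1,3)]
  have "((i, x), (j, y)) \<in> glued_points S" unfolding glued_points_iff using e by blast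
  then have nvy: "y \<notin> vertices (P j)" using glued_points_vertex nv by blast
  have xe: "x' \<in> e"
  proof (rule ccontr)
    assume nx: "x' \<notin> e"
    then have ne: "x \<noteq> x'" using e by auto
    \<comment> \<open>If the segment left the common edge, its midpoint would be interior to both
      polygons.\<close>
    define m where "m = (1/2) *\<^sub>R x + (1/2) *\<^sub>R x'"
    have m: "m \<in> open_segment x x'" unfolding in_segment m_def using ne by (intro conjI exI[of _ "1/2"]) auto
    have m': "d + m \<in> open_segment y (y + (x' - x))"
      using m unfolding e(4) by (simp add: open_segment_translation_eq[of d m x x', simplified] algebra_simps)
    have fe: "e face_of P i" "(+) d ` e face_of P j" using e(1) ge(1) by (auto simp: edge_of_def)
    have mP: "m \<in> P i" using m x P.sp_convex[of i] by (meson convex_contains_open_segment subsetD)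
    have mP': "d + m \<in> P j" using m' y P.sp_convex[of j] by (meson convex_contains_open_segment subsetD)
    have mi: "m \<in> interior (P i)"
    proof (rule ccontr)
      assume "m \<notin> interior (P i)"
      then obtain e' where e': "e' edge_of P i" "m \<in> e'" using frontier_edge[OF P.sp_polygon mP] by blast
      then have "x \<in> e'" "x' \<in> e'" using face_ofD[OF _ m x] by (auto simp: edge_of_def)
      then have "e' = e" using edge_unique[OF P.sp_polytope e'(1) e(1) _ e(2) nv] by blast
      then show False using \<open>x' \<in> e'\<close> nx by simp
    qed
    have "d + m \<in> interior (P j)"
    proof (rule ccontr)
      assume "d + m \<notin> interior (P j)"
      then obtain e' where e': "e' edge_of P j" "d + m \<in> e'" using frontier_edge[OF P.sp_polygon mP'] by blast
      then have "y \<in> e'" "y + (x' - x) \<in> e'" using face_ofD[OF _ m' y] by (auto simp: edge_of_def)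
      then have "e' = (+) d ` e" using edge_unique[OF P.sp_polytope e'(1) ge(1) _ _ nvy] e by blast
      then have "d + x' \<in> (+) d ` e" using \<open>y + (x' - x) \<in> e'\<close> e(4) by (simp add: algebra_simps)
      then show False using nx by auto
    qed
    moreover have "d + m \<in> interior ((+) d ` P i)" using mi by (simp add: interior_translation)
    ultimately show False using ge(4) by blast
  qed
  have sh: "y + (x' - x) = d + x'" using e(4) by simp
  show ?thesis unfolding sh using pt_glue[OF e(1) xe e(3)] by simp
qed simp

lemma geodesic_point:
  assumes "geodesic_on S J g v" "s \<in> J"
  shows "g s \<in> points S" "g s \<notin> vertex_points S"
  using assms by (auto simp: geodesic_on_def)

text \<open>Agreement of the geodesic with the straight line in \<open>P i\<close> is a locally
  constant property of the time, and the parameter segment is connected. A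
  \<open>closed_segment\<close> has no orientation, so this also continues backwards in
  time.\<close>

lemma geodesic_continues:
  assumes g: "geodesic_on S J g v" and J: "closed_segment s0 s1 \<subseteq> J"
    and z: "g s0 = pt S (i, z)" "z \<in> P i" "z + (s1 - s0) *\<^sub>R v \<in> P i"
    and s: "s \<in> closed_segment s0 s1"
  shows "g s = pt S (i, z + (s - s0) *\<^sub>R v)"
proof -
  define l where "l r = z + (r - s0) *\<^sub>R v" for r
  have lP: "l r \<in> P i" if r: "r \<in> closed_segment s0 s1" for r
  proof -
    obtain u where u: "0 \<le> u" "u \<le> 1" "r = (1 - u) *\<^sub>R s0 + u *\<^sub>R s1" using r by (auto simp: in_segment)
    have "l r = (1 - u) *\<^sub>R z + u *\<^sub>R (z + (s1 - s0) *\<^sub>R v)"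
      unfolding l_def u(3) by (simp add: algebra_simps)
    then show ?thesis using convexD_alt[OF P.sp_convex z(2,3) u(1,2)] by simp
  qed
  have key: "g r = pt S (i, l r)"
    if st: "straight_on S J' g v" and r: "r \<in> J'" "r' \<in> J'" "r \<in> closed_segment s0 s1" "r' \<in> closed_segment s0 s1"
      and gr: "g r' = pt S (i, l r')" for J' r r'
  proof -
    obtain j w where w: "\<And>s. s \<in> J' \<Longrightarrow> w + s *\<^sub>R v \<in> P j \<and> g s = pt S (j, w + s *\<^sub>R v)"
      using st unfolding straight_on_def by metis
    have nv: "l r' \<notin> vertices (P i)" using geodesic_point(2)[OF g] gr pt_vertex_iff r(4) J by (metis subsetD)
    have sh: "w + r' *\<^sub>R v + (l r - l r') = w + r *\<^sub>R v" by (simp add: l_def algebra_simps)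
    have "pt S (i, l r) = pt S (j, w + r' *\<^sub>R v + (l r - l r'))"
      by (rule segment_unique[OF lP[OF r(4)] lP[OF r(3)]], unfold sh) (use w[OF r(1)] w[OF r(2)] gr nv in auto)
    then show ?thesis using w[OF r(1)] sh by simp
  qed
  have "(g s0 = pt S (i, l s0)) = (g s = pt S (i, l s))"
  proof (rule connected_local_const[of "closed_segment s0 s1"])
    show "connected (closed_segment s0 s1)" by simp
    show "s0 \<in> closed_segment s0 s1" "s \<in> closed_segment s0 s1" using s by auto
    show "\<forall>a\<in>closed_segment s0 s1. \<forall>\<^sub>F b in at a within closed_segment s0 s1.
       (g a = pt S (i, l a)) = (g b = pt S (i, l b))"
    proof
      fix a assume a: "a \<in> closed_segment s0 s1"
      then obtain \<epsilon> where e: "\<epsilon> > 0" "straight_on S (J \<inter> {a - \<epsilon>..a}) g v" "straight_on S (J \<inter> {a..a + \<epsilon>}) g v"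
        using g J unfolding geodesic_on_def by blast
      show "\<forall>\<^sub>F b in at a within closed_segment s0 s1. (g a = pt S (i, l a)) = (g b = pt S (i, l b))"
        unfolding eventually_at
      proof (intro exI[of _ \<epsilon>] conjI ballI impI, rule e(1))
        fix b assume b: "b \<in> closed_segment s0 s1" "b \<noteq> a \<and> dist b a < \<epsilon>"
        define I where "I = J \<inter> (if a \<le> b then {a..a + \<epsilon>} else {a - \<epsilon>..a})"
        have I: "a \<in> I" "b \<in> I" "straight_on S I g v" using a b J e by (auto simp: I_def dist_real_def)
        show "(g a = pt S (i, l a)) = (g b = pt S (i, l b))"
          using key[OF I(3) I(1,2) a b(1)] key[OF I(3) I(2,1) b(1) a] by blast
      qed
    qed
  qed
  then show ?thesis using z(1) by (simp add: l_def)
qed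

section \<open>The flip as a map of the surface\<close>

lemma glued_points_mirror:
  assumes "((i, z), (j, w)) \<in> glued_points S"
  shows "((i, mirror (mid i) z), (j, mirror (mid j) w)) \<in> glued_points S"
proof -
  obtain e d where e: "e edge_of P i" "z \<in> e" "glue S (i, e) = (j, (+) d ` e)" "w = d + z"
    using assms by (auto simp: glued_points_iff)
  \<comment> \<open>Composing the translation by \<open>d\<close> with the reflections at both ends
    gives the translation by \<open>d'\<close>.\<close>
  define d' where "d' = Complex (2 * mid j - 2 * mid i - Re d) (Im d)"
  have tr: "mirror (mid j) (d + x) = d' + mirror (mid i) x" for x
    by (simp add: complex_eq_iff d'_def)
  then have "mirror (mid j) ` (+) d ` e = (+) d' ` mirror (mid i) ` e"
    by (simp add: image_image)
  then have "glue S (i, mirror (mid i) ` e) = (j, (+) d' ` mirror (mid i) ` e)"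
    using glue_edge(5)[OF e(1,3)] by simp
  then show ?thesis unfolding glued_points_iff using P.mirror_edge[OF e(1)] e(2,4) tr by blast
qed

lemma pt_points [simp]: "z \<in> P i \<Longrightarrow> pt S (i, z) \<in> points S"
  unfolding points_def by blast

text \<open>The flip acts on a class as a set of representatives. That the image is again a whole
  class uses the compatibility of the gluing with the reflections in both directions, by way of the
  involution \<open>m\<close>.\<close>

lemma flip_pt: "flip S (pt S (i, z)) = pt S (i, mirror (mid i) z)"
proof -
  define m where "m = (\<lambda>(i, z). (i :: 'i, mirror (mid i) z))"
  have mm: "m (m p) = p" for p by (cases p) (simp add: m_def)
  have st: "(m p, m q) \<in> (glued_points S)\<^sup>*" if "(p, q) \<in> (glued_points S)\<^sup>*" for p q
    using that
  proof (induction rule: rtrancl_induct)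
    case (step q r)
    have "(m q, m r) \<in> glued_points S"
      using step.hyps(2) glued_points_mirror by (cases q, cases r) (auto simp: m_def)
    then show ?case using step.IH by simp
  qed simp
  have "flip S (pt S (i, z)) = m ` pt S (i, z)"
    unfolding flip_def P.reflection_eq m_def ..
  also have "\<dots> = pt S (m (i, z))"
    unfolding pt_def
  proof (intro subset_antisym subsetI)
    fix q assume "q \<in> m ` ((glued_points S)\<^sup>* `` {(i, z)})"
    then show "q \<in> (glued_points S)\<^sup>* `` {m (i, z)}" using st by blast
  next
    fix q assume "q \<in> (glued_points S)\<^sup>* `` {m (i, z)}"
    then have "(m (m (i, z)), m q) \<in> (glued_points S)\<^sup>*" using st by blast
    then have "m (m q) \<in> m ` ((glued_points S)\<^sup>* `` {(i, z)})" by (intro imageI) (simp add: mm)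
    then show "q \<in> m ` ((glued_points S)\<^sup>* `` {(i, z)})" by (simp add: mm)
  qed
  finally show ?thesis by (simp add: m_def)
qed

lemma geodesic_flip:
  assumes "geodesic_on S J g v"
  shows "geodesic_on S J (flip S \<circ> g) (Complex (- Re v) (Im v))"
proof -
  let ?v = "Complex (- Re v) (Im v)"
  have st: "straight_on S J' (flip S \<circ> g) ?v" if st: "straight_on S J' g v" for J'
  proof -
    obtain i z where z: "\<And>s. s \<in> J' \<Longrightarrow> z + s *\<^sub>R v \<in> P i \<and> g s = pt S (i, z + s *\<^sub>R v)"
      using st unfolding straight_on_def by metis
    let ?m = "mirror (mid i)"
    have eq: "?m z + s *\<^sub>R ?v = ?m (z + s *\<^sub>R v)" for s
      by (simp add: complex_eq_iff)
    show ?thesis unfolding straight_on_def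
      by (intro exI[of _ i] exI[of _ "?m z"]) (use z in \<open>auto simp: eq flip_pt\<close>)
  qed
  have pts: "flip S X \<in> points S - vertex_points S" if X: "X \<in> points S - vertex_points S" for X
  proof -
    obtain i z where z: "X = pt S (i, z)" "z \<in> P i" using X by (auto simp: points_def)
    have "z \<notin> vertices (P i)" using X z pt_vertex_iff by auto
    then have "mirror (mid i) z \<notin> vertices (P i)" using P.mirror_vertex by fastforce
    then show ?thesis using z pt_vertex_iff by (simp add: flip_pt)
  qed
  show ?thesis using assms st pts unfolding geodesic_on_def comp_def by meson
qed

lemma flip_flip: "X \<in> points S \<Longrightarrow> flip S (flip S X) = X"
  by (auto simp: points_def flip_pt)

lemma flip_points: "X \<in> points S \<Longrightarrow> flip S X \<in> points S"
  unfolding points_def using flip_pt P.mirror_mem by blast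

end

section \<open>Cylinders of two trapezoids\<close>

lemma horizontal_Im: "horizontal e \<Longrightarrow> x \<in> Im ` e \<Longrightarrow> y \<in> Im ` e \<Longrightarrow> x = y"
  by (auto simp: horizontal_def)

context special_poly
begin

lemma gap_above:
  assumes "h \<in> heights P" "h < ymax P"
  obtains b where "gap P h b"
proof -
  define B where "B = {y \<in> heights P. h < y}"
  have "ymax P \<in> B" using assms finite_heights heights_nonempty by (simp add: B_def)
  then have B: "finite B" "B \<noteq> {}" using finite_heights by (auto simp: B_def)
  then have "Min B \<in> B" "\<And>y. y \<in> B \<Longrightarrow> Min B \<le> y" by auto
  then have "gap P h (Min B)" using assms by (fastforce simp: gap_def B_def)
  then show ?thesis using that by blast
qed

lemma gap_below:
  assumes "h \<in> heights P" "ymin P < h"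
  obtains a where "gap P a h"
proof -
  define B where "B = {y \<in> heights P. y < h}"
  have "ymin P \<in> B" using assms finite_heights heights_nonempty by (simp add: B_def)
  then have B: "finite B" "B \<noteq> {}" using finite_heights by (auto simp: B_def)
  then have "Max B \<in> B" "\<And>y. y \<in> B \<Longrightarrow> y \<le> Max B" by auto
  then have "gap P (Max B) h" using assms by (fastforce simp: gap_def B_def)
  then show ?thesis using that by blast
qed

lemma gap_mem_iff:
  assumes "gap P a b" "a \<le> Im z" "Im z \<le> b"
  shows "z \<in> P \<longleftrightarrow> \<bar>Re z - sym_axis P\<bar> \<le> half_width P (Im z)"
  using gap_bounds[OF assms(1)] assms(2,3) by (auto simp: mem_iff)

lemma gap_half_width_pos: "gap P a b \<Longrightarrow> a < y \<Longrightarrow> y < b \<Longrightarrow> half_width P y > 0"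
  using half_width_pos[of y] gap_bounds[of a b] by auto

lemma gap_half_width_nonneg: "gap P a b \<Longrightarrow> a \<le> y \<Longrightarrow> y \<le> b \<Longrightarrow> half_width P y \<ge> 0"
  using half_width_nonneg[of y] gap_bounds[of a b] by auto

lemma gap_not_vertex: "gap P a b \<Longrightarrow> a < Im z \<Longrightarrow> Im z < b \<Longrightarrow> z \<notin> vertices P"
  using vertices_iff by (auto simp: gap_def)

end

lemma Im_side_image [simp]: "Im ` side P \<sigma> ` A = A"
  by (simp add: image_image)

context special_surf
begin

lemma trapezoids_iff: "(i, a, b) \<in> trapezoids S \<longleftrightarrow> gap (P i) a b"
  by (simp add: trapezoids_def gap_def)

lemma side_glue:
  assumes g: "gap (P i) a b" and \<sigma>: "\<sigma> = -1 \<or> \<sigma> = 1"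
  obtains j c d \<delta> where "gap (P j) c d" "d - c = b - a" "c = a + Im \<delta>"
    "glue S (i, side (P i) \<sigma> ` {a..b}) = (j, side (P j) (-\<sigma>) ` {c..d})"
    "side (P j) (-\<sigma>) ` {c..d} = (+) \<delta> ` side (P i) \<sigma> ` {a..b}"
    "\<And>y. y \<in> {a..b} \<Longrightarrow> \<delta> + side (P i) \<sigma> y = side (P j) (-\<sigma>) (y + Im \<delta>)"
proof -
  let ?e = "side (P i) \<sigma> ` {a..b}"
  have e: "?e edge_of P i" by (rule P.side_edge[OF g \<sigma>])
  obtain j \<delta> where gl: "glue S (i, ?e) = (j, (+) \<delta> ` ?e)" using glueE[OF e] by metis
  note ge = glue_edge[OF e gl]
  have ab: "a < b" using g by (simp add: gap_def)
  have Imf: "Im ` (+) \<delta> ` ?e = {a + Im \<delta>..b + Im \<delta>}"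
  proof -
    have "Im ` (+) \<delta> ` ?e = (+) (Im \<delta>) ` {a..b}" by (simp add: image_image)
    then show ?thesis by (simp add: add.commute)
  qed
  have "\<not> horizontal ((+) \<delta> ` ?e)"
  proof
    assume "horizontal ((+) \<delta> ` ?e)"
    from horizontal_Im[OF this, of "a + Im \<delta>" "b + Im \<delta>"] show False unfolding Imf using ab by auto
  qed
  then obtain \<sigma>' c d where s: "\<sigma>' = -1 \<or> \<sigma>' = 1" "gap (P j) c d" "(+) \<delta> ` ?e = side (P j) \<sigma>' ` {c..d}"
    by (rule P.slanted_edgeE[OF ge(1)])
  have "{c..d} = {a + Im \<delta>..b + Im \<delta>}" using Imf unfolding s(3) by simp
  then have cd: "c = a + Im \<delta>" "d = b + Im \<delta>" using ab s(2) by (auto simp: gap_def Icc_eq_Icc)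
  have tr: "\<delta> + side (P i) \<sigma> y = side (P j) \<sigma>' (y + Im \<delta>)" if "y \<in> {a..b}" for y
  proof -
    have "\<delta> + side (P i) \<sigma> y \<in> side (P j) \<sigma>' ` {c..d}" using that s(3) by blast
    then obtain y' where y': "\<delta> + side (P i) \<sigma> y = side (P j) \<sigma>' y'" by blast
    then have "Im (\<delta> + side (P i) \<sigma> y) = Im (side (P j) \<sigma>' y')" by simp
    then have "y' = y + Im \<delta>" by simp
    then show ?thesis using y' by simp
  qed
  \<comment> \<open>If two right sides or two left sides were glued, points slightly inside the
    first trapezoid would be translated into the interior of the second, against the disjointness of
    the interiors.\<close>
  have "\<sigma>' = -\<sigma>"
  proof (rule ccontr)
    assume "\<sigma>' \<noteq> -\<sigma>"
    then have eq: "\<sigma>' = \<sigma>" using s(1) \<sigma> by auto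
    define y where "y = (a + b) / 2"
    have y: "a < y" "y < b" using ab by (auto simp: y_def)
    define \<epsilon> where "\<epsilon> = min (hw i y) (hw j (y + Im \<delta>))"
    have w: "hw i y > 0" "hw j (y + Im \<delta>) > 0"
      using P.gap_half_width_pos[OF g y] P.gap_half_width_pos[OF s(2), of "y + Im \<delta>"] y cd by auto
    have "side (P i) \<sigma> y - of_real (\<sigma> * \<epsilon>) \<in> interior (P i)"
      by (rule P.trapezoid_interior[OF g]) (use y w \<sigma> in \<open>auto simp: \<epsilon>_def min_def\<close>)
    then have "\<delta> + (side (P i) \<sigma> y - of_real (\<sigma> * \<epsilon>)) \<in> interior ((+) \<delta> ` P i)"
      by (simp add: interior_translation)
    moreover have "side (P j) \<sigma> (y + Im \<delta>) - of_real (\<sigma> * \<epsilon>) \<in> interior (P j)"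
      by (rule P.trapezoid_interior[OF s(2)]) (use y w \<sigma> cd in \<open>auto simp: \<epsilon>_def min_def\<close>)
    moreover have "\<delta> + (side (P i) \<sigma> y - of_real (\<sigma> * \<epsilon>)) = side (P j) \<sigma> (y + Im \<delta>) - of_real (\<sigma> * \<epsilon>)"
      using tr[of y] y by (simp add: eq algebra_simps)
    ultimately show False using ge(4) by (metis IntI empty_iff)
  qed
  then show ?thesis using that[of j c d \<delta>] s(2,3) cd gl tr by simp
qed

text \<open>Each trapezoid is the neighbour of the other on both sides, which closes up the
  cylinder. The two may coincide, as for a rectangle glued to itself.\<close>

definition opposite :: "'i \<Rightarrow> real \<Rightarrow> real \<Rightarrow> 'i \<Rightarrow> real \<Rightarrow> real \<Rightarrow> bool" where
  "opposite i a b j c d \<longleftrightarrow> gap (P i) a b \<and> gap (P j) c d \<and> d - c = b - a \<and>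
     glue S (i, side (P i) 1 ` {a..b}) = (j, side (P j) (-1) ` {c..d}) \<and>
     glue S (i, side (P i) (-1) ` {a..b}) = (j, side (P j) 1 ` {c..d})"

lemma opposite_sym:
  assumes "opposite i a b j c d" shows "opposite j c d i a b"
proof -
  have inv: "glue S (j, f) = (i, e)" if "e edge_of P i" "glue S (i, e) = (j, f)" for e f
    using glueE[OF that(1)] that(2) by (metis prod.inject)
  show ?thesis using assms P.side_edge unfolding opposite_def
    by (intro conjI) (auto intro!: inv)
qed

text \<open>Gluing commutes with the reflections, so the reflected gluing of the right side is the
  gluing of the left side: going right and going left lead to the same trapezoid.\<close>

lemma opposite_exists:
  assumes g: "gap (P i) a b"
  obtains j c d where "opposite i a b j c d"
proof -
  obtain j c d \<delta> where s: "gap (P j) c d" "d - c = b - a"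
    "glue S (i, side (P i) 1 ` {a..b}) = (j, side (P j) (-1) ` {c..d})"
    "side (P j) (-1) ` {c..d} = (+) \<delta> ` side (P i) 1 ` {a..b}"
    using side_glue[OF g, of 1] by metis
  have e: "side (P i) 1 ` {a..b} edge_of P i" using P.side_edge[OF g] by simp
  have "glue S (i, side (P i) (-1) ` {a..b}) = (j, side (P j) 1 ` {c..d})"
    using glue_edge(5)[OF e s(3)[unfolded s(4)]] unfolding s(4)[symmetric] by (simp add: image_image)
  then have "opposite i a b j c d" using s(1-3) g by (simp add: opposite_def)
  then show ?thesis using that by blast
qed

text \<open>The glued sides are translates of each other, so with growing height one trapezoid gains
  the half-width that the other loses, and the sum stays constant.\<close>

lemma opposite_pt:
  assumes o: "opposite i a b j c d" and y: "a \<le> y" "y \<le> b"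
  shows "pt S (i, side (P i) 1 y) = pt S (j, side (P j) (-1) (y - a + c))"
    "hw i y + hw j (y - a + c) = hw i a + hw j c"
proof -
  have g: "gap (P i) a b" "gap (P j) c d" using o by (auto simp: opposite_def)
  obtain j' c' d' \<delta> where s: "gap (P j') c' d'" "c' = a + Im \<delta>"
    "glue S (i, side (P i) 1 ` {a..b}) = (j', side (P j') (-1) ` {c'..d'})"
    "side (P j') (-1) ` {c'..d'} = (+) \<delta> ` side (P i) 1 ` {a..b}"
    "\<And>y. y \<in> {a..b} \<Longrightarrow> \<delta> + side (P i) 1 y = side (P j') (-1) (y + Im \<delta>)"
    using side_glue[OF g(1), of 1] by (metis (no_types, lifting))
  have j: "j' = j" and "side (P j) (-1) ` {c..d} = side (P j) (-1) ` {c'..d'}"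
    using o s(3) by (auto simp: opposite_def)
  then have "{c..d} = {c'..d'}" by (metis Im_side_image)
  then have c: "c' = c" using g(2) by (auto simp: gap_def Icc_eq_Icc)
  have e: "side (P i) 1 ` {a..b} edge_of P i" using P.side_edge[OF g(1)] by simp
  have tr: "\<delta> + side (P i) 1 y = side (P j) (-1) (y - a + c)" if "a \<le> y" "y \<le> b" for y
    using s(5)[of y] that s(2) j c by (simp add: algebra_simps)
  show "pt S (i, side (P i) 1 y) = pt S (j, side (P j) (-1) (y - a + c))"
    using pt_glue[OF e _ s(3)[unfolded s(4)], of "side (P i) 1 y"] tr[OF y] y j by auto
  have "Re (\<delta> + side (P i) 1 y) = Re (side (P j) (-1) (y - a + c))"
    "Re (\<delta> + side (P i) 1 a) = Re (side (P j) (-1) c)"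
    using tr[OF y] tr[of a] y by simp_all
  then show "hw i y + hw j (y - a + c) = hw i a + hw j c"
    by simp
qed

lemma side_glued_iff:
  assumes o: "opposite i a b j c d"
  shows "((i, a, b), T) \<in> side_glued S \<longleftrightarrow> T = (j, c, d)"
proof
  have g: "gap (P i) a b" "gap (P j) c d" using o by (auto simp: opposite_def)
  {
    assume "((i, a, b), T) \<in> side_glued S"
    then obtain j' c' d' e f where T: "T = (j', c', d')" "e edge_of P i" "Im ` e = {a..b}" "Im ` f = {c'..d'}"
      "glue S (i, e) = (j', f)" "gap (P j') c' d'"
      by (auto simp: side_glued_def trapezoids_iff)
    have "\<not> horizontal e"
    proof
      assume "horizontal e"
      from horizontal_Im[OF this, of a b] show False using T(3) g(1) by (auto simp: gap_def)
    qed
    then obtain \<sigma> a' b' where s: "\<sigma> = -1 \<or> \<sigma> = 1" "gap (P i) a' b'" "e = side (P i) \<sigma> ` {a'..b'}"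
      by (rule P.slanted_edgeE[OF T(2)])
    have "{a'..b'} = {a..b}" using T(3) s(3) by simp
    then have "e = side (P i) \<sigma> ` {a..b}" using s(3) by metis
    then have "j' = j" "f = side (P j) (-\<sigma>) ` {c..d}" using s(1) T(5) o by (auto simp: opposite_def)
    then have cd: "{c'..d'} = {c..d}" using T(4) by (metis Im_side_image)
    have "c' < d'" "c < d" using T(6) g(2) by (simp_all add: gap_def)
    then have "c' = c" "d' = d" using cd unfolding Icc_eq_Icc by linarith+
    then show "T = (j, c, d)" using T(1) \<open>j' = j\<close> by simp
  }
  assume "T = (j, c, d)"
  moreover have "side (P i) 1 ` {a..b} edge_of P i" "side (P j) (-1) ` {c..d} edge_of P j"
    using P.side_edge g by auto
  ultimately show "((i, a, b), T) \<in> side_glued S"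
    using o g by (auto simp: side_glued_def trapezoids_iff opposite_def)
qed

lemma opposite_cylinder:
  assumes o: "opposite i a b j c d"
  shows "(side_glued S)\<^sup>* `` {(i, a, b)} = {(i, a, b), (j, c, d)}"
proof (intro subset_antisym subsetI)
  fix T assume "T \<in> (side_glued S)\<^sup>* `` {(i, a, b)}"
  then have "((i, a, b), T) \<in> (side_glued S)\<^sup>*" by simp
  then show "T \<in> {(i, a, b), (j, c, d)}"
  proof (induction rule: rtrancl_induct)
    case (step T T')
    then show ?case using side_glued_iff[OF o] side_glued_iff[OF opposite_sym[OF o]] by blast
  qed simp
next
  fix T assume "T \<in> {(i, a, b), (j, c, d)}"
  then show "T \<in> (side_glued S)\<^sup>* `` {(i, a, b)}" using side_glued_iff[OF o] by blast
qed

lemma straight_geodesic: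
  assumes "\<And>s. s \<in> J \<Longrightarrow> z + s *\<^sub>R v \<in> P i \<and> z + s *\<^sub>R v \<notin> vertices (P i)"
  shows "geodesic_on S J (\<lambda>s. pt S (i, z + s *\<^sub>R v)) v"
proof -
  have "straight_on S (J \<inter> A) (\<lambda>s. pt S (i, z + s *\<^sub>R v)) v" for A
    unfolding straight_on_def using assms by blast
  moreover have "(1::real) > 0" by simp
  ultimately show ?thesis unfolding geodesic_on_def using assms pt_points pt_vertex_iff by blast
qed

end

section \<open>The modulus relation and the values of the flip-shear inside a cylinder\<close>

locale perfect_surf =
  fixes S :: "'i::finite polygon_surface" and M :: real
    and V :: "('i \<times> complex) set \<Rightarrow> ('i \<times> complex) set"
  assumes perfect: "perfect_surface S M" and flip_shear: "is_flip_shear S M V"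

sublocale perfect_surf \<subseteq> special_surf S
  using perfect by unfold_locales (simp add: perfect_surface_def)

context perfect_surf
begin

text \<open>For two trapezoids the right-hand side is the circumference, at modulus
  \<open>M\<close>. For a rectangle glued to itself it is twice the circumference, at modulus
  \<open>M / 2\<close>.\<close>

lemma opposite_modulus:
  assumes o: "opposite i a b j c d" and y: "a \<le> y" "y \<le> b"
  shows "M * (b - a) = 2 * hw i y + 2 * hw j (y - a + c)"
proof -
  have g: "gap (P i) a b" "d - c = b - a" using o by (auto simp: opposite_def)
  have ab: "b - a > 0" using g by (simp add: gap_def)
  let ?C = "{(i, a, b), (j, c, d)}"
  have "?C \<in> cylinders S" unfolding cylinders_def using opposite_cylinder[OF o] g(1) trapezoids_iff by blast
  then have C: "(modulus S ?C = M \<and> card ?C = 2) \<or> (modulus S ?C = M / 2 \<and> (\<exists>T. ?C = {T}))"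
    using perfect unfolding perfect_surface_def by blast
  have h: "cylinder_height ?C = b - a" unfolding cylinder_height_def using g(2) by auto
  have "M * (b - a) = 2 * hw i a + 2 * hw j c"
  proof (cases "(i, a, b) = (j, c, d)")
    case True
    then have "card ?C = 1" by simp
    then have "modulus S ?C = M / 2" using C by linarith
    moreover have "circumference S ?C = 2 * hw i a"
      using True by (simp add: circumference_def half_width_def)
    ultimately show ?thesis using True ab unfolding modulus_def h by (simp add: field_simps)
  next
    case False
    then have "card ?C = 2" by simp
    then have "modulus S ?C = M" using C False by (metis card_1_singleton_iff One_nat_def n_not_Suc_n numeral_2_eq_2)
    moreover have "circumference S ?C = 2 * hw i a + 2 * hw j c"
      using False by (simp add: circumference_def half_width_def field_simps)
    ultimately show ?thesis using ab h by (simp add: modulus_def field_simps)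
  qed
  then show ?thesis using opposite_pt(2)[OF o y] by simp
qed

lemma M_pos:
  assumes "gap (P i) a b" shows "M > 0"
proof -
  obtain j c d where o: "opposite i a b j c d" using opposite_exists[OF assms] .
  have ab: "a < b" using assms by (simp add: gap_def)
  define y where "y = (a + b) / 2"
  have y: "a < y" "y < b" using ab by (auto simp: y_def)
  have "hw i y > 0" "hw j (y - a + c) > 0"
    using y o P.gap_half_width_pos[of j c d] P.gap_half_width_pos[OF assms y] by (auto simp: opposite_def)
  then have "M * (b - a) > 0" using opposite_modulus[OF o, of y] y by simp
  then show ?thesis using ab by (simp add: zero_less_mult_iff)
qed

lemma shearE:
  obtains F where "is_shear S M F" "V = F \<circ> flip S"
  using flip_shear by (auto simp: is_flip_shear_def)

lemma V_bij: "bij_betw V (points S) (points S)"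
proof -
  obtain F where F: "is_shear S M F" "V = F \<circ> flip S" by (rule shearE)
  have "bij_betw (flip S) (points S) (points S)"
    by (rule bij_betw_byWitness[where f' = "flip S"]) (auto simp: flip_flip flip_points)
  moreover have "bij_betw F (points S) (points S)"
    using F(1) by (simp add: is_shear_def affine_automorphism_def)
  ultimately show ?thesis unfolding F(2) by (rule bij_betw_trans)
qed

lemma V_inj: "X \<in> points S \<Longrightarrow> Y \<in> points S \<Longrightarrow> V X = V Y \<Longrightarrow> X = Y"
  using V_bij by (auto simp: bij_betw_def inj_on_def)

lemma V_geodesic:
  assumes "geodesic_on S J g v" "is_interval J"
  shows "geodesic_on S J (V \<circ> g) (Complex (M * Im v - Re v) (Im v))"
proof -
  obtain F where F: "is_shear S M F" "V = F \<circ> flip S" by (rule shearE)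
  have "geodesic_on S J (F \<circ> (flip S \<circ> g)) (Complex (- Re v + M * Im v) (Im v))"
    using F(1) geodesic_flip[OF assms(1)] assms(2) unfolding is_shear_def affine_automorphism_def by force
  then show ?thesis by (simp add: F(2) o_assoc)
qed

text \<open>The flip moves the point within the cylinder boundary, where the shear is the
  identity.\<close>

lemma V_slice:
  assumes g: "gap (P i) a b" and z: "z \<in> P i" "Im z = a \<or> Im z = b"
  shows "V (pt S (i, z)) = pt S (i, mirror (mid i) z)"
proof -
  obtain F where F: "is_shear S M F" "V = F \<circ> flip S" by (rule shearE)
  let ?C = "(side_glued S)\<^sup>* `` {(i, a, b)}"
  have "?C \<in> cylinders S" unfolding cylinders_def using g trapezoids_iff by blast
  moreover have "pt S (i, mirror (mid i) z) \<in> cylinder_boundary S ?C"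
    unfolding cylinder_boundary_def using z by fastforce
  ultimately have "F (pt S (i, mirror (mid i) z)) = pt S (i, mirror (mid i) z)"
    using F(1) unfolding is_shear_def by blast
  then show ?thesis using F(2) by (simp add: flip_pt)
qed

text \<open>\<open>z0\<close> lies strictly inside the bottom or top of the trapezoid and the rest
  of the segment strictly between vertex heights. So the segment avoids the vertices, and its image
  is a geodesic whose starting point is known.\<close>

lemma V_segment:
  assumes g: "gap (P i) a b" and z0: "Im z0 = a \<or> Im z0 = b" "\<bar>Re z0 - mid i\<bar> < hw i (Im z0)"
    and z1: "z1 \<in> P i" "a < Im z1" "Im z1 < b"
  shows "geodesic_on S {0..1} (\<lambda>s. V (pt S (i, z0 + s *\<^sub>R (z1 - z0)))) (Complex (M * Im (z1 - z0) - Re (z1 - z0)) (Im (z1 - z0)))"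
    "V (pt S (i, z0)) = pt S (i, mirror (mid i) z0)"
proof -
  have ab: "a < b" using g by (simp add: gap_def)
  have z0P: "z0 \<in> P i" using P.gap_mem_iff[OF g, of z0] z0 ab by auto
  have "z0 + s *\<^sub>R (z1 - z0) \<in> P i \<and> z0 + s *\<^sub>R (z1 - z0) \<notin> vertices (P i)" if s: "s \<in> {0..1}" for s
  proof
    have eq: "z0 + s *\<^sub>R (z1 - z0) = (1 - s) *\<^sub>R z0 + s *\<^sub>R z1" by (simp add: algebra_simps)
    show "z0 + s *\<^sub>R (z1 - z0) \<in> P i" unfolding eq using convexD_alt[OF P.sp_convex z0P z1(1)] s by auto
    show "z0 + s *\<^sub>R (z1 - z0) \<notin> vertices (P i)"
    proof (cases "s = 0")
      case True
      then show ?thesis using z0 P.vertices_iff by auto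
    next
      case False
      then have s0: "0 < s" "s \<le> 1" using s by auto
      define k where "k = s * (Im z1 - Im z0)"
      have "a < Im z0 + k \<and> Im z0 + k < b"
        using z0(1)
      proof
        assume a: "Im z0 = a"
        then have "0 < k" "k \<le> Im z1 - Im z0"
          using s0 z1 mult_right_mono[of s 1 "Im z1 - Im z0"] by (auto simp: k_def)
        then show ?thesis using z1 a by linarith
      next
        assume b: "Im z0 = b"
        then have "k < 0" "Im z1 - Im z0 \<le> k"
          using s0 z1 mult_right_mono_neg[of s 1 "Im z1 - Im z0"] by (auto simp: k_def mult_pos_neg)
        then show ?thesis using z1 b by linarith
      qed
      then show ?thesis using P.gap_not_vertex[OF g, of "z0 + s *\<^sub>R (z1 - z0)"] by (simp add: k_def)
    qed
  qed
  then have "geodesic_on S {0..1} (\<lambda>s. pt S (i, z0 + s *\<^sub>R (z1 - z0))) (z1 - z0)"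
    by (rule straight_geodesic)
  from V_geodesic[OF this] show "geodesic_on S {0..1} (\<lambda>s. V (pt S (i, z0 + s *\<^sub>R (z1 - z0)))) (Complex (M * Im (z1 - z0) - Re (z1 - z0)) (Im (z1 - z0)))"
    by (simp add: comp_def is_interval_cc)
  show "V (pt S (i, z0)) = pt S (i, mirror (mid i) z0)" by (rule V_slice[OF g z0P z0(1)])
qed

text \<open>If the straight continuation of the image ends in the same polygon, convexity keeps all
  of it there, and its end \<open>w\<close> is the value of \<open>V\<close>.\<close>

lemma V_within:
  assumes g: "gap (P i) a b" and z0: "Im z0 = a \<or> Im z0 = b" "\<bar>Re z0 - mid i\<bar> < hw i (Im z0)"
    and z1: "z1 \<in> P i" "a < Im z1" "Im z1 < b"
    and w: "w \<in> P i" "w = mirror (mid i) z0 + Complex (M * Im (z1 - z0) - Re (z1 - z0)) (Im (z1 - z0))"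
  shows "V (pt S (i, z1)) = pt S (i, w)"
proof -
  note seg = V_segment[OF g z0 z1]
  have ab: "a < b" using g by (simp add: gap_def)
  have z0P: "z0 \<in> P i" using P.gap_mem_iff[OF g, of z0] z0 ab by auto
  have "V (pt S (i, z0 + 1 *\<^sub>R (z1 - z0))) = pt S (i, mirror (mid i) z0 +
      (1 - 0) *\<^sub>R (Complex (M * Im (z1 - z0) - Re (z1 - z0)) (Im (z1 - z0))))"
    by (rule geodesic_continues[OF seg(1), of 0 1]) (use seg(2) z0P w in \<open>auto simp: closed_segment_eq_real_ivl\<close>)
  then show ?thesis using w by simp
qed

text \<open>Relative to the centre of the bottom, which \<open>V\<close> fixes, the map is (x, y)
  \<mapsto> (-x + M y, y); the abscissa of \<open>z\<close> is the one sent to the right side. A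
  bottom of positive length makes its centre a non-vertex.\<close>

lemma V_right:
  assumes g: "gap (P i) a b" "hw i a > 0" and y: "a < y" "y < b"
    and z: "z = Complex (mid i + M * (y - a) - hw i y) y" "z \<in> P i"
  shows "V (pt S (i, z)) = pt S (i, side (P i) 1 y)"
  by (rule V_within[OF g(1), of "side (P i) 0 a"])
    (use g y z P.gap_mem_iff[OF g(1), of "side (P i) 1 y"] P.gap_half_width_pos[OF g(1) y] in \<open>auto simp: complex_eq_iff algebra_simps\<close>)

text \<open>The same from the centre of the top, for the points sent to the left side.\<close>

lemma V_left:
  assumes g: "gap (P i) a b" "hw i b > 0" and y: "a < y" "y < b"
    and z: "z = Complex (mid i + M * (y - b) + hw i y) y" "z \<in> P i"
  shows "V (pt S (i, z)) = pt S (i, side (P i) (-1) y)"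
  by (rule V_within[OF g(1), of "side (P i) 0 b"])
    (use g y z P.gap_mem_iff[OF g(1), of "side (P i) (-1) y"] P.gap_half_width_pos[OF g(1) y] in \<open>auto simp: complex_eq_iff algebra_simps\<close>)

end

section \<open>The preimage of a side under the flip-shear\<close>

lemma (in special_poly) gap_affine:
  assumes "gap P a b" "a \<le> y" "y \<le> b"
  shows "(b - a) * half_width P y = (b - y) * half_width P a + (y - a) * half_width P b"
proof -
  have "b - a > 0" using assms(1) by (simp add: gap_def)
  then show ?thesis using half_width_affine[OF assms(1), of 1 y] assms(2,3) by (simp add: field_simps)
qed

lemma (in special_poly) side_vertex_iff:
  assumes "\<sigma> = -1 \<or> \<sigma> = 1" "gap P a b" "a \<le> y" "y \<le> b"
  shows "side P \<sigma> y \<in> vertices P \<longleftrightarrow> y = a \<or> y = b"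
  using assms gap_half_width_nonneg[OF assms(2-4)] unfolding vertices_iff gap_def by fastforce

context perfect_surf
begin

text \<open>If both trapezoids of the cylinder are triangles, the side between them joins two vertices and
  the flip-shear fixes it pointwise. A path from the bottom of the second triangle to its left side
  is taken to a path that leaves this triangle on the right and ends on the far side of the first one.\<close>

lemma V_triangles:
  assumes o: "opposite i a b j c d" and z: "hw i a = 0" "hw j d = 0"
    and y: "a < y" "y < b"
  shows "V (pt S (i, side (P i) 1 y)) = pt S (i, side (P i) 1 y)"
proof -
  have g: "gap (P i) a b" "gap (P j) c d" "d - c = b - a" using o by (auto simp: opposite_def)
  define H where "H = b - a"
  define k where "k = y - a"
  have H: "H > 0" "b = a + H" "d = c + H" "0 < k" "k < H" "y = a + k"
    using y g by (auto simp: H_def k_def)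
  have wb: "hw i b = M * H / 2"
    using opposite_modulus[OF o, of b] z H by (simp add: algebra_simps)
  have wc: "hw j c = M * H / 2"
    using opposite_modulus[OF o, of a] z H by (simp add: algebra_simps)
  \<comment> \<open>The first triangle has its apex at the bottom, the second at the top, and both
    bases have length \<open>M * H\<close>.\<close>
  have wi: "hw i (a + h) = M * h / 2" if "0 \<le> h" "h \<le> H" for h
  proof -
    have "H * hw i (a + h) = h * hw i b"
      using P.gap_affine[OF g(1), of "a + h"] that H z by simp
    also have "\<dots> = H * (M * h / 2)" unfolding wb by simp
    finally show ?thesis using H(1) by simp
  qed
  have wj: "hw j (c + h) = M * (H - h) / 2" if "0 \<le> h" "h \<le> H" for h
  proof -
    have "H * hw j (c + h) = (H - h) * hw j c"
      using P.gap_affine[OF g(2), of "c + h"] that H z by simp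
    also have "\<dots> = H * (M * (H - h) / 2)" unfolding wc by simp
    finally show ?thesis using H(1) by simp
  qed
  have Mp: "M > 0" by (rule M_pos[OF g(1)])
  \<comment> \<open>The path runs from the middle of the base of the second triangle to the point
    glued to the side point at height \<open>y\<close>; \<open>v\<close> is the velocity of its
    image.\<close>
  let ?z0 = "side (P j) 0 c" and ?z1 = "side (P j) (-1) (c + k)"
  define v where "v = Complex (M * (H + k) / 2) k"
  have v: "Complex (M * Im (?z1 - ?z0) - Re (?z1 - ?z0)) (Im (?z1 - ?z0)) = v"
    using wj[of k] H unfolding v_def by (simp add: complex_eq_iff field_simps)
  have z1P: "?z1 \<in> P j" using P.gap_mem_iff[OF g(2), of ?z1] H wj[of k] Mp by auto
  have wcp: "hw j c > 0" unfolding wc using Mp H(1) by (intro divide_pos_pos mult_pos_pos) auto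
  note seg = V_segment[OF g(2), of ?z0 ?z1, unfolded v]
  have geo: "geodesic_on S {0..1} (\<lambda>s. V (pt S (j, ?z0 + s *\<^sub>R (?z1 - ?z0)))) v"
    and start: "V (pt S (j, ?z0)) = pt S (j, ?z0)"
    using seg wcp z1P H by auto
  \<comment> \<open>The time at which the image path reaches the right side of the second triangle,
    from \<tau> * M * (H + k) / 2 = M * (H - \<tau> * k) / 2.\<close>
  define \<tau> where "\<tau> = H / (H + 2 * k)"
  have \<tau>: "0 < \<tau>" "\<tau> < 1" using H by (auto simp: \<tau>_def)
  have \<tau>eq: "\<tau> * (H + 2 * k) = H" using H by (simp add: \<tau>_def)
  have \<tau>k: "0 < \<tau> * k" "\<tau> * k < k" "\<tau> * k \<le> H" using \<tau> H by (auto intro: order_trans[of _ k])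
  have h1: "?z0 + (\<tau> - 0) *\<^sub>R v = side (P j) 1 (c + \<tau> * k)"
  proof -
    have "\<tau> * (M * (H + k) / 2) = M * (H - \<tau> * k) / 2"
    proof -
      have "\<tau> * (H + k) = H - \<tau> * k" using \<tau>eq by (simp add: algebra_simps)
      then show ?thesis by (metis mult.left_commute times_divide_eq_right)
    qed
    then show ?thesis using wj[of "\<tau> * k"] \<tau>k by (simp add: complex_eq_iff v_def)
  qed
  have "side (P j) 1 (c + \<tau> * k) \<in> P j"
    using P.gap_mem_iff[OF g(2), of "side (P j) 1 (c + \<tau> * k)"] \<tau>k H wj[of "\<tau> * k"] Mp by auto
  then have "V (pt S (j, ?z0 + \<tau> *\<^sub>R (?z1 - ?z0))) = pt S (j, ?z0 + (\<tau> - 0) *\<^sub>R v)"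
    using geodesic_continues[OF geo, of 0 \<tau> j ?z0 \<tau>] start \<tau> h1 P.sp_convex wcp
      P.gap_mem_iff[OF g(2), of ?z0] H by (auto simp: closed_segment_eq_real_ivl)
  also have "\<dots> = pt S (i, side (P i) (-1) (a + \<tau> * k))"
    unfolding h1 using opposite_pt(1)[OF opposite_sym[OF o], of "c + \<tau> * k"] \<tau>k H by (simp add: algebra_simps)
  finally have mid: "V (pt S (j, ?z0 + \<tau> *\<^sub>R (?z1 - ?z0))) = pt S (i, side (P i) (-1) (a + \<tau> * k))" .
  have h2: "side (P i) (-1) (a + \<tau> * k) + (1 - \<tau>) *\<^sub>R v = side (P i) 1 y"
  proof -
    have "(1 - \<tau>) * (H + k) - \<tau> * k = k" using \<tau>eq by (simp add: algebra_simps)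
    then have "M * ((1 - \<tau>) * (H + k) - \<tau> * k) / 2 = M * k / 2" by simp
    moreover have "M * ((1 - \<tau>) * (H + k) - \<tau> * k) / 2 = (1 - \<tau>) * (M * (H + k) / 2) - M * (\<tau> * k) / 2"
      by (simp add: right_diff_distrib diff_divide_distrib mult.left_commute)
    ultimately have "(1 - \<tau>) * (M * (H + k) / 2) - M * (\<tau> * k) / 2 = M * k / 2" by simp
    then have "mid i - hw i (a + \<tau> * k) + (1 - \<tau>) * (M * (H + k) / 2)
        = mid i + hw i y"
      using wi[of "\<tau> * k"] wi[of k] \<tau>k H by simp
    moreover have "a + \<tau> * k + (1 - \<tau>) * k = y" using H by (simp add: algebra_simps)
    ultimately show ?thesis by (simp add: complex_eq_iff v_def)
  qed
  have in1: "side (P i) (-1) (a + \<tau> * k) \<in> P i" "side (P i) 1 y \<in> P i"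
    using P.gap_mem_iff[OF g(1), of "side (P i) (-1) (a + \<tau> * k)"] P.gap_mem_iff[OF g(1), of "side (P i) 1 y"]
      \<tau>k H wi[of "\<tau> * k"] wi[of k] Mp by auto
  have "V (pt S (j, ?z0 + 1 *\<^sub>R (?z1 - ?z0))) = pt S (i, side (P i) (-1) (a + \<tau> * k) + (1 - \<tau>) *\<^sub>R v)"
    by (rule geodesic_continues[OF geo, of \<tau> 1]) (use \<tau> mid in1 h2 in \<open>auto simp: closed_segment_eq_real_ivl\<close>)
  moreover have "pt S (j, ?z1) = pt S (i, side (P i) 1 y)"
    using opposite_pt(1)[OF o, of y] y H by (simp add: algebra_simps)
  ultimately show ?thesis unfolding h2 by simp
qed

text \<open>The part of the diagonal in \<open>P i\<close>: the inequality says that at height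
  \<open>y\<close> the diagonal has not passed the right side of the trapezoid.\<close>

lemma V_shear1:
  assumes o: "opposite i a b j c d" and y: "a < y" "y < b"
    and le: "M * (y - a) \<le> 2 * hw i y"
  shows "V (pt S (i, Complex (mid i + M * (y - a) - hw i y) y)) = pt S (i, side (P i) 1 y)"
    "Complex (mid i + M * (y - a) - hw i y) y \<in> P i"
proof -
  let ?z = "Complex (mid i + M * (y - a) - hw i y) y"
  have g: "gap (P i) a b" "gap (P j) c d" "d - c = b - a" using o by (auto simp: opposite_def)
  have "M > 0" by (rule M_pos[OF g(1)])
  then have "0 \<le> M * (y - a)" using y by simp
  then show zP: "?z \<in> P i" using P.gap_mem_iff[OF g(1), of ?z] y le by auto
  show "V (pt S (i, ?z)) = pt S (i, side (P i) 1 y)"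
  proof (cases "hw i a = 0")
    case False
    then have "hw i a > 0" using P.gap_half_width_nonneg[OF g(1), of a] y by simp
    then show ?thesis using V_right[OF g(1) _ y refl] zP by blast
  next
    \<comment> \<open>With the apex at the bottom, the modulus relation gives the reverse inequality
      as well, with a defect proportional to \<open>hw j d\<close>. Hence equality holds, both
      trapezoids are triangles, and the diagonal is the side itself.\<close>
    case True
    have wd: "hw j d \<ge> 0" using P.gap_half_width_nonneg[OF g(2), of d] g(2) by (simp add: gap_def)
    have "b - a + c = d" using g(3) by simp
    then have mod: "M * (b - a) = 2 * hw i b + 2 * hw j d"
      using opposite_modulus[OF o, of b] y by simp
    have aff: "(b - a) * hw i y = (y - a) * hw i b"
      using P.gap_affine[OF g(1), of y] y True by simp
    have "(b - a) * (2 * hw i y - M * (y - a)) = (y - a) * (2 * hw i b - M * (b - a))"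
      using aff by (simp add: algebra_simps)
    also have "\<dots> = - (2 * (y - a) * hw j d)" unfolding mod by (simp add: algebra_simps)
    finally have eq: "(b - a) * (2 * hw i y - M * (y - a)) + 2 * (y - a) * hw j d = 0" by simp
    moreover have "(b - a) * (2 * hw i y - M * (y - a)) \<ge> 0" "2 * (y - a) * hw j d \<ge> 0"
      using y le wd by auto
    ultimately have "(b - a) * (2 * hw i y - M * (y - a)) = 0" "2 * (y - a) * hw j d = 0"
      by linarith+
    then have e: "M * (y - a) = 2 * hw i y" "hw j d = 0" using y by auto
    then have "?z = side (P i) 1 y" by (simp add: complex_eq_iff)
    then show ?thesis using V_triangles[OF o True e(2) y] by simp
  qed
qed

text \<open>The rest of the diagonal, in the neighbour \<open>P j\<close>, found from the top of its
  trapezoid. Heights in the two trapezoids differ by the shift \<open>c - a\<close>.\<close>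

lemma V_shear2:
  assumes o: "opposite i a b j c d" and y: "a < y" "y < b"
    and le: "2 * hw i y \<le> M * (y - a)"
  shows "V (pt S (j, Complex (mid j + M * (y - b) + hw j (y - a + c)) (y - a + c))) = pt S (i, side (P i) 1 y)"
    "Complex (mid j + M * (y - b) + hw j (y - a + c)) (y - a + c) \<in> P j"
proof -
  define y' where "y' = y - a + c"
  let ?z = "Complex (mid j + M * (y - b) + hw j y') y'"
  have g: "gap (P i) a b" "gap (P j) c d" "d - c = b - a" using o by (auto simp: opposite_def)
  have y': "c < y'" "y' < d" "y' - d = y - b" using y g(3) by (auto simp: y'_def)
  have pt: "pt S (i, side (P i) 1 y) = pt S (j, side (P j) (-1) y')"
    using opposite_pt(1)[OF o] y by (simp add: y'_def)
  have "M > 0" by (rule M_pos[OF g(1)])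
  then have neg: "M * (y - b) \<le> 0" using y by (simp add: mult_le_0_iff)
  have mod: "M * (b - a) = 2 * hw i y + 2 * hw j y'"
    using opposite_modulus[OF o, of y] y by (simp add: y'_def)
  have le': "2 * hw j y' + M * (y - b) \<ge> 0"
  proof -
    have "M * (y - b) = M * (y - a) - M * (b - a)" by (simp add: algebra_simps)
    then show ?thesis using mod le by linarith
  qed
  then have zP: "?z \<in> P j" using P.gap_mem_iff[OF g(2), of ?z] y' neg by auto
  have V: "V (pt S (j, ?z)) = pt S (i, side (P i) 1 y)"
  proof (cases "hw j d = 0")
    case False
    then have "hw j d > 0" using P.gap_half_width_nonneg[OF g(2), of d] g(2) by (simp add: gap_def)
    then show ?thesis using V_left[OF g(2) _ y'(1,2) _ zP] pt y'(3) by simp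
  next
    case True
    have wa: "hw i a \<ge> 0" using P.gap_half_width_nonneg[OF g(1), of a] g(1) by (simp add: gap_def)
    have mod': "M * (b - a) = 2 * hw i a + 2 * hw j c"
      using opposite_modulus[OF o, of a] y by simp
    have aff: "(b - a) * hw j y' = (b - y) * hw j c"
    proof -
      have "d - y' = b - y" using y'(3) by simp
      then show ?thesis using P.gap_affine[OF g(2), of y'] y' True g(3) by simp
    qed
    have "(b - a) * (2 * hw j y' + M * (y - b)) = (b - y) * (2 * hw j c - M * (b - a))"
      using aff by (simp add: algebra_simps)
    also have "\<dots> = - (2 * (b - y) * hw i a)" unfolding mod' by (simp add: algebra_simps)
    finally have eq: "(b - a) * (2 * hw j y' + M * (y - b)) + 2 * (b - y) * hw i a = 0" by simp
    moreover have "(b - a) * (2 * hw j y' + M * (y - b)) \<ge> 0" "2 * (b - y) * hw i a \<ge> 0"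
      using y le' wa by auto
    ultimately have "(b - a) * (2 * hw j y' + M * (y - b)) = 0" "2 * (b - y) * hw i a = 0"
      by linarith+
    then have e: "2 * hw j y' + M * (y - b) = 0" "hw i a = 0" using y by auto
    then have "?z = side (P j) (-1) y'" by (simp add: complex_eq_iff)
    then show ?thesis using V_triangles[OF o e(2) True y] pt by simp
  qed
  show "V (pt S (j, Complex (mid j + M * (y - b) + hw j (y - a + c)) (y - a + c))) = pt S (i, side (P i) 1 y)"
    "Complex (mid j + M * (y - b) + hw j (y - a + c)) (y - a + c) \<in> P j"
    using V zP by (simp_all add: y'_def)
qed

lemma V_preimage:
  assumes o: "opposite i a b j c d" and y: "a < y" "y < b"
    and X: "X \<in> points S" "V X = pt S (i, side (P i) 1 y)"
  obtains "M * (y - a) \<le> 2 * hw i y"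
      "X = pt S (i, Complex (mid i + M * (y - a) - hw i y) y)"
    | "2 * hw i y \<le> M * (y - a)"
      "X = pt S (j, Complex (mid j + M * (y - b) + hw j (y - a + c)) (y - a + c))"
proof (cases "M * (y - a) \<le> 2 * hw i y")
  case True
  then show ?thesis using that(1) V_inj[OF X(1) pt_points] V_shear1[OF o y] X(2) by metis
next
  case False
  then have "2 * hw i y \<le> M * (y - a)" by simp
  then show ?thesis using that(2) V_inj[OF X(1) pt_points] V_shear2[OF o y] X(2) by metis
qed

end

section \<open>Letters of the points on edges\<close>

context special_surf
begin

lemma on_edge_iff: "on_edge S X (i, e) \<longleftrightarrow> e edge_of P i \<and> (\<exists>z\<in>e. X = pt S (i, z))"
  by (simp add: on_edge_def)

text \<open>A non-vertex point lies on at most one edge in each of its at most two representatives,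
  and two such edges are glued to each other. So the trajectory and the crossing times determine the
  letters.\<close>

lemma letter_unique:
  assumes X: "X \<notin> vertex_points S" and p: "on_edge S X p" and q: "on_edge S X q"
  shows "letter_of S p = letter_of S q"
proof -
  obtain i e z where p': "p = (i, e)" "e edge_of P i" "z \<in> e" "X = pt S (i, z)"
    using p by (metis on_edge_iff surj_pair)
  obtain j f w where q': "q = (j, f)" "f edge_of P j" "w \<in> f" "X = pt S (j, w)"
    using q by (metis on_edge_iff surj_pair)
  have nv: "z \<notin> vertices (P i)" "w \<notin> vertices (P j)" using X p'(4) q'(4) pt_vertex_iff[of i z] pt_vertex_iff[of j w] by simp_all
  have "pt S (i, z) = pt S (j, w)" using p' q' by simp
  then show ?thesis using nv(1)
  proof (cases rule: pt_cases)
    case 1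
    then have "f = e" using edge_unique[OF P.sp_polytope q'(2) _ q'(3) _ nv(2)] p' by auto
    then show ?thesis using p' q' 1 by simp
  next
    case (2 e' d)
    have "e' = e" using edge_unique[OF P.sp_polytope 2(1) p'(2) 2(2) p'(3) nv(1)] .
    then have gl: "glue S (i, e) = (j, (+) d ` e)" using 2 by simp
    note ge = glue_edge[OF p'(2) gl]
    have "w \<in> (+) d ` e" using 2(4) p'(3) by blast
    then have "f = (+) d ` e" using edge_unique[OF P.sp_polytope q'(2) ge(1) q'(3) _ nv(2)] by blast
    then show ?thesis using p' q' gl ge(3) by (auto simp: letter_of_def)
  qed
qed

lemma horizontal_letter_iff:
  assumes "e edge_of P i"
  shows "horizontal_letter (letter_of S (i, e)) \<longleftrightarrow> horizontal e"
proof -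
  obtain j d where "glue S (i, e) = (j, (+) d ` e)" using glueE[OF assms] by metis
  moreover have "horizontal ((+) d ` e)" if "horizontal e" using that by (auto simp: horizontal_def)
  ultimately show ?thesis by (auto simp: horizontal_letter_def letter_of_def)
qed

lemma opposite_letter:
  assumes o: "opposite i a b j c d"
  shows "letter_of S (i, side (P i) 1 ` {a..b}) = letter_of S (j, side (P j) (-1) ` {c..d})"
  using o opposite_sym[OF o] by (auto simp: letter_of_def opposite_def)

text \<open>A normal form for crossings of gluing edges: the edge is the right side of the first
  trapezoid. A left side is traded for the right side of the neighbour to which it is glued.\<close>

lemma slanted_letterE:
  assumes X: "X \<notin> vertex_points S" "on_edge S X (k, e)" "\<not> horizontal e"
  obtains i a b j c d y where "opposite i a b j c d" "a < y" "y < b" "X = pt S (i, side (P i) 1 y)"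
    "letter_of S (k, e) = letter_of S (i, side (P i) 1 ` {a..b})"
proof -
  obtain z where z: "e edge_of P k" "z \<in> e" "X = pt S (k, z)" using X(2) on_edge_iff by auto
  obtain \<sigma> a b where s: "\<sigma> = -1 \<or> \<sigma> = 1" "gap (P k) a b" "e = side (P k) \<sigma> ` {a..b}"
    by (rule P.slanted_edgeE[OF z(1) X(3)])
  then obtain y where y: "z = side (P k) \<sigma> y" "a \<le> y" "y \<le> b" using z(2) by auto
  have "z \<notin> vertices (P k)" using X(1) z(3) pt_vertex_iff by simp
  then have y': "a < y" "y < b" using P.side_vertex_iff[OF s(1,2) y(2,3)] y by auto
  obtain j c d where o: "opposite k a b j c d" using opposite_exists[OF s(2)] .
  show ?thesis
  proof (cases "\<sigma> = 1")
    case True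
    then show ?thesis using that[OF o y'] z y s by simp
  next
    case False
    then have \<sigma>: "\<sigma> = -1" using s(1) by simp
    have o': "opposite j c d k a b" using opposite_sym[OF o] .
    have "d - c = b - a" using o by (simp add: opposite_def)
    then have yc: "c < y - a + c" "y - a + c < d" using y' by auto
    show ?thesis
      using that[OF o' yc] z(3) y(1) \<sigma> opposite_pt(1)[OF o', of "y - a + c"] yc
        opposite_letter[OF o'] s(3) by simp
  qed
qed

end

text \<open>A horizontal edge bounds a cylinder, so \<open>V\<close> acts on it as the reflection of
  its polygon, which preserves the edge. The converse follows from the injectivity of
  \<open>V\<close>.\<close>

lemma (in perfect_surf) V_horizontal:
  assumes X: "X \<in> points S" and e: "horizontal e"
  shows "on_edge S (V X) (i, e) \<longleftrightarrow> on_edge S X (i, e)"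
proof -
  have key: "pt S (i, mirror (mid i) z) = V (pt S (i, z)) \<and> mirror (mid i) z \<in> e \<and> z \<in> P i"
    if ee: "e edge_of P i" and z: "z \<in> e" for z
  proof -
    obtain h where h: "h = ymin (P i) \<or> h = ymax (P i)" "e = {z \<in> P i. Im z = h}"
      using P.horizontal_edgeE[OF ee e] by blast
    have fin: "ymin (P i) \<in> heights (P i)" "ymax (P i) \<in> heights (P i)"
      using P.finite_heights P.heights_nonempty by auto
    obtain a b where g: "gap (P i) a b" "h = a \<or> h = b"
      using h(1) P.gap_above[OF fin(1) P.ymin_less_ymax] P.gap_below[OF fin(2) P.ymin_less_ymax] by metis
    have zP: "z \<in> P i" "Im z = h" using z h(2) by auto
    show ?thesis using V_slice[OF g(1) zP(1)] g(2) zP h(2) by simp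
  qed
  show ?thesis
  proof
    assume "on_edge S X (i, e)"
    then obtain z where z: "e edge_of P i" "z \<in> e" "X = pt S (i, z)" unfolding on_edge_iff by blast
    then show "on_edge S (V X) (i, e)" unfolding on_edge_iff using key[OF z(1,2)] by metis
  next
    assume "on_edge S (V X) (i, e)"
    then obtain z where z: "e edge_of P i" "z \<in> e" "V X = pt S (i, z)" unfolding on_edge_iff by blast
    let ?m = "mirror (mid i) z"
    have m: "?m \<in> e" "?m \<in> P i" using key[OF z(1,2)] by auto
    have "V (pt S (i, ?m)) = V X" using key[OF z(1) m(1)] z(3) by simp
    then have "X = pt S (i, ?m)" using V_inj[OF X pt_points[OF m(2)]] by simp
    then show "on_edge S X (i, e)" unfolding on_edge_iff using z(1) m(1) by blast
  qed
qed

section \<open>Crossing a trapezoid\<close>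

text \<open>Coordinates are centred on the axis, with heights measured from the base left behind;
  \<open>w\<close> is the half-width and (C, N) the velocity. The difference of \<alpha> and \<beta>
  is at most their sum, so the slope condition makes the motion flatter than both sides: the
  distance to the left side grows, that to the right side shrinks, and the exit is on the right or
  at the far base.\<close>

lemma trapezoid_exit:
  fixes \<alpha> \<beta> H C N x y :: real and w :: "real \<Rightarrow> real"
  assumes w_def: "\<And>h. w h = \<alpha> + (\<beta> - \<alpha>) * (h / H)" and H: "H > 0" and ab: "\<alpha> \<ge> 0" "\<beta> \<ge> 0" and C: "C > 0" and N: "N \<ge> 0"
    and slope: "N * (\<alpha> + \<beta>) < C * H" and y: "0 \<le> y" "y \<le> H" and x: "\<bar>x\<bar> \<le> w y"
  obtains q where "q \<ge> 0" "\<And>s. 0 \<le> s \<Longrightarrow> s \<le> q \<Longrightarrow> y + s * N \<le> H \<and> \<bar>x + s * C\<bar> \<le> w (y + s * N)"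
    "\<And>s. 0 < s \<Longrightarrow> s < q \<Longrightarrow> \<bar>x + s * C\<bar> < w (y + s * N)"
    "x + q * C = w (y + q * N) \<or> y + q * N = H"
proof -
  define m where "m = (\<beta> - \<alpha>) / H"
  have w: "w h = \<alpha> + m * h" for h unfolding w_def m_def by simp
  have ws: "w (y + s * N) = w y + s * (m * N)" for s
    unfolding w by (simp add: algebra_simps)
  have "\<bar>m * N\<bar> < C"
  proof -
    have "N * \<bar>\<beta> - \<alpha>\<bar> \<le> N * (\<alpha> + \<beta>)" using ab N by (intro mult_left_mono) auto
    then have "N * \<bar>\<beta> - \<alpha>\<bar> < C * H" using slope by linarith
    then show ?thesis using H N by (simp add: m_def abs_mult abs_divide divide_simps mult.commute)
  qed
  then have DE: "C - m * N > 0" "C + m * N > 0" by auto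
  \<comment> \<open>The time of meeting the right side when this side is extended beyond height
    \<open>H\<close>.\<close>
  define r where "r = (w y - x) / (C - m * N)"
  have r: "r \<ge> 0" "r * (C - m * N) = w y - x" using x DE by (auto simp: r_def)
  have low: "- (w (y + s * N)) \<le> x + s * C" "s > 0 \<Longrightarrow> - (w (y + s * N)) < x + s * C" if "s \<ge> 0" for s
  proof -
    have "s * (C + m * N) \<ge> 0" "s > 0 \<Longrightarrow> s * (C + m * N) > 0" using DE that by auto
    moreover have "x + s * C + w (y + s * N) = (x + w y) + s * (C + m * N)" unfolding ws by (simp add: algebra_simps)
    ultimately show "- (w (y + s * N)) \<le> x + s * C" "s > 0 \<Longrightarrow> - (w (y + s * N)) < x + s * C" using x by linarith+
  qed
  have up: "x + s * C \<le> w (y + s * N)" "s < r \<Longrightarrow> x + s * C < w (y + s * N)" if "s \<le> r" for s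
  proof -
    have "(r - s) * (C - m * N) \<ge> 0" "s < r \<Longrightarrow> (r - s) * (C - m * N) > 0" using DE that by auto
    moreover have "w (y + s * N) - (x + s * C) = (r - s) * (C - m * N)" using r(2) unfolding ws by (simp add: algebra_simps)
    ultimately show "x + s * C \<le> w (y + s * N)" "s < r \<Longrightarrow> x + s * C < w (y + s * N)" by linarith+
  qed
  show ?thesis
  proof (cases "y + r * N \<le> H")
    case True
    have "s * N \<le> r * N" if "s \<le> r" for s using that N by (rule mult_right_mono)
    then have h: "y + s * N \<le> H" if "s \<le> r" for s using True that by fastforce
    have e: "x + r * C = w (y + r * N)" using r(2) unfolding ws by (simp add: algebra_simps)
    show ?thesis by (rule that[of r]) (use r low up h e in \<open>auto simp: abs_le_iff abs_less_iff minus_le_iff minus_less_iff\<close>)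
  next
    case False
    then have Np: "N > 0" using y N by (cases "N = 0") auto
    define q where "q = (H - y) / N"
    have q: "q \<ge> 0" "q * N = H - y" using y Np by (auto simp: q_def)
    have "q < r" using False Np q(2) by (smt (verit) mult_right_mono)
    have "s * N \<le> q * N" if "s \<le> q" for s using that N by (rule mult_right_mono)
    then have h: "y + s * N \<le> H" if "s \<le> q" for s using q that by fastforce
    show ?thesis by (rule that[of q]) (use q \<open>q < r\<close> low up h in \<open>auto simp: abs_le_iff abs_less_iff minus_le_iff minus_less_iff\<close>)
  qed
qed

context special_poly
begin

lemma edge_level_side:
  assumes "gap P a b"
  shows "edge_level P (side P \<sigma> ` {a..b}) = card {h \<in> heights P. h < b}"
proof -
  have "Sup (Im ` side P \<sigma> ` {a..b}) = b" using assms by (simp add: gap_def)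
  then show ?thesis using not_horizontal_side[OF assms] by (simp add: edge_level_def)
qed

lemma edge_level_adjacent:
  assumes "gap P a b" "gap P b d"
  shows "edge_level P (side P \<sigma>' ` {b..d}) = edge_level P (side P \<sigma> ` {a..b}) + 1"
proof -
  have "{h \<in> heights P. h < d} = insert b {h \<in> heights P. h < b}"
    using assms by (auto simp: gap_def)
  then show ?thesis using finite_heights by (simp add: edge_level_side[OF assms(1)] edge_level_side[OF assms(2)])
qed

lemma edge_level_bottom:
  assumes "gap P a b" "a = ymin P" "e edge_of P" "z \<in> e" "horizontal e" "Im z = a"
  shows "edge_level P (side P \<sigma> ` {a..b}) = edge_level P e + 1"
proof -
  have "Im ` e = {a}" using assms(4,5,6) by (auto simp: horizontal_def)
  then have "edge_level P e = 0" using assms(5) unfolding edge_level_def assms(2) by simp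
  moreover have "{h \<in> heights P. h < b} = {a}"
  proof (intro subset_antisym subsetI)
    fix h assume h: "h \<in> {h \<in> heights P. h < b}"
    then have "a \<le> h" using assms(2) finite_heights by simp
    then show "h \<in> {a}" using h assms(1) by (auto simp: gap_def)
  qed (use assms(1) in \<open>auto simp: gap_def\<close>)
  then have "edge_level P (side P \<sigma> ` {a..b}) = 1" unfolding edge_level_side[OF assms(1)] by simp
  ultimately show ?thesis by simp
qed

lemma edge_level_top:
  assumes "gap P a b" "b = ymax P" "e edge_of P" "z \<in> e" "horizontal e" "Im z = b"
  shows "edge_level P e = edge_level P (side P \<sigma> ` {a..b}) + 1"
proof -
  have i: "Im ` e = {b}" using assms(4,5,6) by (auto simp: horizontal_def)
  have "heights P = insert b {h \<in> heights P. h < b}"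
  proof (intro subset_antisym subsetI)
    fix h assume h: "h \<in> heights P"
    then have "h \<le> b" using assms(2) finite_heights by simp
    then show "h \<in> insert b {h \<in> heights P. h < b}" using h by auto
  qed (use assms(1) in \<open>auto simp: gap_def\<close>)
  then have "card (heights P) = card {h \<in> heights P. h < b} + 1"
    using finite_heights by (metis (no_types, lifting) Suc_eq_plus1 card_insert_disjoint finite_insert mem_Collect_eq less_irrefl)
  moreover have "edge_level P e = card (heights P)"
    using i assms(5) ymin_less_ymax unfolding edge_level_def assms(2) by simp
  ultimately show ?thesis by (simp add: edge_level_side[OF assms(1)])
qed

lemma not_in_edge:
  assumes "ymin P < Im z" "Im z < ymax P" "\<bar>Re z - sym_axis P\<bar> < half_width P (Im z)" "e edge_of P"
  shows "z \<notin> e"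
proof
  assume z: "z \<in> e"
  show False
  proof (cases "horizontal e")
    case True
    then obtain h where "h = ymin P \<or> h = ymax P" "e = {z \<in> P. Im z = h}" by (rule horizontal_edgeE[OF assms(4)])
    then show False using z assms by auto
  next
    case False
    then obtain \<sigma> a b where "\<sigma> = -1 \<or> \<sigma> = 1" "gap P a b" "e = side P \<sigma> ` {a..b}" by (rule slanted_edgeE[OF assms(4)])
    then show False using z assms(3) by auto
  qed
qed

lemma horizontal_edge_at:
  assumes "z \<in> P" "Im z = ymin P \<or> Im z = ymax P" "\<bar>Re z - sym_axis P\<bar> < half_width P (Im z)"
  obtains e where "e edge_of P" "z \<in> e" "horizontal e"
proof -
  have "z \<notin> interior P"
  proof
    assume "z \<in> interior P"
    then obtain \<epsilon> where e: "\<epsilon> > 0" "cball z \<epsilon> \<subseteq> P" by (auto simp: mem_interior_cball)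
    have "z + Complex 0 \<epsilon> \<in> P" "z - Complex 0 \<epsilon> \<in> P"
      using e by (auto simp: subset_iff dist_norm norm_complex_def)
    then show False using Im_bounds assms(2) e(1) by fastforce
  qed
  then obtain e where e: "e edge_of P" "z \<in> e" by (rule frontier_edge[OF sp_polygon assms(1)])
  have "horizontal e"
  proof (rule ccontr)
    assume "\<not> horizontal e"
    then obtain \<sigma> a b where "\<sigma> = -1 \<or> \<sigma> = 1" "gap P a b" "e = side P \<sigma> ` {a..b}" by (rule slanted_edgeE[OF e(1)])
    then show False using e(2) assms(3) by auto
  qed
  then show ?thesis using that e by blast
qed

end

text \<open>Intermediate vertex heights are allowed, because the horizontal cuts are not edges of
  the polygon.\<close>

lemma (in special_surf) not_on_edge:
  assumes "ymin (P i) < Im z" "Im z < ymax (P i)" "\<bar>Re z - mid i\<bar> < hw i (Im z)"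
  shows "\<not> on_edge S (pt S (i, z)) p"
proof
  assume "on_edge S (pt S (i, z)) p"
  then obtain j e w where w: "e edge_of P j" "w \<in> e" "pt S (i, z) = pt S (j, w)"
    by (metis on_edge_iff surj_pair)
  have "z \<notin> vertices (P i)" using assms P.vertices_iff by fastforce
  with w(3) show False
  proof (cases rule: pt_cases)
    case 1
    then show False using w P.not_in_edge[OF assms] by auto
  next
    case (2 e d)
    then show False using P.not_in_edge[OF assms] by auto
  qed
qed

section \<open>The slope of the trajectory and its passage through one trapezoid\<close>

locale traj = perfect_surf S M V for S :: "'i::finite polygon_surface" and M V +
  fixes g :: "real \<Rightarrow> ('i \<times> complex) set" and \<theta> :: real
    and t :: "int \<Rightarrow> real" and \<kappa> :: "int \<Rightarrow> ('i \<times> complex set) set"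
  assumes geo: "geodesic_on S UNIV g (cis \<theta>)"
    and \<theta>: "0 \<le> \<theta>" "\<theta> < theta_S S"
    and cut: "cutting_sequence S g t \<kappa>"
begin

abbreviation u :: complex where
  "u \<equiv> cis \<theta>"

abbreviation crossing :: "int \<Rightarrow> nat \<Rightarrow> bool" where
  "crossing \<equiv> crossing_type S g t"

lemma finite_trapezoids: "finite (trapezoids S)"
proof (rule finite_subset)
  show "trapezoids S \<subseteq> (UNIV :: 'i set) \<times> (\<Union>i. heights (P i)) \<times> (\<Union>i. heights (P i))"
    by (auto simp: trapezoids_def)
  show "finite ((UNIV :: 'i set) \<times> (\<Union>i. heights (P i)) \<times> (\<Union>i. heights (P i)))"
    by (intro finite_SigmaI finite_UN_I) (auto simp: P.finite_heights)
qed

text \<open>The difference of the two products is the cross product of the direction with the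
  slanted edge \<open>z\<close>, that is, \<open>cmod z * sin (Arg z - \<theta>)\<close>, which is
  positive since 0 \<le> \<theta> < \<open>Arg z\<close> < \<open>pi\<close>.\<close>

lemma slope_aux:
  assumes g: "gap (P i) a b"
  shows "sin \<theta> \<ge> 0 \<and> sin \<theta> * (hw i a + hw i b) < cos \<theta> * (b - a)"
proof -
  define z where "z = Complex (rgt (P i) b) b - Complex (lft (P i) a) a"
  have "theta_S S \<le> slanted_edge_angle S (i, a, b)"
    unfolding theta_S_def using finite_trapezoids g trapezoids_iff by (intro Min_le) auto
  then have lt: "\<theta> < Arg z" using \<theta>(2) by (simp add: slanted_edge_angle_def z_def)
  have bd: "ymin (P i) \<le> a" "a \<le> ymax (P i)" "ymin (P i) \<le> b" "b \<le> ymax (P i)"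
    using P.gap_bounds[OF g] by auto
  have Rez: "Re z = hw i a + hw i b" and Imz: "Im z = b - a"
    using P.lft_rgt_eq[OF bd(1,2)] P.lft_rgt_eq[OF bd(3,4)] by (auto simp: z_def)
  have ab: "a < b" using g by (simp add: gap_def)
  have z0: "z \<noteq> 0" using Imz ab by auto
  have Ap: "Arg z \<le> pi" using Arg_bounded by blast
  have zz: "Re z = cmod z * cos (Arg z)" "Im z = cmod z * sin (Arg z)" by (metis Re_rcis Im_rcis rcis_cmod_Arg)+
  have "Arg z \<noteq> pi" using zz(2) Imz ab by auto
  then have sp: "sin (Arg z - \<theta>) > 0" using lt Ap \<theta>(1) by (intro sin_gt_zero) auto
  have "Im z * cos \<theta> - Re z * sin \<theta> = cmod z * sin (Arg z - \<theta>)"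
    unfolding zz sin_diff by (simp add: algebra_simps)
  also have "\<dots> > 0" using z0 sp by simp
  finally have "Re z * sin \<theta> < Im z * cos \<theta>" by simp
  moreover have "sin \<theta> \<ge> 0" using \<theta>(1) lt Ap by (intro sin_ge_zero) auto
  ultimately show ?thesis unfolding Rez Imz by (simp add: mult.commute)
qed

lemma sin_nonneg: "sin \<theta> \<ge> 0" and cos_pos: "cos \<theta> > 0"
  and slope: "gap (P i) a b \<Longrightarrow> sin \<theta> * (hw i a + hw i b) < cos \<theta> * (b - a)"
proof -
  obtain i :: 'i where True by simp
  have "ymin (P i) \<in> heights (P i)" using P.finite_heights P.heights_nonempty by auto
  then obtain b where g: "gap (P i) (ymin (P i)) b" using P.gap_above P.ymin_less_ymax by metis
  let ?a = "ymin (P i)"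
  have ab: "?a < b" using g by (simp add: gap_def)
  have w: "hw i ?a \<ge> 0" "hw i b \<ge> 0"
    using P.gap_half_width_nonneg[OF g] ab by auto
  show s: "sin \<theta> \<ge> 0" using slope_aux[OF g] by simp
  then have "0 \<le> sin \<theta> * (hw i ?a + hw i b)" using w by simp
  then have "0 < cos \<theta> * (b - ?a)" using slope_aux[OF g] by linarith
  then show "cos \<theta> > 0" using ab by (simp add: zero_less_mult_iff)
qed (use slope_aux in blast)

lemma not_vertex: "g s = pt S (i, z) \<Longrightarrow> z \<notin> vertices (P i)"
  using geodesic_point(2)[OF geo, of s] pt_vertex_iff by auto

text \<open>Here and below, \<open>\<epsilon> = 1\<close> (or \<open>d = 1\<close>) follows the trajectory forwards and \<open>\<epsilon> = -1\<close> backwards.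
  Reversing the direction exchanges left with right and bottom with top.\<close>

lemma passage:
  assumes gp: "gap (P i) a b" and \<epsilon>: "\<epsilon> = 1 \<or> \<epsilon> = -1"
    and z: "z \<in> P i" "a \<le> Im z" "Im z \<le> b" and gs: "g s0 = pt S (i, z)"
  obtains q where "q \<ge> 0"
    "\<And>s. 0 \<le> s \<Longrightarrow> s \<le> q \<Longrightarrow> z + (\<epsilon> * s) *\<^sub>R u \<in> P i \<and> a \<le> Im (z + (\<epsilon> * s) *\<^sub>R u) \<and>
       Im (z + (\<epsilon> * s) *\<^sub>R u) \<le> b \<and> g (s0 + \<epsilon> * s) = pt S (i, z + (\<epsilon> * s) *\<^sub>R u)"
    "\<And>s. 0 < s \<Longrightarrow> s < q \<Longrightarrow> \<bar>Re (z + (\<epsilon> * s) *\<^sub>R u) - mid i\<bar> < hw i (Im (z + (\<epsilon> * s) *\<^sub>R u))"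
    "(\<exists>y. z + (\<epsilon> * q) *\<^sub>R u = side (P i) \<epsilon> y \<and> a < y \<and> y < b) \<or>
     (Im (z + (\<epsilon> * q) *\<^sub>R u) = (if \<epsilon> = 1 then b else a) \<and>
      \<bar>Re (z + (\<epsilon> * q) *\<^sub>R u) - mid i\<bar> < hw i (if \<epsilon> = 1 then b else a))"
proof -
  \<comment> \<open>Multiplication by \<epsilon> turns backward motion into forward motion:
    \<open>near\<close> and \<open>far\<close> are the bases left behind and approached, and
    \<open>x\<close>, \<open>y\<close> are the coordinates in which \<open>trapezoid_exit\<close>
    applies.\<close>
  define near where "near = (if \<epsilon> = 1 then a else b)"
  define far where "far = (if \<epsilon> = 1 then b else a)"
  define H where "H = b - a"
  define x where "x = \<epsilon> * (Re z - mid i)"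
  define y where "y = \<epsilon> * (Im z - near)"
  let ?w = "hw i"
  let ?p = "\<lambda>s. z + (\<epsilon> * s) *\<^sub>R u"
  have ab: "a < b" using gp by (simp add: gap_def)
  have nf: "far - near = \<epsilon> * H" using \<epsilon> by (auto simp: near_def far_def H_def)
  have wn: "?w near \<ge> 0" "?w far \<ge> 0" using P.gap_half_width_nonneg[OF gp] ab by (auto simp: near_def far_def)
  have H: "H > 0" using ab by (simp add: H_def)
  have sl: "sin \<theta> * (?w near + ?w far) < cos \<theta> * H"
    using slope[OF gp] \<epsilon> by (auto simp: near_def far_def H_def add.commute)
  have w: "?w (near + \<epsilon> * h) = ?w near + (?w far - ?w near) * (h / H)" if "0 \<le> h" "h \<le> H" for h
  proof -
    have "a \<le> near + \<epsilon> * h" "near + \<epsilon> * h \<le> b" using that \<epsilon> by (auto simp: near_def H_def)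
    then have "H * ?w (near + \<epsilon> * h) = (b - (near + \<epsilon> * h)) * ?w a + (near + \<epsilon> * h - a) * ?w b"
      using P.gap_affine[OF gp, of "near + \<epsilon> * h"] by (simp add: H_def)
    also have "\<dots> = H * (?w near + (?w far - ?w near) * (h / H))"
      using \<epsilon> ab by (auto simp: near_def far_def H_def divide_simps) (simp_all add: algebra_simps)
    finally show ?thesis using H by simp
  qed
  have yb: "0 \<le> y" "y \<le> H" using z \<epsilon> by (auto simp: y_def near_def H_def)
  have Imz: "Im z = near + \<epsilon> * y" using \<epsilon> by (auto simp: y_def)
  have "\<bar>x\<bar> \<le> ?w near + (?w far - ?w near) * (y / H)"
    using z P.mem_iff[of z i] \<epsilon> w[OF yb] unfolding Imz x_def by auto
  from trapezoid_exit[OF refl H wn cos_pos sin_nonneg sl yb this]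
  obtain q where q: "q \<ge> 0"
    "\<And>s. 0 \<le> s \<Longrightarrow> s \<le> q \<Longrightarrow> y + s * sin \<theta> \<le> H \<and> \<bar>x + s * cos \<theta>\<bar> \<le> ?w near + (?w far - ?w near) * ((y + s * sin \<theta>) / H)"
    "\<And>s. 0 < s \<Longrightarrow> s < q \<Longrightarrow> \<bar>x + s * cos \<theta>\<bar> < ?w near + (?w far - ?w near) * ((y + s * sin \<theta>) / H)"
    "x + q * cos \<theta> = ?w near + (?w far - ?w near) * ((y + q * sin \<theta>) / H) \<or> y + q * sin \<theta> = H"
    by metis
  have Imp: "Im (?p s) = near + \<epsilon> * (y + s * sin \<theta>)" for s using Imz by (simp add: algebra_simps)
  have Rep: "Re (?p s) - mid i = \<epsilon> * (x + s * cos \<theta>)" for s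
    using \<epsilon> by (auto simp: x_def algebra_simps)
  have y0: "0 \<le> y + s * sin \<theta>" if "0 \<le> s" for s using yb sin_nonneg that by simp
  have wp: "?w (Im (?p s)) = ?w near + (?w far - ?w near) * ((y + s * sin \<theta>) / H)" if "0 \<le> s" "s \<le> q" for s
    unfolding Imp using w[OF y0[OF that(1)]] q(2)[OF that] by simp
  have ab_p: "\<bar>Re (?p s) - mid i\<bar> = \<bar>x + s * cos \<theta>\<bar>" for s unfolding Rep using \<epsilon> by auto
  have Im_b: "a \<le> Im (?p s)" "Im (?p s) \<le> b" if "0 \<le> s" "s \<le> q" for s
    using y0[OF that(1)] q(2)[OF that] \<epsilon> unfolding Imp by (auto simp: near_def H_def)
  have inP: "?p s \<in> P i" if "0 \<le> s" "s \<le> q" for s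
    using P.gap_mem_iff[OF gp Im_b[OF that]] q(2)[OF that] ab_p[of s] wp[OF that] by simp
  have gp': "g (s0 + \<epsilon> * s) = pt S (i, ?p s)" if "0 \<le> s" "s \<le> q" for s
    using geodesic_continues[OF geo, of s0 "s0 + \<epsilon> * s" i z "s0 + \<epsilon> * s"] gs z(1) inP[OF that] by simp
  \<comment> \<open>The trajectory avoids vertices, so it leaves through the relative interior of a
    side or of the far base.\<close>
  have nv: "?p q \<notin> vertices (P i)" using not_vertex gp'[of q] q(1) by blast
  have fin: "(\<exists>y. ?p q = side (P i) \<epsilon> y \<and> a < y \<and> y < b) \<or>
     (Im (?p q) = far \<and> \<bar>Re (?p q) - mid i\<bar> < ?w far)"
  proof (cases "y + q * sin \<theta> = H")
    case True
    then have I: "Im (?p q) = far" unfolding Imp using nf by simp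
    have "far \<in> heights (P i)" using gp by (auto simp: far_def gap_def)
    then have "\<bar>Re (?p q) - mid i\<bar> \<noteq> ?w far" using nv I unfolding P.vertices_iff by auto
    moreover have "\<bar>Re (?p q) - mid i\<bar> \<le> ?w far" using inP[of q] q(1) I P.mem_iff[of "?p q" i] by auto
    ultimately show ?thesis using I by simp
  next
    case False
    then have "x + q * cos \<theta> = ?w (Im (?p q))" using q(4) wp[of q] q(1) by simp
    then have s: "?p q = side (P i) \<epsilon> (Im (?p q))"
      using Rep[of q] unfolding complex_eq_iff by simp
    have \<epsilon>': "\<epsilon> = -1 \<or> \<epsilon> = 1" using \<epsilon> by blast
    have "\<not> (Im (?p q) = a \<or> Im (?p q) = b)"
      using P.side_vertex_iff[OF \<epsilon>' gp Im_b[of q]] q(1) nv unfolding s[symmetric] by blast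
    then have "a < Im (?p q)" "Im (?p q) < b" using Im_b[of q] q(1) by auto
    then show ?thesis using s by blast
  qed
  show ?thesis
  proof (rule that[OF q(1)])
    fix s :: real assume s: "0 < s" "s < q"
    then show "\<bar>Re (?p s) - mid i\<bar> < ?w (Im (?p s))" using ab_p[of s] wp[of s] q(3)[OF s] by simp
  qed (use inP Im_b gp' fin in \<open>auto simp: far_def\<close>)
qed

end

section \<open>Types of crossings\<close>

context traj
begin

lemma t_mono: "strict_mono t" and t_range: "range t = {s. \<exists>p. on_edge S (g s) p}"
  using cut by (auto simp: cutting_sequence_def)

lemma t_on_edge: "\<exists>p. on_edge S (g (t n)) p"
  using t_range by blast

lemma t_less_iff [simp]: "t m < t n \<longleftrightarrow> m < n"
  using t_mono by (simp add: strict_mono_less)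

lemma c_letter: "on_edge S (g (t n)) p \<Longrightarrow> \<kappa> n = letter_of S p"
  using cut letter_unique[OF geodesic_point(2)[OF geo, of "t n"]] unfolding cutting_sequence_def by (metis UNIV_I)

text \<open>When no edge is met strictly before \<open>q\<close> in the time direction
  \<open>e\<close>, strict monotonicity of \<open>t\<close> leaves no index between \<open>n\<close>
  and the index of this crossing.\<close>

lemma adjacent_crossing:
  assumes e: "e = 1 \<or> e = -1" and q: "0 < q"
    and free: "\<And>s p. 0 < s \<Longrightarrow> s < q \<Longrightarrow> \<not> on_edge S (g (t n + of_int e * s)) p"
    and p: "on_edge S (g (t n + of_int e * q)) p"
  shows "t n + of_int e * q = t (n + e)"
proof -
  obtain m where m: "t m = t n + of_int e * q" using t_range p by (metis (mono_tags, lifting) mem_Collect_eq rangeE)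
  have "\<not> (0 < s \<and> s < q)" if "t k = t n + of_int e * s" for k s
    using free[of s] t_on_edge[of k] that by metis
  note fr = this
  have tlt: "t k < t l \<longleftrightarrow> k < l" for k l by simp
  show ?thesis using e
  proof
    assume e: "e = 1"
    then have "n < m" using m q tlt[of n m] by simp
    moreover have "\<not> n + 1 < m"
    proof
      assume "n + 1 < m"
      then have "t (n + 1) < t m" "t n < t (n + 1)" using tlt[of "n + 1" m] tlt[of n "n + 1"] by auto
      then show False using fr[of "n + 1" "t (n + 1) - t n"] m e by auto
    qed
    ultimately have "m = n + 1" by simp
    then show ?thesis using m e by simp
  next
    assume e: "e = -1"
    then have "m < n" using m q tlt[of m n] by simp
    moreover have "\<not> m < n - 1"
    proof
      assume "m < n - 1"
      then have "t m < t (n - 1)" "t (n - 1) < t n" using tlt[of m "n - 1"] tlt[of "n - 1" n] by auto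
      then show False using fr[of "n - 1" "t n - t (n - 1)"] m e by auto
    qed
    ultimately have "m = n - 1" by simp
    then show ?thesis using m e by simp
  qed
qed

lemma between_crossings: "t n < s \<Longrightarrow> s < t (n + 1) \<Longrightarrow> \<not> on_edge S (g s) p"
proof
  assume s: "t n < s" "s < t (n + 1)" and p: "on_edge S (g s) p"
  obtain m where "s = t m" using t_range p by (metis (mono_tags, lifting) mem_Collect_eq rangeE)
  then have "n < m" "m < n + 1" using s by auto
  then show False by simp
qed

lemma off_edge_unique:
  assumes "g s = pt S (i, z)" "g s = pt S (j, w)" "\<And>p. \<not> on_edge S (g s) p"
  shows "j = i" "w = z"
proof -
  have "pt S (i, z) = pt S (j, w)" "z \<notin> vertices (P i)" using assms(1,2) not_vertex by auto
  then have "j = i \<and> w = z"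
  proof (cases rule: pt_cases)
    case (2 e d)
    then have "on_edge S (g s) (i, e)" using assms(1) on_edge_iff by auto
    then show ?thesis using assms(3) by blast
  qed simp
  then show "j = i" "w = z" by auto
qed

text \<open>\<open>crossing_type\<close> asserts only the existence of a polygon, a path and two
  edges. They are unique: between crossings a point lies on no edge and has a single representative,
  and the end points are not vertices.\<close>

lemma crossing_type_iff:
  assumes path: "\<And>s. s \<in> {t n..t (n + 1)} \<Longrightarrow> z + s *\<^sub>R u \<in> P i \<and> g s = pt S (i, z + s *\<^sub>R u)"
    and e: "e edge_of P i" "z + t n *\<^sub>R u \<in> e"
    and f: "f edge_of P i" "z + t (n + 1) *\<^sub>R u \<in> f"
  shows "crossing n k \<longleftrightarrow> edge_level (P i) f = edge_level (P i) e + k"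
proof
  assume "edge_level (P i) f = edge_level (P i) e + k"
  then show "crossing n k" unfolding crossing_type_def using path e f by blast
next
  assume "crossing n k"
  then obtain i' z' v' e' f' where p': "\<And>s. s \<in> {t n..t (n + 1)} \<Longrightarrow> z' + s *\<^sub>R v' \<in> P i' \<and> g s = pt S (i', z' + s *\<^sub>R v')"
    and e': "e' edge_of P i'" "z' + t n *\<^sub>R v' \<in> e'"
    and f': "f' edge_of P i'" "z' + t (n + 1) *\<^sub>R v' \<in> f'"
    and l: "edge_level (P i') f' = edge_level (P i') e' + k"
    unfolding crossing_type_def by metis
  have tn: "t n < t (n + 1)" by simp
  have eq: "i' = i" "z' + s *\<^sub>R v' = z + s *\<^sub>R u" if "t n < s" "s < t (n + 1)" for s
  proof -
    have off: "\<And>p. \<not> on_edge S (g s) p" using between_crossings that by blast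
    have "s \<in> {t n..t (n + 1)}" using that by auto
    then have "g s = pt S (i, z + s *\<^sub>R u)" "g s = pt S (i', z' + s *\<^sub>R v')" using path p' by blast+
    then show "i' = i" "z' + s *\<^sub>R v' = z + s *\<^sub>R u" using off_edge_unique off by blast+
  qed
  define D where "D = t (n + 1) - t n"
  have D: "D > 0" "t (n + 1) = t n + D" using tn by (simp_all add: D_def)
  \<comment> \<open>Two distinct times strictly between the crossings determine the line and its
    velocity.\<close>
  define r where "r = t n + D / 3"
  define r' where "r' = t n + 2 * D / 3"
  have r: "t n < r" "r < t (n + 1)" "t n < r'" "r' < t (n + 1)" "r \<noteq> r'" using D(1) unfolding r_def r'_def D(2) by auto
  have i: "i' = i" using eq(1) r by blast
  have 1: "z' + r *\<^sub>R v' = z + r *\<^sub>R u" "z' + r' *\<^sub>R v' = z + r' *\<^sub>R u" using eq(2) r by auto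
  have "(r' - r) *\<^sub>R v' = (z' + r' *\<^sub>R v') - (z' + r *\<^sub>R v')" by (simp add: algebra_simps)
  also have "\<dots> = (r' - r) *\<^sub>R u" unfolding 1 by (simp add: algebra_simps)
  finally have v: "v' = cis \<theta>" using r(5) by simp
  then have z: "z' = z" using 1 by simp
  have nv: "z + t n *\<^sub>R u \<notin> vertices (P i)" "z + t (n + 1) *\<^sub>R u \<notin> vertices (P i)"
    using path[of "t n"] path[of "t (n + 1)"] not_vertex tn by auto
  have "e' = e" "f' = f"
    using edge_unique[OF P.sp_polytope _ e(1) _ e(2) nv(1)] edge_unique[OF P.sp_polytope _ f(1) _ f(2) nv(2)] e' f' i v z by auto
  then show "edge_level (P i) f = edge_level (P i) e + k" using l i by simp
qed

text \<open>The path is parametrised away from time \<open>t n\<close>. Followed backwards, the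
  entry and exit edges exchange roles and the crossing has index \<open>n - 1\<close>.\<close>

lemma crossing_type_path:
  fixes d :: int
  assumes d: "d = 1 \<or> d = -1" and Q: "0 < Q" "t n + of_int d * Q = t (n + d)"
    and path: "\<And>s. 0 \<le> s \<Longrightarrow> s \<le> Q \<Longrightarrow> z + (of_int d * s) *\<^sub>R u \<in> P i \<and>
       g (t n + of_int d * s) = pt S (i, z + (of_int d * s) *\<^sub>R u)"
    and e: "e edge_of P i" "z \<in> e"
    and f: "f edge_of P i" "z + (of_int d * Q) *\<^sub>R u \<in> f"
  shows "crossing (if d = 1 then n else n - 1) k \<longleftrightarrow>
    (if d = 1 then edge_level (P i) f = edge_level (P i) e + k
     else edge_level (P i) e = edge_level (P i) f + k)"
proof -
  define w where "w = z - t n *\<^sub>R u"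
  have w: "w + s *\<^sub>R u = z + (of_int d * (of_int d * (s - t n))) *\<^sub>R u" for s
    using d by (auto simp: w_def algebra_simps)
  have p: "w + s *\<^sub>R u \<in> P i \<and> g s = pt S (i, w + s *\<^sub>R u)"
    if "0 \<le> of_int d * (s - t n)" "of_int d * (s - t n) \<le> Q" for s
  proof -
    have "t n + of_int d * (of_int d * (s - t n)) = s" using d by auto
    then show ?thesis using path[OF that] unfolding w by simp
  qed
  from d show ?thesis
  proof
    assume d: "d = 1"
    have "crossing n k \<longleftrightarrow> edge_level (P i) f = edge_level (P i) e + k"
    proof (rule crossing_type_iff[of n w i])
      fix s assume "s \<in> {t n..t (n + 1)}"
      then show "w + s *\<^sub>R u \<in> P i \<and> g s = pt S (i, w + s *\<^sub>R u)" using p[of s] d Q by auto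
    next
      have "t (n + 1) = t n + Q" using Q d by simp
      then show "w + t (n + 1) *\<^sub>R u \<in> f" using f(2) d by (simp add: w_def algebra_simps)
    qed (use e f in \<open>auto simp: w_def\<close>)
    then show ?thesis using d by simp
  next
    assume d: "d = -1"
    have tq: "t (n - 1) = t n - Q" using Q d by simp
    have "crossing (n - 1) k \<longleftrightarrow> edge_level (P i) e = edge_level (P i) f + k"
    proof (rule crossing_type_iff[of "n - 1" w i])
      fix s assume "s \<in> {t (n - 1)..t (n - 1 + 1)}"
      then show "w + s *\<^sub>R u \<in> P i \<and> g s = pt S (i, w + s *\<^sub>R u)" using p[of s] d tq by auto
    next
      show "w + t (n - 1) *\<^sub>R u \<in> f" using f(2) d unfolding tq by (simp add: w_def algebra_simps)
    qed (use e f in \<open>auto simp: w_def\<close>)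
    then show ?thesis using d by simp
  qed
qed

lemma strict_between:
  fixes s q :: real
  assumes "0 < s" "s < q" "a < Im z" "Im z < b" "a \<le> Im (z + (\<epsilon> * q) *\<^sub>R u)" "Im (z + (\<epsilon> * q) *\<^sub>R u) \<le> b"
  shows "a < Im (z + (\<epsilon> * s) *\<^sub>R u)" "Im (z + (\<epsilon> * s) *\<^sub>R u) < b"
proof -
  have eq: "q * Im (z + (\<epsilon> * s) *\<^sub>R u) = (q - s) * Im z + s * Im (z + (\<epsilon> * q) *\<^sub>R u)"
    by (simp add: algebra_simps)
  have "(q - s) * a + s * a < (q - s) * Im z + s * Im (z + (\<epsilon> * q) *\<^sub>R u)"
    using assms by (intro add_less_le_mono mult_strict_left_mono mult_left_mono) auto
  then have "q * a < q * Im (z + (\<epsilon> * s) *\<^sub>R u)" unfolding eq by (simp add: algebra_simps)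
  then show "a < Im (z + (\<epsilon> * s) *\<^sub>R u)" using assms by simp
  have "(q - s) * b + s * b > (q - s) * Im z + s * Im (z + (\<epsilon> * q) *\<^sub>R u)"
    using assms by (intro add_less_le_mono mult_strict_left_mono mult_left_mono) auto
  then have "q * b > q * Im (z + (\<epsilon> * s) *\<^sub>R u)" unfolding eq by (simp add: algebra_simps)
  then show "Im (z + (\<epsilon> * s) *\<^sub>R u) < b" using assms by simp
qed

lemma gap_inside: "gap (P i) a b \<Longrightarrow> a < y \<Longrightarrow> y < b \<Longrightarrow> ymin (P i) < y \<and> y < ymax (P i)"
  using P.gap_bounds[of i a b] by auto

text \<open>The trajectory is flatter than the slanted edges, so it does not run from the bottom of a
  trapezoid to its top.\<close>

lemma through_trapezoid:
  assumes gp: "gap (P i) a b" and \<epsilon>: "\<epsilon> = 1 \<or> \<epsilon> = -1"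
    and z: "z \<in> P i" "w \<in> P i" "w = z + (\<epsilon> * q) *\<^sub>R u" "q \<ge> 0"
    and ends: "Im z = (if \<epsilon> = 1 then a else b)" "Im w = (if \<epsilon> = 1 then b else a)"
  shows False
proof -
  have "\<bar>Re z - mid i\<bar> \<le> hw i (Im z)" "\<bar>Re w - mid i\<bar> \<le> hw i (Im w)"
    using z P.mem_iff by auto
  then have "\<epsilon> * (Re w - Re z) \<le> hw i a + hw i b"
    using \<epsilon> ends by (auto simp: abs_le_iff)
  moreover have "\<epsilon> * (Re w - Re z) = q * cos \<theta>" using z(3) \<epsilon> by auto
  ultimately have "sin \<theta> * (q * cos \<theta>) \<le> sin \<theta> * (hw i a + hw i b)"
    using sin_nonneg by (intro mult_left_mono) auto
  also have "\<dots> < cos \<theta> * (b - a)" by (rule slope[OF gp])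
  also have "b - a = q * sin \<theta>" using z(3) \<epsilon> ends by auto
  finally show False by (simp add: algebra_simps)
qed

text \<open>For \<open>d = 1\<close>: from the left side the trajectory leaves the trapezoid on the
  right side, of the same level, or through the top. In the latter case the level rises by exactly
  one, because the top is a horizontal edge, or else the trapezoid above is left on its right side.
  \<open>q\<close> is the time of leaving the trapezoid, which for type 1 may precede the next
  crossing.\<close>

lemma cross_side:
  fixes d :: int
  assumes d: "d = 1 \<or> d = -1" and gp: "gap (P i) a b" and y0: "a < y0" "y0 < b"
    and z0: "z0 = side (P i) (- of_int d) y0" and gn: "g (t n) = pt S (i, z0)"
  obtains q where "0 < q"
    "\<And>s. 0 \<le> s \<Longrightarrow> s \<le> q \<Longrightarrow> z0 + (of_int d * s) *\<^sub>R u \<in> P i \<and> a \<le> Im (z0 + (of_int d * s) *\<^sub>R u) \<and>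
       Im (z0 + (of_int d * s) *\<^sub>R u) \<le> b \<and> g (t n + of_int d * s) = pt S (i, z0 + (of_int d * s) *\<^sub>R u)"
    "(\<exists>y. z0 + (of_int d * q) *\<^sub>R u = side (P i) (of_int d) y \<and> a < y \<and> y < b) \<and>
       t n + of_int d * q = t (n + d) \<and> (\<forall>k. crossing (if d = 1 then n else n - 1) k \<longleftrightarrow> k = 0)
     \<or> Im (z0 + (of_int d * q) *\<^sub>R u) = (if d = 1 then b else a) \<and>
       \<bar>Re (z0 + (of_int d * q) *\<^sub>R u) - mid i\<bar> < hw i (if d = 1 then b else a) \<and>
       q \<le> of_int d * (t (n + d) - t n) \<and> (\<forall>k. crossing (if d = 1 then n else n - 1) k \<longleftrightarrow> k = 1)"
proof -
  define \<epsilon> :: real where "\<epsilon> = of_int d"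
  have \<epsilon>: "\<epsilon> = 1 \<or> \<epsilon> = -1" and \<epsilon>d: "\<epsilon> = 1 \<longleftrightarrow> d = 1" using d by (auto simp: \<epsilon>_def)
  have \<epsilon>': "-\<epsilon> = -1 \<or> -\<epsilon> = 1" "\<epsilon> = -1 \<or> \<epsilon> = 1" using \<epsilon> by auto
  let ?p = "\<lambda>s. z0 + (\<epsilon> * s) *\<^sub>R u"
  let ?w = "hw i"
  define far where "far = (if d = 1 then b else a)"
  have far: "far = (if \<epsilon> = 1 then b else a)" using \<epsilon>d by (simp add: far_def)
  have w0: "?w y0 > 0" by (rule P.gap_half_width_pos[OF gp y0])
  have z0e: "z0 \<in> side (P i) (-\<epsilon>) ` {a..b}" using z0 y0 by (simp add: \<epsilon>_def)
  have e0: "side (P i) (-\<epsilon>) ` {a..b} edge_of P i" by (rule P.side_edge[OF gp \<epsilon>'(1)])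
  have z0P: "z0 \<in> P i" using z0e edge_of_imp_subset[OF e0] by auto
  have Im0: "Im z0 = y0" using z0 by simp
  obtain q where q: "q \<ge> 0"
    "\<And>s. 0 \<le> s \<Longrightarrow> s \<le> q \<Longrightarrow> ?p s \<in> P i \<and> a \<le> Im (?p s) \<and> Im (?p s) \<le> b \<and> g (t n + \<epsilon> * s) = pt S (i, ?p s)"
    "\<And>s. 0 < s \<Longrightarrow> s < q \<Longrightarrow> \<bar>Re (?p s) - mid i\<bar> < ?w (Im (?p s))"
    "(\<exists>y. ?p q = side (P i) \<epsilon> y \<and> a < y \<and> y < b) \<or>
     (Im (?p q) = far \<and> \<bar>Re (?p q) - mid i\<bar> < ?w far)"
  proof -
    have "a \<le> Im z0" "Im z0 \<le> b" using y0 Im0 by auto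
    from passage[OF gp \<epsilon> z0P this gn, folded far] show ?thesis using that by blast
  qed
  have "q \<noteq> 0"
  proof
    assume "q = 0"
    then have "(\<exists>y. z0 = side (P i) \<epsilon> y) \<or> y0 = far" using q(4) Im0 by auto
    moreover have "z0 \<noteq> side (P i) \<epsilon> y" for y
      using z0 w0 \<epsilon> by (auto simp: complex_eq_iff \<epsilon>_def)
    ultimately show False using y0 by (auto simp: far_def split: if_splits)
  qed
  then have qp: "q > 0" using q(1) by simp
  have Imq: "a \<le> Im (?p q)" "Im (?p q) \<le> b" using q(2)[of q] qp by auto
  have free: "\<not> on_edge S (g (t n + \<epsilon> * s)) p" if s: "0 < s" "s < q" for s p
  proof -
    have "a < Im (?p s)" "Im (?p s) < b" using strict_between[OF s _ _ Imq] y0 Im0 by auto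
    then show ?thesis using not_on_edge[of i "?p s" p] gap_inside[OF gp] q(3)[OF s] q(2)[of s] s by auto
  qed
  from q(4) show ?thesis
  proof
    assume "\<exists>y. ?p q = side (P i) \<epsilon> y \<and> a < y \<and> y < b"
    then obtain y where y: "?p q = side (P i) \<epsilon> y" "a < y" "y < b" by blast
    have f: "side (P i) \<epsilon> ` {a..b} edge_of P i" by (rule P.side_edge[OF gp \<epsilon>'(2)])
    have qf: "?p q \<in> side (P i) \<epsilon> ` {a..b}" using y by auto
    have "on_edge S (g (t n + \<epsilon> * q)) (i, side (P i) \<epsilon> ` {a..b})"
      unfolding on_edge_iff using f qf q(2)[of q] qp by auto
    then have tq: "t n + \<epsilon> * q = t (n + d)"
      using adjacent_crossing[OF d qp] free unfolding \<epsilon>_def by blast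
    have ct: "crossing (if d = 1 then n else n - 1) k \<longleftrightarrow> k = 0" for k
      using crossing_type_path[OF d qp, of n z0 i "side (P i) (-\<epsilon>) ` {a..b}" "side (P i) \<epsilon> ` {a..b}" k]
        tq q(2) e0 z0e f qf P.edge_level_side[OF gp, of "-\<epsilon>"] P.edge_level_side[OF gp, of \<epsilon>] unfolding \<epsilon>_def by auto
    show ?thesis
    proof (rule that[of q, folded \<epsilon>_def])
      show "0 < q" by (rule qp)
      show "?p s \<in> P i \<and> a \<le> Im (?p s) \<and> Im (?p s) \<le> b \<and> g (t n + \<epsilon> * s) = pt S (i, ?p s)"
        if "0 \<le> s" "s \<le> q" for s by (rule q(2)[OF that])
    qed (use y ct tq in blast)
  next
    assume top: "Im (?p q) = far \<and> \<bar>Re (?p q) - mid i\<bar> < ?w far"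
    \<comment> \<open>At the extreme height of the polygon the far base is a horizontal edge; at any
      other height it is a cut, and the passage continues in the next trapezoid.\<close>
    show ?thesis
    proof (cases "far = (if d = 1 then ymax (P i) else ymin (P i))")
      case True
      have "?p q \<in> P i" using q(2)[of q] qp by simp
      then obtain e where e: "e edge_of P i" "?p q \<in> e" "horizontal e"
        using P.horizontal_edge_at[of "?p q" i] top True by (metis (full_types))
      have "on_edge S (g (t n + \<epsilon> * q)) (i, e)"
        unfolding on_edge_iff using e q(2)[of q] qp by auto
      then have tq: "t n + \<epsilon> * q = t (n + d)"
        using adjacent_crossing[OF d qp] free unfolding \<epsilon>_def by blast
      have ct: "crossing (if d = 1 then n else n - 1) k \<longleftrightarrow> k = 1" for k
      proof -
        have "if d = 1 then edge_level (P i) e = edge_level (P i) (side (P i) (-\<epsilon>) ` {a..b}) + 1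
          else edge_level (P i) (side (P i) (-\<epsilon>) ` {a..b}) = edge_level (P i) e + 1"
          using P.edge_level_top[OF gp _ e] P.edge_level_bottom[OF gp _ e] True top by (auto simp: far_def)
        then show ?thesis
          using crossing_type_path[OF d qp, of n z0 i "side (P i) (-\<epsilon>) ` {a..b}" e k]
            tq q(2) e0 z0e e unfolding \<epsilon>_def by (auto split: if_splits)
      qed
      have "\<epsilon> * (t (n + d) - t n) = q" unfolding tq[symmetric] using \<epsilon> by auto
      then have qe: "q \<le> \<epsilon> * (t (n + d) - t n)" by simp
      show ?thesis
      proof (rule that[of q, folded \<epsilon>_def])
        show "0 < q" by (rule qp)
        show "?p s \<in> P i \<and> a \<le> Im (?p s) \<and> Im (?p s) \<le> b \<and> g (t n + \<epsilon> * s) = pt S (i, ?p s)"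
          if "0 \<le> s" "s \<le> q" for s by (rule q(2)[OF that])
      qed (use top ct qe in \<open>unfold far_def, blast\<close>)
    next
      case False
      have hf: "far \<in> heights (P i)" using gp by (auto simp: far_def gap_def)
      have fb: "ymin (P i) < far" "far < ymax (P i)"
        using False P.gap_bounds[OF gp] by (auto simp: far_def split: if_splits)
      obtain a' b' where g': "gap (P i) a' b'" "far = (if d = 1 then a' else b')"
        using P.gap_above[OF hf fb(2)] P.gap_below[OF hf fb(1)] by metis
      define far' where "far' = (if d = 1 then b' else a')"
      have ab': "a' < b'" using g' by (simp add: gap_def)
      let ?z = "?p q"
      have zP: "?z \<in> P i" "g (t n + \<epsilon> * q) = pt S (i, ?z)" using q(2)[of q] qp by auto
      have Imz: "a' \<le> Im ?z" "Im ?z \<le> b'" using top g' ab' by auto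
      let ?r = "\<lambda>s. ?z + (\<epsilon> * s) *\<^sub>R u"
      obtain q' where q': "q' \<ge> 0"
        "\<And>s. 0 \<le> s \<Longrightarrow> s \<le> q' \<Longrightarrow> ?r s \<in> P i \<and> a' \<le> Im (?r s) \<and> Im (?r s) \<le> b' \<and> g (t n + \<epsilon> * q + \<epsilon> * s) = pt S (i, ?r s)"
        "\<And>s. 0 < s \<Longrightarrow> s < q' \<Longrightarrow> \<bar>Re (?r s) - mid i\<bar> < ?w (Im (?r s))"
        "(\<exists>y. ?r q' = side (P i) \<epsilon> y \<and> a' < y \<and> y < b') \<or>
         (Im (?r q') = far' \<and> \<bar>Re (?r q') - mid i\<bar> < ?w far')"
      proof -
        have f': "far' = (if \<epsilon> = 1 then b' else a')" using \<epsilon>d by (simp add: far'_def)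
        from passage[OF g'(1) \<epsilon> zP(1) Imz zP(2), folded f'] show ?thesis using that by blast
      qed
      \<comment> \<open>Entered by its near base, the second trapezoid cannot be left by its far
        base.\<close>
      have "\<not> Im (?r q') = far'"
        using through_trapezoid[OF g'(1) \<epsilon> zP(1) _ refl q'(1)] q'(2)[of q'] q'(1) top g'(2) \<epsilon>d by (auto simp: far'_def)
      then obtain y where y: "?r q' = side (P i) \<epsilon> y" "a' < y" "y < b'" using q'(4) by blast
      have "q' \<noteq> 0"
      proof
        assume "q' = 0"
        then have "Im ?z = y" using y(1) by simp
        then show False using top y(2,3) g'(2) by (auto split: if_splits)
      qed
      then have qp': "q' > 0" using q'(1) by simp
      have rp: "?r s = ?p (q + s)" for s by (simp add: algebra_simps)
      let ?Q = "q + q'"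
      have Qp: "?Q > 0" using qp qp' by simp
      have path: "?p s \<in> P i \<and> g (t n + \<epsilon> * s) = pt S (i, ?p s)" if "0 \<le> s" "s \<le> ?Q" for s
      proof (cases "s \<le> q")
        case True then show ?thesis using q(2) that by blast
      next
        case False
        then show ?thesis using q'(2)[of "s - q"] that unfolding rp by (simp add: algebra_simps)
      qed
      have free': "\<not> on_edge S (g (t n + \<epsilon> * s)) p" if s: "0 < s" "s < ?Q" for s p
      proof -
        consider "s < q" | "s = q" | "q < s" by linarith
        then show ?thesis
        proof cases
          case 1 then show ?thesis using free s by blast
        next
          case 2 then show ?thesis using not_on_edge[of i ?z p] top fb zP by simp
        next
          case 3
          define s' where "s' = s - q"
          have s': "0 < s'" "s' < q'" using 3 s by (auto simp: s'_def)
          have sp: "?r s' = ?p s" unfolding rp by (simp add: s'_def)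
          have "ymin (P i) < Im (?r s') \<and> Im (?r s') < ymax (P i)"
          proof -
            have "Im (?r s') = Im ?z + \<epsilon> * (s' * sin \<theta>)" "Im (?r q') = Im ?z + \<epsilon> * (q' * sin \<theta>)" by simp_all
            moreover have "0 \<le> s' * sin \<theta>" "s' * sin \<theta> \<le> q' * sin \<theta>" using s' sin_nonneg by (auto intro: mult_right_mono)
            moreover have "Im (?r q') = y" using y by simp
            moreover have "ymin (P i) < y" "y < ymax (P i)" using gap_inside[OF g'(1) y(2,3)] by auto
            ultimately show ?thesis using \<epsilon> top fb by auto
          qed
          then have "\<not> on_edge S (pt S (i, ?r s')) p" using not_on_edge[of i "?r s'" p] q'(3)[OF s'] by blast
          then show ?thesis using path[of s] s unfolding sp by simp
        qed
      qed
      let ?f = "side (P i) \<epsilon> ` {a'..b'}"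
      have f: "?f edge_of P i" by (rule P.side_edge[OF g'(1) \<epsilon>'(2)])
      have qf: "?p ?Q \<in> ?f" using y unfolding rp by auto
      have "on_edge S (g (t n + \<epsilon> * ?Q)) (i, ?f)"
        unfolding on_edge_iff using f qf path[of ?Q] Qp by auto
      then have tq: "t n + \<epsilon> * ?Q = t (n + d)"
        using adjacent_crossing[OF d Qp] free' unfolding \<epsilon>_def by blast
      have ct: "crossing (if d = 1 then n else n - 1) k \<longleftrightarrow> k = 1" for k
      proof -
        have "if d = 1 then edge_level (P i) ?f = edge_level (P i) (side (P i) (-\<epsilon>) ` {a..b}) + 1
          else edge_level (P i) (side (P i) (-\<epsilon>) ` {a..b}) = edge_level (P i) ?f + 1"
          using P.edge_level_adjacent[OF gp, of b' \<epsilon> "-\<epsilon>"] P.edge_level_adjacent[OF _ gp, of a' "-\<epsilon>" \<epsilon>] g' by (auto simp: far_def)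
        then show ?thesis
          using crossing_type_path[OF d Qp, of n z0 i "side (P i) (-\<epsilon>) ` {a..b}" ?f k]
            tq path e0 z0e f qf unfolding \<epsilon>_def by (auto split: if_splits)
      qed
      have "\<epsilon> * (t (n + d) - t n) = ?Q" unfolding tq[symmetric] using \<epsilon> by auto
      then have qe: "q \<le> \<epsilon> * (t (n + d) - t n)" using qp' by linarith
      show ?thesis
      proof (rule that[of q, folded \<epsilon>_def])
        show "0 < q" by (rule qp)
        show "?p s \<in> P i \<and> a \<le> Im (?p s) \<and> Im (?p s) \<le> b \<and> g (t n + \<epsilon> * s) = pt S (i, ?p s)"
          if "0 \<le> s" "s \<le> q" for s by (rule q(2)[OF that])
      qed (use top ct qe in \<open>unfold far_def, blast\<close>)
    qed
  qed
qed

end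

section \<open>The two trapezoids at a crossing\<close>

lemma affine_root:
  fixes f :: "real \<Rightarrow> real"
  assumes f: "\<And>s. f s = k + s * l" and pq: "p < q" "f p * f q < 0"
  obtains r where "p < r" "r < q" "f r = 0"
proof -
  have l: "l \<noteq> 0" using pq(2) by (auto simp: f mult_less_0_iff)
  define r where "r = - k / l"
  have fr: "f s = l * (s - r)" for s using l by (simp add: f r_def field_simps)
  have "l * l * ((p - r) * (q - r)) < 0" using pq(2) by (simp add: fr algebra_simps)
  then have "(p - r) * (q - r) < 0" using l by (simp add: mult_less_0_iff)
  then have "p < r" "r < q" using pq(1) by (auto simp: mult_less_0_iff)
  then show ?thesis using that fr by simp
qed

lemma affine_sign:
  fixes f :: "real \<Rightarrow> real"
  assumes f: "\<And>s. f s = k + s * l" and r: "p < r" "r < q" "f r = 0" "f p \<noteq> 0"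
  shows "f p * f q < 0"
proof -
  have fr: "f s = l * (s - r)" for s using r(3) by (simp add: f algebra_simps)
  have l: "l \<noteq> 0" using r(4) by (auto simp: fr)
  have "(l * l) * ((p - r) * (q - r)) < 0" using l r by (intro mult_pos_neg mult_neg_pos) (auto simp: zero_less_mult_iff)
  then show ?thesis by (simp add: fr algebra_simps)
qed

lemma (in special_poly) half_width_diff:
  assumes "gap P a b" "a \<le> y" "y \<le> b" "a \<le> y'" "y' \<le> b"
  shows "half_width P y - half_width P y' = (half_width P b - half_width P a) / (b - a) * (y - y')"
proof -
  have ab: "b - a > 0" using assms(1) by (simp add: gap_def)
  have "(b - a) * (half_width P y - half_width P y') = (half_width P b - half_width P a) * (y - y')"
    using gap_affine[OF assms(1,2,3)] gap_affine[OF assms(1,4,5)] by (simp add: algebra_simps)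
  then show ?thesis using ab by (simp add: field_simps)
qed

context traj
begin

text \<open>The trajectory meets the preimage under \<open>V\<close> of the side crossed at time \<open>t n\<close> exactly at the
  zero of this affine function, extended over the two trapezoids adjacent to that side.\<close>

definition phi :: "int \<Rightarrow> 'i \<Rightarrow> real \<Rightarrow> real \<Rightarrow> real \<Rightarrow> real \<Rightarrow> real" where
  "phi n i a b y0 s = 2 * hw i y0 - M * (y0 - a) + (s - t n) *
     (cos \<theta> - M * sin \<theta> + (hw i b - hw i a) / (b - a) * sin \<theta>)"

lemma phi_affine: "\<exists>k l. \<forall>s. phi n i a b y0 s = k + s * l"
proof -
  define L where "L = cos \<theta> - M * sin \<theta> + (hw i b - hw i a) / (b - a) * sin \<theta>"
  have "phi n i a b y0 s = (2 * hw i y0 - M * (y0 - a) - t n * L) + s * L" for s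
    unfolding phi_def L_def[symmetric] by (simp add: algebra_simps)
  then show ?thesis by blast
qed

text \<open>The value is the abscissa of the trajectory minus that of the diagonal at the same
  height. It is affine in time because the half-width is affine between consecutive vertex
  heights.\<close>

lemma phi_left:
  assumes g: "gap (P i) a b" and y0: "a \<le> y0" "y0 \<le> b"
    and z: "z = side (P i) 1 y0 + (s - t n) *\<^sub>R u" "a \<le> Im z" "Im z \<le> b"
  shows "phi n i a b y0 s = Re z - mid i - M * (Im z - a) + hw i (Im z)"
proof -
  define m where "m = (hw i b - hw i a) / (b - a)"
  have Iz: "Im z = y0 + (s - t n) * sin \<theta>"
    and Rz: "Re z = mid i + hw i y0 + (s - t n) * cos \<theta>"
    using z(1) by simp_all
  have wz: "hw i (Im z) = hw i y0 + m * ((s - t n) * sin \<theta>)"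
    using P.half_width_diff[OF g z(2,3) y0] Iz by (simp add: m_def)
  show ?thesis unfolding phi_def m_def[symmetric] wz unfolding Rz Iz by (simp add: algebra_simps)
qed

text \<open>The modulus relation, used at the height of the crossing and at that of
  \<open>z\<close>, turns the distance to the part of the diagonal in \<open>P j\<close> into the
  same affine expression. This makes the signs of \<open>phi\<close> comparable across the gluing
  edge.\<close>

lemma phi_right:
  assumes o: "opposite i a b j c d" and y0: "a \<le> y0" "y0 \<le> b"
    and z: "z = side (P j) (-1) (y0 - a + c) + (s - t n) *\<^sub>R u" "c \<le> Im z" "Im z \<le> d"
  shows "phi n i a b y0 s = Re z - mid j - M * (Im z - d) - hw j (Im z)"
proof -
  have g: "gap (P i) a b" "d - c = b - a" using o by (auto simp: opposite_def)
  define m where "m = (hw i b - hw i a) / (b - a)"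
  define Y where "Y = Im z - c + a"
  have Y: "a \<le> Y" "Y \<le> b" using z g(2) by (auto simp: Y_def)
  have wY: "hw i Y = hw i y0 + m * (Y - y0)"
    using P.half_width_diff[OF g(1) Y y0] by (simp add: m_def)
  have 1: "M * (b - a) = 2 * hw i Y + 2 * hw j (Im z)"
    using opposite_modulus[OF o Y] by (simp add: Y_def)
  have 2: "M * (b - a) = 2 * hw i y0 + 2 * hw j (y0 - a + c)"
    using opposite_modulus[OF o y0] by simp
  have Yv: "Y = y0 + (s - t n) * sin \<theta>" and Rz: "Re z = mid j - hw j (y0 - a + c) + (s - t n) * cos \<theta>"
    using z(1) by (simp_all add: Y_def)
  have "Re z - mid j - M * (Im z - d) - hw j (Im z)
    = - hw j (y0 - a + c) + (s - t n) * cos \<theta> - M * (Y - a) + M * (b - a) - hw j (Im z)"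
  proof -
    have "Im z - d = (Y - a) - (b - a)" using g(2) by (simp add: Y_def)
    then have "M * (Im z - d) = M * (Y - a) - M * (b - a)" by (simp only: right_diff_distrib)
    then show ?thesis unfolding Rz by simp
  qed
  also have "\<dots> = hw i y0 + hw i Y + (s - t n) * cos \<theta> - M * (Y - a)"
    using 1 2 by linarith
  also have "\<dots> = phi n i a b y0 s"
    unfolding phi_def m_def[symmetric] wY unfolding Yv by (simp add: algebra_simps)
  finally show ?thesis by simp
qed

text \<open>A time interval around the crossing in which the trajectory stays in the two trapezoids
  at the gluing edge. Each end pairs the type of a crossing with a sign of \<open>phi\<close>: the
  left side (type 0) and the top (type 1) lie to the left of the diagonal, the right side (type 0)
  and the bottom (type 1) to its right. For type 1 the end is the time at the base of the trapezoid,
  which may be a cut strictly between two crossings.\<close>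

definition window :: "int \<Rightarrow> 'i \<Rightarrow> real \<Rightarrow> real \<Rightarrow> 'i \<Rightarrow> real \<Rightarrow> real \<Rightarrow> real \<Rightarrow> real \<Rightarrow> real \<Rightarrow> bool" where
  "window n i a b j c d y0 p q \<longleftrightarrow> opposite i a b j c d \<and> a < y0 \<and> y0 < b \<and>
     g (t n) = pt S (i, side (P i) 1 y0) \<and>
     t (n - 1) \<le> p \<and> p < t n \<and> t n < q \<and> q \<le> t (n + 1) \<and>
     (\<forall>s. p \<le> s \<and> s \<le> t n \<longrightarrow> (let z = side (P i) 1 y0 + (s - t n) *\<^sub>R u
        in z \<in> P i \<and> a \<le> Im z \<and> Im z \<le> b \<and> g s = pt S (i, z))) \<and>
     (\<forall>s. t n \<le> s \<and> s \<le> q \<longrightarrow> (let z = side (P j) (-1) (y0 - a + c) + (s - t n) *\<^sub>R u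
        in z \<in> P j \<and> c \<le> Im z \<and> Im z \<le> d \<and> g s = pt S (j, z))) \<and>
     (p = t (n - 1) \<and> phi n i a b y0 p < 0 \<and> (\<forall>k. crossing (n - 1) k \<longleftrightarrow> k = 0) \<or>
      y0 + (p - t n) * sin \<theta> = a \<and> phi n i a b y0 p > 0 \<and> (\<forall>k. crossing (n - 1) k \<longleftrightarrow> k = 1)) \<and>
     (q = t (n + 1) \<and> phi n i a b y0 q > 0 \<and> (\<forall>k. crossing n k \<longleftrightarrow> k = 0) \<or>
      y0 - a + c + (q - t n) * sin \<theta> = d \<and> phi n i a b y0 q < 0 \<and> (\<forall>k. crossing n k \<longleftrightarrow> k = 1))"

lemma window_exists:
  assumes o: "opposite i a b j c d" and y0: "a < y0" "y0 < b" and gn: "g (t n) = pt S (i, side (P i) 1 y0)"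
  obtains p q where "window n i a b j c d y0 p q"
proof -
  have g: "gap (P i) a b" "gap (P j) c d" "d - c = b - a" using o by (auto simp: opposite_def)
  have Mp: "M > 0" by (rule M_pos[OF g(1)])
  have y0': "c < y0 - a + c" "y0 - a + c < d" using y0 g(3) by auto
  let ?z1 = "\<lambda>s. side (P i) 1 y0 + (s - t n) *\<^sub>R u"
  let ?z2 = "\<lambda>s. side (P j) (-1) (y0 - a + c) + (s - t n) *\<^sub>R u"
  have gn': "g (t n) = pt S (j, side (P j) (-1) (y0 - a + c))"
    using gn opposite_pt(1)[OF o] y0 by simp
  obtain q1 where q1: "0 < q1"
    "\<And>s. 0 \<le> s \<Longrightarrow> s \<le> q1 \<Longrightarrow> ?z2 (t n + s) \<in> P j \<and> c \<le> Im (?z2 (t n + s)) \<and> Im (?z2 (t n + s)) \<le> d \<and> g (t n + s) = pt S (j, ?z2 (t n + s))"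
    "(\<exists>y. ?z2 (t n + q1) = side (P j) 1 y \<and> c < y \<and> y < d) \<and> t n + q1 = t (n + 1) \<and> (\<forall>k. crossing n k \<longleftrightarrow> k = 0)
     \<or> Im (?z2 (t n + q1)) = d \<and> \<bar>Re (?z2 (t n + q1)) - mid j\<bar> < hw j d \<and>
       q1 \<le> t (n + 1) - t n \<and> (\<forall>k. crossing n k \<longleftrightarrow> k = 1)"
    by (rule cross_side[of 1 j c d "y0 - a + c" "side (P j) (-1) (y0 - a + c)" n])
      (use g y0' gn' in \<open>simp_all\<close>)
  obtain q2 where q2: "0 < q2"
    "\<And>s. 0 \<le> s \<Longrightarrow> s \<le> q2 \<Longrightarrow> ?z1 (t n - s) \<in> P i \<and> a \<le> Im (?z1 (t n - s)) \<and> Im (?z1 (t n - s)) \<le> b \<and> g (t n - s) = pt S (i, ?z1 (t n - s))"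
    "(\<exists>y. ?z1 (t n - q2) = side (P i) (-1) y \<and> a < y \<and> y < b) \<and> t n - q2 = t (n - 1) \<and> (\<forall>k. crossing (n - 1) k \<longleftrightarrow> k = 0)
     \<or> Im (?z1 (t n - q2)) = a \<and> \<bar>Re (?z1 (t n - q2)) - mid i\<bar> < hw i a \<and>
       q2 \<le> t n - t (n - 1) \<and> (\<forall>k. crossing (n - 1) k \<longleftrightarrow> k = 1)"
    by (rule cross_side[of "-1" i a b y0 "side (P i) 1 y0" n])
      (use g y0 gn in \<open>simp_all\<close>)
  define p where "p = t n - q2"
  define q where "q = t n + q1"
  have z1: "?z1 s \<in> P i" "a \<le> Im (?z1 s)" "Im (?z1 s) \<le> b" "g s = pt S (i, ?z1 s)" if "p \<le> s" "s \<le> t n" for s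
    using q2(2)[of "t n - s"] that by (auto simp: p_def)
  have z2: "?z2 s \<in> P j" "c \<le> Im (?z2 s)" "Im (?z2 s) \<le> d" "g s = pt S (j, ?z2 s)" if "t n \<le> s" "s \<le> q" for s
    using q1(2)[of "s - t n"] that by (auto simp: q_def)
  have pq: "p < t n" "t n < q" using q1(1) q2(1) by (auto simp: p_def q_def)
  have phip: "phi n i a b y0 p = Re (?z1 p) - mid i - M * (Im (?z1 p) - a) + hw i (Im (?z1 p))"
    by (rule phi_left[OF g(1)]) (use y0 z1[of p] pq in auto)
  have phiq: "phi n i a b y0 q = Re (?z2 q) - mid j - M * (Im (?z2 q) - d) - hw j (Im (?z2 q))"
    by (rule phi_right[OF o]) (use y0 z2[of q] pq in auto)
  have A: "p = t (n - 1) \<and> phi n i a b y0 p < 0 \<and> (\<forall>k. crossing (n - 1) k \<longleftrightarrow> k = 0) \<or>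
      y0 + (p - t n) * sin \<theta> = a \<and> phi n i a b y0 p > 0 \<and> (\<forall>k. crossing (n - 1) k \<longleftrightarrow> k = 1)"
    using q2(3)
  proof
    assume *: "(\<exists>y. ?z1 (t n - q2) = side (P i) (-1) y \<and> a < y \<and> y < b) \<and> t n - q2 = t (n - 1) \<and> (\<forall>k. crossing (n - 1) k \<longleftrightarrow> k = 0)"
    then obtain y where y: "?z1 p = side (P i) (-1) y" "a < y" unfolding p_def by (elim conjE exE)
    \<comment> \<open>The left side and the diagonal start at the same bottom left corner, and at
      height \<open>y\<close> the diagonal is ahead by \<open>M * (y - a)\<close>.\<close>
    have "phi n i a b y0 p = - (M * (y - a))" unfolding phip y(1) by simp
    then have "phi n i a b y0 p < 0" using Mp y(2) by simp
    moreover have "p = t (n - 1)" using * by (simp add: p_def)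
    ultimately show ?thesis using * by blast
  next
    assume *: "Im (?z1 (t n - q2)) = a \<and> \<bar>Re (?z1 (t n - q2)) - mid i\<bar> < hw i a \<and>
       q2 \<le> t n - t (n - 1) \<and> (\<forall>k. crossing (n - 1) k \<longleftrightarrow> k = 1)"
    then have I: "Im (?z1 p) = a" and R: "\<bar>Re (?z1 p) - mid i\<bar> < hw i a" unfolding p_def by blast+
    have "phi n i a b y0 p > 0" using R unfolding phip I by simp
    moreover have "y0 + (p - t n) * sin \<theta> = a" using I by simp
    ultimately show ?thesis using * by blast
  qed
  have B: "q = t (n + 1) \<and> phi n i a b y0 q > 0 \<and> (\<forall>k. crossing n k \<longleftrightarrow> k = 0) \<or>
      y0 - a + c + (q - t n) * sin \<theta> = d \<and> phi n i a b y0 q < 0 \<and> (\<forall>k. crossing n k \<longleftrightarrow> k = 1)"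
    using q1(3)
  proof
    assume *: "(\<exists>y. ?z2 (t n + q1) = side (P j) 1 y \<and> c < y \<and> y < d) \<and> t n + q1 = t (n + 1) \<and> (\<forall>k. crossing n k \<longleftrightarrow> k = 0)"
    then obtain y where y: "?z2 q = side (P j) 1 y" "y < d" unfolding q_def by (elim conjE exE)
    \<comment> \<open>The diagonal ends at the top right corner, so at height \<open>y\<close> it is
      behind the right side by \<open>M * (d - y)\<close>.\<close>
    have "phi n i a b y0 q = M * (d - y)" unfolding phiq y(1) by (simp add: algebra_simps)
    then have "phi n i a b y0 q > 0" using Mp y(2) by simp
    moreover have "q = t (n + 1)" using * by (simp add: q_def)
    ultimately show ?thesis using * by blast
  next
    assume *: "Im (?z2 (t n + q1)) = d \<and> \<bar>Re (?z2 (t n + q1)) - mid j\<bar> < hw j d \<and>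
       q1 \<le> t (n + 1) - t n \<and> (\<forall>k. crossing n k \<longleftrightarrow> k = 1)"
    then have I: "Im (?z2 q) = d" and R: "\<bar>Re (?z2 q) - mid j\<bar> < hw j d" unfolding q_def by blast+
    have "phi n i a b y0 q < 0" using R unfolding phiq I by simp
    moreover have "y0 - a + c + (q - t n) * sin \<theta> = d" using I by simp
    ultimately show ?thesis using * by blast
  qed
  have tp: "t (n - 1) \<le> p" using q2(3) unfolding p_def by (elim disjE conjE) linarith+
  have tq: "q \<le> t (n + 1)" using q1(3) unfolding q_def by (elim disjE conjE) linarith+
  have "window n i a b j c d y0 p q"
    unfolding window_def Let_def
    by (intro conjI allI impI o y0 gn pq tp tq A B; elim conjE; rule z1 z2; assumption)
  then show ?thesis by (rule that)
qed

context
  fixes n i a b j c d y0 p q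
  assumes win: "window n i a b j c d y0 p q"
begin

lemma win_opposite: "opposite i a b j c d" and win_y0: "a < y0" "y0 < b"
  and win_crossing: "g (t n) = pt S (i, side (P i) 1 y0)"
  and win_times: "t (n - 1) \<le> p" "p < t n" "t n < q" "q \<le> t (n + 1)"
  and win_entry: "p = t (n - 1) \<and> phi n i a b y0 p < 0 \<and> (\<forall>k. crossing (n - 1) k \<longleftrightarrow> k = 0) \<or>
      y0 + (p - t n) * sin \<theta> = a \<and> phi n i a b y0 p > 0 \<and> (\<forall>k. crossing (n - 1) k \<longleftrightarrow> k = 1)"
  and win_exit: "q = t (n + 1) \<and> phi n i a b y0 q > 0 \<and> (\<forall>k. crossing n k \<longleftrightarrow> k = 0) \<or>
      y0 - a + c + (q - t n) * sin \<theta> = d \<and> phi n i a b y0 q < 0 \<and> (\<forall>k. crossing n k \<longleftrightarrow> k = 1)"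
  using win unfolding window_def by - (elim conjE, assumption)+

lemma win_gaps: "gap (P i) a b" "gap (P j) c d" "d - c = b - a"
  using win_opposite by (auto simp: opposite_def)

lemma win_left:
  assumes "p \<le> s" "s \<le> t n" "z = side (P i) 1 y0 + (s - t n) *\<^sub>R u"
  shows "z \<in> P i" "a \<le> Im z" "Im z \<le> b" "g s = pt S (i, z)" "p < s \<Longrightarrow> a < Im z" "Im z < b"
    "phi n i a b y0 s = Re z - mid i - M * (Im z - a) + hw i (Im z)"
proof -
  have all: "\<forall>s. p \<le> s \<and> s \<le> t n \<longrightarrow> (let z = side (P i) 1 y0 + (s - t n) *\<^sub>R u
        in z \<in> P i \<and> a \<le> Im z \<and> Im z \<le> b \<and> g s = pt S (i, z))"
    using win unfolding window_def by - (elim conjE, assumption)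
  show 1: "z \<in> P i" "a \<le> Im z" "Im z \<le> b" "g s = pt S (i, z)"
    using all assms unfolding Let_def by blast+
  have "a \<le> Im (side (P i) 1 y0 + (p - t n) *\<^sub>R u)"
    using all win_times(2) unfolding Let_def by (meson order.refl order_less_imp_le)
  then have ap: "a \<le> y0 + (p - t n) * sin \<theta>" by simp
  have Iz: "Im z = y0 + (s - t n) * sin \<theta>" using assms(3) by simp
  have "(s - t n) * sin \<theta> \<le> 0" using assms(2) sin_nonneg by (simp add: mult_nonpos_nonneg)
  then show "Im z < b" using win_y0 Iz by simp
  show "a < Im z" if "p < s"
  proof (cases "sin \<theta> = 0")
    case True then show ?thesis using Iz win_y0 by simp
  next
    case False
    then have "(p - t n) * sin \<theta> < (s - t n) * sin \<theta>" using that sin_nonneg by simp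
    then show ?thesis using ap Iz by linarith
  qed
  show "phi n i a b y0 s = Re z - mid i - M * (Im z - a) + hw i (Im z)"
    by (rule phi_left[OF win_gaps(1)]) (use win_y0 assms(3) 1 in auto)
qed

lemma win_right:
  assumes "t n \<le> s" "s \<le> q" "z = side (P j) (-1) (y0 - a + c) + (s - t n) *\<^sub>R u"
  shows "z \<in> P j" "c \<le> Im z" "Im z \<le> d" "g s = pt S (j, z)" "s < q \<Longrightarrow> Im z < d" "c < Im z"
    "phi n i a b y0 s = Re z - mid j - M * (Im z - d) - hw j (Im z)"
proof -
  have all: "\<forall>s. t n \<le> s \<and> s \<le> q \<longrightarrow> (let z = side (P j) (-1) (y0 - a + c) + (s - t n) *\<^sub>R u
        in z \<in> P j \<and> c \<le> Im z \<and> Im z \<le> d \<and> g s = pt S (j, z))"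
    using win unfolding window_def by - (elim conjE, assumption)
  show 1: "z \<in> P j" "c \<le> Im z" "Im z \<le> d" "g s = pt S (j, z)"
    using all assms unfolding Let_def by blast+
  have "Im (side (P j) (-1) (y0 - a + c) + (q - t n) *\<^sub>R u) \<le> d"
    using all win_times(3) unfolding Let_def by (meson order.refl order_less_imp_le)
  then have dq: "y0 - a + c + (q - t n) * sin \<theta> \<le> d" by simp
  have Iz: "Im z = y0 - a + c + (s - t n) * sin \<theta>" using assms(3) by simp
  have "(s - t n) * sin \<theta> \<ge> 0" using assms(1) sin_nonneg by simp
  then show "c < Im z" using win_y0 Iz by simp
  show "Im z < d" if "s < q"
  proof (cases "sin \<theta> = 0")
    case True then show ?thesis using Iz win_y0 win_gaps(3) by simp
  next
    case False
    then have "(s - t n) * sin \<theta> < (q - t n) * sin \<theta>" using that sin_nonneg by simp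
    then show ?thesis using dq Iz by linarith
  qed
  show "phi n i a b y0 s = Re z - mid j - M * (Im z - d) - hw j (Im z)"
    by (rule phi_right[OF win_opposite]) (use win_y0 assms(3) 1 in auto)
qed

lemma win_letter:
  "\<kappa> n = letter_of S (i, side (P i) 1 ` {a..b})" "\<not> horizontal_letter (\<kappa> n)"
proof -
  have e: "side (P i) 1 ` {a..b} edge_of P i" using P.side_edge[OF win_gaps(1)] by simp
  have "on_edge S (g (t n)) (i, side (P i) 1 ` {a..b})"
    unfolding on_edge_iff win_crossing using e win_y0 by auto
  then show "\<kappa> n = letter_of S (i, side (P i) 1 ` {a..b})" by (rule c_letter)
  then show "\<not> horizontal_letter (\<kappa> n)"
    using horizontal_letter_iff[OF e] P.not_horizontal_side[OF win_gaps(1)] by simp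
qed

end

end

section \<open>The derived sequence\<close>

context traj
begin

text \<open>For a (00) word \<open>phi\<close> runs from negative to positive, for a (11) word from
  positive to negative; for mixed types its sign is the same at both ends.\<close>

lemma window_marked:
  assumes w: "window n i a b j c d y0 p q"
  shows "marked S g t \<kappa> n \<longleftrightarrow> phi n i a b y0 p * phi n i a b y0 q < 0"
proof -
  have "marked S g t \<kappa> n \<longleftrightarrow> (crossing (n - 1) 0 \<and> crossing n 0) \<or>
      (crossing (n - 1) 1 \<and> crossing n 1)"
    using win_letter(2)[OF w] by (simp add: marked_def middle_of_word_def)
  also have "\<dots> \<longleftrightarrow> phi n i a b y0 p * phi n i a b y0 q < 0"
    using win_entry[OF w] win_exit[OF w] by (elim disjE conjE) (simp_all add: mult_less_0_iff)
  finally show ?thesis .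
qed

text \<open>\<tau> is the time at which the trajectory meets the diagonal of the \<open>n\<close>th
  crossing, so that the derived trajectory meets the gluing edge itself.\<close>

definition hit :: "int \<Rightarrow> real \<Rightarrow> bool" where
  "hit n \<tau> \<longleftrightarrow> (\<exists>i a b j c d y0 p q. window n i a b j c d y0 p q \<and> p < \<tau> \<and> \<tau> < q \<and> phi n i a b y0 \<tau> = 0)"

lemma hit_exists:
  assumes m: "marked S g t \<kappa> n" and nh: "\<not> horizontal_letter (\<kappa> n)"
  obtains \<tau> where "hit n \<tau>"
proof -
  obtain k e where p: "on_edge S (g (t n)) (k, e)" using t_on_edge by (metis surj_pair)
  have nv: "g (t n) \<notin> vertex_points S" using geodesic_point(2)[OF geo] by simp
  have "e edge_of P k" using p on_edge_iff by simp
  then have "\<not> horizontal e" using nh c_letter[OF p] horizontal_letter_iff by simp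
  then obtain i a b j c d y where o: "opposite i a b j c d" "a < y" "y < b" "g (t n) = pt S (i, side (P i) 1 y)"
    by (rule slanted_letterE[OF nv p])
  obtain p q where w: "window n i a b j c d y p q" by (rule window_exists[OF o])
  have pq: "p < q" using win_times[OF w] by simp
  obtain k l where f: "\<And>s. phi n i a b y s = k + s * l" using phi_affine by metis
  obtain r where "p < r" "r < q" "phi n i a b y r = 0"
    using affine_root[OF f pq] window_marked[OF w] m by blast
  then show ?thesis using that w unfolding hit_def by blast
qed

lemma hit_times: "hit n \<tau> \<Longrightarrow> t (n - 1) < \<tau> \<and> \<tau> < t (n + 1)"
  unfolding hit_def using win_times by (meson order.strict_trans1 order.strict_trans2)

lemma hit_letter:
  assumes "hit n \<tau>"
  obtains p where "on_edge S (V (g \<tau>)) p" "\<kappa> n = letter_of S p"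
proof -
  obtain i a b j c d y0 p q where w: "window n i a b j c d y0 p q" and pq: "p < \<tau>" "\<tau> < q"
    and ph: "phi n i a b y0 \<tau> = 0" using assms unfolding hit_def by blast
  note o = win_opposite[OF w] and gaps = win_gaps[OF w]
  have "\<exists>y. a < y \<and> y < b \<and> V (g \<tau>) = pt S (i, side (P i) 1 y)"
  proof (cases "\<tau> \<le> t n")
    case True
    define z where "z = side (P i) 1 y0 + (\<tau> - t n) *\<^sub>R u"
    have p\<tau>: "p \<le> \<tau>" using pq by simp
    note l = win_left[OF w p\<tau> True z_def]
    define y where "y = Im z"
    have y: "a < y" "y < b" using l(5,6) pq by (auto simp: y_def)
    have Re: "Re z = mid i + M * (y - a) - hw i y" using l(7) ph by (simp add: y_def)
    then have zc: "z = Complex (mid i + M * (y - a) - hw i y) y"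
      by (simp add: complex_eq_iff y_def)
    \<comment> \<open>Membership in the polygon yields the inequality that places the point on this
      part of the diagonal.\<close>
    have "\<bar>Re z - mid i\<bar> \<le> hw i y" using l(1) P.mem_iff by (auto simp: y_def)
    then have "M * (y - a) \<le> 2 * hw i y" unfolding Re by simp
    then show ?thesis using V_shear1(1)[OF o y] l(4) y unfolding zc by auto
  next
    case False
    define z where "z = side (P j) (-1) (y0 - a + c) + (\<tau> - t n) *\<^sub>R u"
    have t\<tau>: "t n \<le> \<tau>" "\<tau> \<le> q" using False pq by auto
    note l = win_right[OF w t\<tau> z_def]
    define y where "y = Im z - c + a"
    have yc: "y - a + c = Im z" by (simp add: y_def)
    have y: "a < y" "y < b" using l(5,6) pq gaps(3) by (auto simp: y_def)
    have "Im z - d = y - b" using gaps(3) by (simp add: y_def)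
    then have Re: "Re z = mid j + M * (y - b) + hw j (Im z)" using l(7) ph by simp
    then have zc: "z = Complex (mid j + M * (y - b) + hw j (y - a + c)) (y - a + c)"
      by (simp add: complex_eq_iff yc)
    have "\<bar>Re z - mid j\<bar> \<le> hw j (Im z)" using l(1) P.mem_iff by auto
    then have "0 \<le> M * (y - b) + 2 * hw j (Im z)" unfolding Re by simp
    moreover have "M * (b - a) = 2 * hw i y + 2 * hw j (Im z)"
      using opposite_modulus[OF o, of y] y yc by simp
    moreover have "M * (y - b) = M * (y - a) - M * (b - a)" by (simp add: algebra_simps)
    ultimately have "2 * hw i y \<le> M * (y - a)" by linarith
    then show ?thesis using V_shear2(1)[OF o y] l(4) y zc by metis
  qed
  then obtain y where y: "a < y" "y < b" "V (g \<tau>) = pt S (i, side (P i) 1 y)" by blast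
  have "side (P i) 1 ` {a..b} edge_of P i" using P.side_edge[OF gaps(1)] by simp
  then have "on_edge S (V (g \<tau>)) (i, side (P i) 1 ` {a..b})"
    unfolding on_edge_iff y(3) using y(1,2) by auto
  then show ?thesis using that win_letter(1)[OF w] by blast
qed

text \<open>A right side is glued to a left side, and strictly between vertex heights the two sides
  of a trapezoid are disjoint. So a class has only one representative on a right side.\<close>

lemma right_side_unique:
  assumes eq: "pt S (i, side (P i) 1 y) = pt S (i', side (P i') 1 y')"
    and g: "gap (P i) a b" "gap (P i') a' b'" and y: "a < y" "y < b" "a' < y'" "y' < b'"
  shows "i' = i" "a' = a" "b' = b" "y' = y"
proof -
  have nv: "side (P i) 1 y \<notin> vertices (P i)" using P.gap_not_vertex[OF g(1), of "side (P i) 1 y"] y by simp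
  have iy: "i' = i \<and> y' = y" using eq nv
  proof (cases rule: pt_cases)
    case 1
    then have "Im (side (P i') 1 y') = Im (side (P i) 1 y)" by simp
    then show ?thesis using 1 by simp
  next
    case (2 e d)
    have f: "side (P i) 1 ` {a..b} edge_of P i" using P.side_edge[OF g(1)] by simp
    have "side (P i) 1 y \<in> side (P i) 1 ` {a..b}" using y by simp
    then have e: "e = side (P i) 1 ` {a..b}" using edge_unique[OF P.sp_polytope 2(1) f 2(2) _ nv] by blast
    obtain j c d' where o: "opposite i a b j c d'" by (rule opposite_exists[OF g(1)])
    have "(i', (+) d ` e) = (j, side (P j) (-1) ` {c..d'})" using 2(3) o unfolding e opposite_def by metis
    then have j: "i' = j" and im: "(+) d ` e = side (P j) (-1) ` {c..d'}" by auto
    have "side (P j) 1 y' \<in> side (P j) (-1) ` {c..d'}"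
      using 2(4,2) unfolding im[symmetric] j by blast
    then obtain x where x: "side (P j) 1 y' = side (P j) (-1) x" by blast
    then have "Im (side (P j) 1 y') = Im (side (P j) (-1) x)" "Re (side (P j) 1 y') = Re (side (P j) (-1) x)"
      by simp_all
    then have "hw j y' = 0" by simp
    then show ?thesis using P.gap_half_width_pos[OF g(2) y(3,4)] j by simp
  qed
  then show "i' = i" "y' = y" by auto
  have "gap (P i) a' b'" "a' \<le> y" "y \<le> b'" using iy g(2) y by auto
  then show "a' = a" "b' = b" using P.gap_unique[OF g(1) _ y(1,2)] by blast+
qed

text \<open>The crossing determines the first trapezoid and the height in its window, and
  \<open>phi\<close> is affine and nonzero at \<open>q\<close>, so it has only one zero.\<close>

lemma hit_unique:
  assumes "hit n \<tau>" "hit n \<tau>'"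
  shows "\<tau> = \<tau>'"
proof -
  obtain i a b j c d y0 p q where w: "window n i a b j c d y0 p q" and ph: "phi n i a b y0 \<tau> = 0"
    using assms(1) unfolding hit_def by blast
  obtain i' a' b' j' c' d' y0' p' q' where w': "window n i' a' b' j' c' d' y0' p' q'" and ph': "phi n i' a' b' y0' \<tau>' = 0"
    using assms(2) unfolding hit_def by blast
  have "pt S (i, side (P i) 1 y0) = pt S (i', side (P i') 1 y0')"
    using win_crossing[OF w] win_crossing[OF w'] by simp
  note eq = right_side_unique[OF this win_gaps(1)[OF w] win_gaps(1)[OF w'] win_y0[OF w] win_y0[OF w']]
  obtain k l where f: "\<And>s. phi n i a b y0 s = k + s * l" using phi_affine by metis
  have q: "k + q * l \<noteq> 0" using win_exit[OF w] unfolding f by linarith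
  have 0: "k + \<tau> * l = 0" "k + \<tau>' * l = 0" using ph ph' unfolding eq f by simp_all
  have "l \<noteq> 0" using q 0(1) by (metis mult_zero_right)
  moreover have "\<tau> * l = \<tau>' * l" using 0 by linarith
  ultimately show ?thesis by simp
qed

text \<open>In the wrong order, both hits would fall between the two crossings, in the trapezoid
  \<open>(j, c, d)\<close> shared by the windows. There the second diagonal lies to the right of the
  first by the width of the neighbouring trapezoid. A trajectory that ends on the right side crosses
  the first diagonal from left to right, so it cannot meet the second one earlier.\<close>

lemma hit_order:
  assumes h: "hit n \<tau>" and h': "hit (n + 1) \<tau>'"
  shows "\<tau> < \<tau>'"
proof (rule ccontr)
  assume "\<not> \<tau> < \<tau>'"
  then have le: "\<tau>' \<le> \<tau>" by simp
  obtain i a b j c d y0 p q where w: "window n i a b j c d y0 p q" and pq: "p < \<tau>" "\<tau> < q" and ph: "phi n i a b y0 \<tau> = 0"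
    using h unfolding hit_def by blast
  obtain i' a' b' j' c' d' y0' p' q' where w': "window (n + 1) i' a' b' j' c' d' y0' p' q'"
    and pq': "p' < \<tau>'" "\<tau>' < q'" and ph': "phi (n + 1) i' a' b' y0' \<tau>' = 0"
    using h' unfolding hit_def by blast
  have tp: "t n \<le> p'" "p' < t (n + 1)" using win_times(1,2)[OF w'] by simp_all
  have tq: "q \<le> t (n + 1)" using win_times(4)[OF w] .
  let ?z = "\<lambda>s. side (P j) (-1) (y0 - a + c) + (s - t n) *\<^sub>R u"
  let ?z' = "\<lambda>s. side (P i') 1 y0' + (s - t (n + 1)) *\<^sub>R u"
  have same: "i' = j" "?z' s = ?z s" "c < Im (?z s)" "Im (?z s) < d" "a' < Im (?z s)" "Im (?z s) < b'"
    "phi n i a b y0 s = Re (?z s) - mid j - M * (Im (?z s) - d) - hw j (Im (?z s))"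
    "phi (n + 1) i' a' b' y0' s = Re (?z s) - mid j - M * (Im (?z s) - a') + hw j (Im (?z s))"
    if s: "\<tau>' \<le> s" "s \<le> \<tau>" for s
  proof -
    have s1: "t n \<le> s" "s \<le> q" "s < q" and s2: "p' \<le> s" "s \<le> t (n + 1)" "p' < s" using s tp tq pq pq' by auto
    note r = win_right[OF w s1(1,2) refl] and l = win_left[OF w' s2(1,2) refl]
    have off: "\<And>p. \<not> on_edge S (g s) p" using between_crossings[of n s] s1 s2 tp tq by simp
    show i: "i' = j" and zz: "?z' s = ?z s" using off_edge_unique[OF r(4) l(4) off] by auto
    show "c < Im (?z s)" "Im (?z s) < d" using r(5,6) s1(3) by auto
    show "a' < Im (?z s)" "Im (?z s) < b'" using l(5,6) s2(3) unfolding zz by auto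
    show "phi n i a b y0 s = Re (?z s) - mid j - M * (Im (?z s) - d) - hw j (Im (?z s))"
      by (rule r(7))
    show "phi (n + 1) i' a' b' y0' s = Re (?z s) - mid j - M * (Im (?z s) - a') + hw j (Im (?z s))"
      using l(7) unfolding zz unfolding i .
  qed
  note st = same[OF order.refl le]
  have "gap (P j) a' b'" using win_gaps(1)[OF w'] st(1) by simp
  then have eq: "a' = c" "b' = d" using P.gap_unique[OF win_gaps(2)[OF w] _ st(3,4)] st(5,6) by auto
  from win_exit[OF w] show False
  proof (elim disjE conjE)
    assume q: "0 < phi n i a b y0 q"
    obtain k l where f: "\<And>s. phi n i a b y0 s = k + s * l" using phi_affine by metis
    have "(q - \<tau>) * l > 0" using q ph unfolding f by (simp add: algebra_simps)
    then have "l > 0" using pq(2) by (simp add: zero_less_mult_iff)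
    then have "\<tau>' * l \<le> \<tau> * l" using le by simp
    then have "phi n i a b y0 \<tau>' \<le> 0" using ph unfolding f by linarith
    then have 1: "Re (?z \<tau>') - mid j - M * (Im (?z \<tau>') - d) - hw j (Im (?z \<tau>')) \<le> 0"
      unfolding st(7)[symmetric] .
    have 2: "Re (?z \<tau>') - mid j - M * (Im (?z \<tau>') - c) + hw j (Im (?z \<tau>')) = 0"
      using st(8)[unfolded ph', symmetric] unfolding eq(1) .
    define y where "y = Im (?z \<tau>')"
    have y: "c < y" "y < d" using st(3,4) unfolding y_def .
    have o: "opposite j c d i a b" by (rule opposite_sym[OF win_opposite[OF w]])
    have "hw i (y - c + a) > 0"
      by (rule P.gap_half_width_pos[OF win_gaps(1)[OF w]]) (use y win_gaps(3)[OF w] in auto)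
    moreover have "M * (d - c) = 2 * hw j y + 2 * hw i (y - c + a)"
      using opposite_modulus[OF o] y by simp
    moreover have "M * (d - c) = M * (y - c) - M * (y - d)" by (simp add: algebra_simps)
    ultimately show False using 1 2 unfolding y_def[symmetric] by linarith
  next
    \<comment> \<open>Leaving by the top would put the next crossing at height \<open>d\<close> or
      above, whereas it lies strictly below.\<close>
    assume q: "y0 - a + c + (q - t n) * sin \<theta> = d"
    have "Im (?z' \<tau>') = Im (?z \<tau>')" using st(2) by simp
    then have "y0' + (\<tau>' - t (n + 1)) * sin \<theta> = y0 - a + c + (\<tau>' - t n) * sin \<theta>" by simp
    then have "y0' + (q - t (n + 1)) * sin \<theta> = d" using q by (simp add: algebra_simps)
    moreover have "(q - t (n + 1)) * sin \<theta> \<le> 0" using tq sin_nonneg by (simp add: mult_nonpos_nonneg)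
    ultimately show False using win_y0(2)[OF w'] eq(2) by simp
  qed
qed

text \<open>For \<epsilon> = 1 the point lies on a diagonal issuing from the bottom left corner, for
  \<epsilon> = -1 on one ending at the top right corner. If the trajectory left by the far base
  instead, it would have come from the opposite side, as it cannot run from base to base. These two
  places lie on the same side of the diagonal, while the affine distance to it vanishes in
  between.\<close>

lemma reach_side:
  assumes o: "opposite i a b j c d" and \<epsilon>: "\<epsilon> = 1 \<or> \<epsilon> = -1"
    and z: "z \<in> P i" "a < Im z" "Im z < b" and gs: "g s = pt S (i, z)"
    and on: "\<epsilon> * (Re z - mid i) = M * (\<epsilon> * (Im z - (if \<epsilon> = 1 then a else b))) - hw i (Im z)"
  obtains q y where "q \<ge> 0" "a < y" "y < b" "z + (\<epsilon> * q) *\<^sub>R u = side (P i) \<epsilon> y"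
    "g (s + \<epsilon> * q) = pt S (i, side (P i) \<epsilon> y)"
    "\<And>r p. 0 < r \<Longrightarrow> r < q \<Longrightarrow> \<not> on_edge S (g (s + \<epsilon> * r)) p"
proof -
  define near where "near = (if \<epsilon> = 1 then a else b)"
  define far where "far = (if \<epsilon> = 1 then b else a)"
  have gp: "gap (P i) a b" and cd: "d - c = b - a" using o by (auto simp: opposite_def)
  have ab: "a < b" using gp by (simp add: gap_def)
  let ?w = "hw i"
  let ?p = "\<lambda>s. z + (\<epsilon> * s) *\<^sub>R u"
  have \<epsilon>': "-\<epsilon> = 1 \<or> -\<epsilon> = -1" using \<epsilon> by auto
  have zi: "a \<le> Im z" "Im z \<le> b" using z by auto
  obtain q where q: "q \<ge> 0"
    "\<And>r. 0 \<le> r \<Longrightarrow> r \<le> q \<Longrightarrow> ?p r \<in> P i \<and> a \<le> Im (?p r) \<and> Im (?p r) \<le> b \<and> g (s + \<epsilon> * r) = pt S (i, ?p r)"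
    "\<And>r. 0 < r \<Longrightarrow> r < q \<Longrightarrow> \<bar>Re (?p r) - mid i\<bar> < ?w (Im (?p r))"
    "(\<exists>y. ?p q = side (P i) \<epsilon> y \<and> a < y \<and> y < b) \<or>
     (Im (?p q) = far \<and> \<bar>Re (?p q) - mid i\<bar> < ?w far)"
    using passage[OF gp \<epsilon> z(1) zi gs, folded far_def] by blast
  have qi: "a \<le> Im (?p q)" "Im (?p q) \<le> b" using q(2)[of q] q(1) by auto
  from q(4) show ?thesis
  proof
    assume "\<exists>y. ?p q = side (P i) \<epsilon> y \<and> a < y \<and> y < b"
    then obtain y where y: "?p q = side (P i) \<epsilon> y" "a < y" "y < b" by blast
    show ?thesis
    proof (rule that[OF q(1) y(2,3,1)])
      show "g (s + \<epsilon> * q) = pt S (i, side (P i) \<epsilon> y)" using q(2)[of q] q(1) y(1) by simp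
      fix r p assume r: "0 < r" "r < q"
      have "a < Im (?p r)" "Im (?p r) < b" using strict_between[OF r z(2,3) qi] by auto
      then show "\<not> on_edge S (g (s + \<epsilon> * r)) p"
        using not_on_edge[of i "?p r" p] gap_inside[OF gp] q(3)[OF r] q(2)[of r] r by auto
    qed
  next
    assume top: "Im (?p q) = far \<and> \<bar>Re (?p q) - mid i\<bar> < ?w far"
    have far': "near = (if -\<epsilon> = 1 then b else a)" using \<epsilon> by (auto simp: near_def)
    let ?r = "\<lambda>s. z + (-\<epsilon> * s) *\<^sub>R u"
    obtain q2 where q2: "q2 \<ge> 0"
      "\<And>r. 0 \<le> r \<Longrightarrow> r \<le> q2 \<Longrightarrow> ?r r \<in> P i \<and> a \<le> Im (?r r) \<and> Im (?r r) \<le> b \<and> g (s + -\<epsilon> * r) = pt S (i, ?r r)"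
      "\<And>r. 0 < r \<Longrightarrow> r < q2 \<Longrightarrow> \<bar>Re (?r r) - mid i\<bar> < ?w (Im (?r r))"
      "(\<exists>y. ?r q2 = side (P i) (-\<epsilon>) y \<and> a < y \<and> y < b) \<or>
       (Im (?r q2) = near \<and> \<bar>Re (?r q2) - mid i\<bar> < ?w near)"
      using passage[OF gp \<epsilon>' z(1) zi gs, folded far'] by blast
    have q2i: "a \<le> Im (?r q2)" "Im (?r q2) \<le> b" using q2(2)[of q2] q2(1) by auto
    have ?thesis if near: "Im (?r q2) = near"
    proof -
      have e: "?p q = ?r q2 + (\<epsilon> * (q + q2)) *\<^sub>R u" by (simp add: algebra_simps)
      have P: "?r q2 \<in> P i" "?p q \<in> P i" "q + q2 \<ge> 0" using q(1,2) q2(1,2) by auto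
      have False
        using through_trapezoid[OF gp \<epsilon> P(1,2) e P(3)] near top unfolding near_def far_def by blast
      then show ?thesis ..
    qed
    moreover have ?thesis if y: "?r q2 = side (P i) (-\<epsilon>) y" "a < y" "y < b" for y
    proof -
      define m where "m = (?w b - ?w a) / (b - a)"
      define L where "L = cos \<theta> - M * sin \<theta> + \<epsilon> * m * sin \<theta>"
      have ee: "\<epsilon> * \<epsilon> = 1" using \<epsilon> by auto
      \<comment> \<open>The signed horizontal distance to the extended diagonal along the
        trajectory; it vanishes at \<open>r = 0\<close> because \<open>z\<close> is on the
        diagonal.\<close>
      have F: "\<epsilon> * (Re (?p r) - mid i) - M * (\<epsilon> * (Im (?p r) - near)) + ?w (Im (?p r)) = r * L"
        if "a \<le> Im (?p r)" "Im (?p r) \<le> b" for r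
      proof -
        have Re: "\<epsilon> * (Re (?p r) - mid i) = \<epsilon> * (Re z - mid i) + r * cos \<theta>"
          using \<epsilon> by (auto simp: algebra_simps)
        have Im: "\<epsilon> * (Im (?p r) - near) = \<epsilon> * (Im z - near) + r * sin \<theta>"
          using \<epsilon> by (auto simp: algebra_simps)
        have wz: "?w (Im (?p r)) = ?w (Im z) + \<epsilon> * m * (r * sin \<theta>)"
        proof -
          have I: "Im (?p r) - Im z = \<epsilon> * (r * sin \<theta>)" by simp
          show ?thesis using P.half_width_diff[OF gp that zi] unfolding m_def[symmetric] I by (simp add: algebra_simps)
        qed
        show ?thesis unfolding Re Im wz on[folded near_def] by (simp add: L_def algebra_simps)
      qed
      have Mp: "M > 0" by (rule M_pos[OF gp])
      \<comment> \<open>By the modulus relation the diagonal, extended to the height of the far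
        base, is at or beyond the end of that base.\<close>
      have "q * L < 0"
      proof -
        have "far - a + c = (if \<epsilon> = 1 then d else c)" using cd by (simp add: far_def)
        then have "M * (b - a) = 2 * ?w far + 2 * hw j (if \<epsilon> = 1 then d else c)"
          using opposite_modulus[OF o, of far] ab by (auto simp: far_def)
        moreover have "hw j (if \<epsilon> = 1 then d else c) \<ge> 0"
          using o P.gap_half_width_nonneg[of j c d] by (auto simp: opposite_def gap_def)
        moreover have "\<epsilon> * (far - near) = b - a" using \<epsilon> by (auto simp: near_def far_def)
        moreover have "\<epsilon> * (Re (?p q) - mid i) < ?w far" using top \<epsilon> by auto
        moreover have "\<epsilon> * (Re (?p q) - mid i) - M * (\<epsilon> * (far - near)) + ?w far = q * L"
          using F[OF qi] top by simp
        ultimately show ?thesis by simp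
      qed
      then have "L < 0" using q(1) by (simp add: mult_less_0_iff)
      moreover have "(-q2) * L < 0"
      proof -
        have e: "?p (-q2) = ?r q2" by simp
        have "\<epsilon> * (Re (?r q2) - mid i) - M * (\<epsilon> * (Im (?r q2) - near)) + ?w (Im (?r q2)) = (-q2) * L"
          using F[of "-q2"] q2i unfolding e by blast
        moreover have "\<epsilon> * (Re (?r q2) - mid i) = - ?w y" "Im (?r q2) = y" unfolding y(1) using \<epsilon> by auto
        ultimately have "(-q2) * L = - (M * (\<epsilon> * (y - near)))" by simp
        moreover have "\<epsilon> * (y - near) > 0" using y \<epsilon> by (auto simp: near_def)
        ultimately show ?thesis using Mp by simp
      qed
      ultimately have False using q2(1) mult_nonneg_nonpos[of q2 L] by simp
      then show ?thesis ..
    qed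
    ultimately show ?thesis using q2(4) by blast
  qed
qed

text \<open>The preimage of the crossed point lies on a diagonal. In \<open>P i\<close> the
  trajectory is followed on to the gluing edge, in \<open>P j\<close> it is traced back to it, and
  the time of that crossing gives the index. The window there contains \<open>s\<close>, and an
  interior zero of the affine \<open>phi\<close> forces the sign change that characterises marked
  letters.\<close>

lemma hit_of_crossing:
  assumes p: "on_edge S (V (g s)) (k, e)" and nh: "\<not> horizontal e"
  obtains n where "hit n s" "marked S g t \<kappa> n"
proof -
  have geoV: "geodesic_on S UNIV (V \<circ> g) (Complex (M * Im (cis \<theta>) - Re (cis \<theta>)) (Im (cis \<theta>)))"
    using V_geodesic[OF geo] by (simp add: is_interval_univ)
  have nv: "V (g s) \<notin> vertex_points S" using geodesic_point(2)[OF geoV, of s] by simp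
  obtain i a b j c d y where o: "opposite i a b j c d" and y: "a < y" "y < b" and Vg: "V (g s) = pt S (i, side (P i) 1 y)"
    using slanted_letterE[OF nv p nh] by metis
  have gaps: "gap (P i) a b" "gap (P j) c d" "d - c = b - a" using o by (auto simp: opposite_def)
  note result = that
  have finish: thesis
    if w: "window n i a b j c d y0 p q" and pq: "p \<le> s" "s \<le> q" and ph: "phi n i a b y0 s = 0" for n y0 p q
  proof -
    obtain k l where f: "\<And>s. phi n i a b y0 s = k + s * l" using phi_affine by metis
    have nz: "phi n i a b y0 p \<noteq> 0" "phi n i a b y0 q \<noteq> 0"
      using win_entry[OF w] win_exit[OF w] by (metis less_irrefl)+
    have st: "p < s" "s < q" using pq nz ph by (metis order.order_iff_strict)+
    have "phi n i a b y0 p * phi n i a b y0 q < 0" by (rule affine_sign[OF f st ph nz(1)])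
    then have "marked S g t \<kappa> n" using window_marked[OF w] by simp
    moreover have "hit n s" unfolding hit_def using w st ph by blast
    ultimately show ?thesis using result by blast
  qed
  have gp: "g s \<in> points S" using geodesic_point(1)[OF geo] by simp
  from V_preimage[OF o y gp Vg] show thesis
  proof cases
    case 1
    define z where "z = Complex (mid i + M * (y - a) - hw i y) y"
    have zP: "z \<in> P i" using V_shear1(2)[OF o y 1(1)] by (simp add: z_def)
    have zy: "a < Im z" "Im z < b" using y by (auto simp: z_def)
    have gz: "g s = pt S (i, z)" using 1(2) by (simp add: z_def)
    obtain q y1 where q: "q \<ge> 0" "a < y1" "y1 < b" "z + (1 * q) *\<^sub>R u = side (P i) 1 y1"
      "g (s + 1 * q) = pt S (i, side (P i) 1 y1)" "\<And>r p. 0 < r \<Longrightarrow> r < q \<Longrightarrow> \<not> on_edge S (g (s + 1 * r)) p"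
      using reach_side[OF o _ zP zy gz, of 1] by (auto simp: z_def)
    have "side (P i) 1 ` {a..b} edge_of P i" using P.side_edge[OF gaps(1)] by simp
    then have "on_edge S (g (s + q)) (i, side (P i) 1 ` {a..b})"
      unfolding on_edge_iff using q(2,3,5) by auto
    then have "s + q \<in> range t" using t_range by blast
    then obtain m where m: "t m = s + q" by (metis rangeE)
    have gm: "g (t m) = pt S (i, side (P i) 1 y1)" using q(5) m by simp
    obtain p' q' where w: "window m i a b j c d y1 p' q'" by (rule window_exists[OF o q(2,3) gm])
    have zz: "z = side (P i) 1 y1 + (s - t m) *\<^sub>R u" unfolding q(4)[symmetric] m by (simp add: algebra_simps)
    have ph: "phi m i a b y1 s = 0"
      using phi_left[OF gaps(1) _ _ zz] q(2,3) zy by (simp add: z_def)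
    \<comment> \<open>The window reaches back to \<open>s\<close>: no edge is met strictly between
      \<open>s\<close> and the crossing, and \<open>z\<close> lies strictly above the
      bottom.\<close>
    have "p' \<le> s"
    proof (rule ccontr)
      assume "\<not> p' \<le> s"
      then have ps: "s < p'" by simp
      from win_entry[OF w] show False
      proof (elim disjE conjE)
        assume "p' = t (m - 1)"
        then obtain p where "on_edge S (g p') p" using t_on_edge by blast
        then show False using q(6)[of "p' - s" p] ps win_times(2)[OF w] m by simp
      next
        assume a: "y1 + (p' - t m) * sin \<theta> = a"
        have "Im z = y1 + (s - t m) * sin \<theta>" unfolding zz by simp
        moreover have "(s - t m) * sin \<theta> \<le> (p' - t m) * sin \<theta>" using ps sin_nonneg by (intro mult_right_mono) auto
        ultimately show False using a zy(1) by linarith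
      qed
    qed
    moreover have "s \<le> q'" using m q(1) win_times(3)[OF w] by simp
    ultimately show thesis using finish[OF w] ph by blast
  next
    case 2
    define y' where "y' = y - a + c"
    define z where "z = Complex (mid j + M * (y - b) + hw j y') y'"
    have zP: "z \<in> P j" using V_shear2(2)[OF o y 2(1)] by (simp add: z_def y'_def)
    have zy: "c < Im z" "Im z < d" using y gaps(3) by (auto simp: z_def y'_def)
    have gz: "g s = pt S (j, z)" using 2(2) by (simp add: z_def y'_def)
    have yb: "y' - d = y - b" using gaps(3) by (simp add: y'_def)
    have e: "(-1::real) = 1 \<or> (-1::real) = -1" by simp
    have on: "-1 * (Re z - mid j) = M * (-1 * (Im z - (if (-1::real) = 1 then c else d))) - hw j (Im z)"
      by (simp add: z_def yb[symmetric] algebra_simps)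
    obtain q y1 where q: "q \<ge> 0" "c < y1" "y1 < d" "z + (-1 * q) *\<^sub>R u = side (P j) (-1) y1"
      "g (s + -1 * q) = pt S (j, side (P j) (-1) y1)" "\<And>r p. 0 < r \<Longrightarrow> r < q \<Longrightarrow> \<not> on_edge S (g (s + -1 * r)) p"
      using reach_side[OF opposite_sym[OF o] e zP zy gz on] by metis
    have "side (P j) (-1) ` {c..d} edge_of P j" using P.side_edge[OF gaps(2)] by simp
    then have "on_edge S (g (s - q)) (j, side (P j) (-1) ` {c..d})"
      unfolding on_edge_iff using q(2,3,5) by auto
    then have "s - q \<in> range t" using t_range by blast
    then obtain m where m: "t m = s - q" by (metis rangeE)
    define y0 where "y0 = y1 - c + a"
    have y0: "a < y0" "y0 < b" "y0 - a + c = y1" using q(2,3) gaps(3) by (auto simp: y0_def)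
    have "g (t m) = pt S (j, side (P j) (-1) (y0 - a + c))" using q(5) m y0(3) by simp
    also have "\<dots> = pt S (i, side (P i) 1 y0)" using opposite_pt(1)[OF o, of y0] y0 by simp
    finally have gm: "g (t m) = pt S (i, side (P i) 1 y0)" .
    obtain p' q' where w: "window m i a b j c d y0 p' q'" by (rule window_exists[OF o y0(1,2) gm])
    have zz: "z = side (P j) (-1) (y0 - a + c) + (s - t m) *\<^sub>R u"
      unfolding y0(3) q(4)[symmetric] m by (simp add: algebra_simps)
    have ph: "phi m i a b y0 s = 0"
      using phi_right[OF o _ _ zz] y0 zy by (simp add: z_def yb)
    have "s \<le> q'"
    proof (rule ccontr)
      assume "\<not> s \<le> q'"
      then have ps: "q' < s" by simp
      from win_exit[OF w] show False
      proof (elim disjE conjE)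
        assume "q' = t (m + 1)"
        then obtain p where "on_edge S (g q') p" using t_on_edge by blast
        then show False using q(6)[of "s - q'" p] ps win_times(3)[OF w] m by simp
      next
        assume a: "y0 - a + c + (q' - t m) * sin \<theta> = d"
        have "Im z = y0 - a + c + (s - t m) * sin \<theta>" unfolding zz by simp
        moreover have "(q' - t m) * sin \<theta> \<le> (s - t m) * sin \<theta>" using ps sin_nonneg by (intro mult_right_mono) auto
        ultimately show False using a zy(2) by linarith
      qed
    qed
    moreover have "p' \<le> s" using m q(1) win_times(2)[OF w] by simp
    ultimately show thesis using finish[OF w] ph by blast
  qed
qed

end

text \<open>From an interior point the straight path leaves the bounded polygon through an edge.
  This is what makes the derived sequence infinite in both directions.\<close>

lemma (in special_surf) geodesic_meets_edges:
  assumes g: "geodesic_on S UNIV g v" and v: "v \<noteq> 0" and \<epsilon>: "\<epsilon> = 1 \<or> \<epsilon> = -1"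
  obtains s p where "\<epsilon> * (s - s0) > 0" "on_edge S (g s) p"
proof -
  \<comment> \<open>Starting one unit beyond \<open>s0\<close> keeps the inequality strict even if
    that point is already on an edge.\<close>
  define s1 where "s1 = s0 + \<epsilon>"
  have s1: "\<epsilon> * (s1 - s0) > 0" using \<epsilon> by (auto simp: s1_def)
  have ee: "\<epsilon> * \<epsilon> = 1" using \<epsilon> by auto
  obtain i z where z: "g s1 = pt S (i, z)" "z \<in> P i"
    using geodesic_point(1)[OF g, of s1] by (auto simp: points_def)
  show ?thesis
  proof (cases "z \<in> interior (P i)")
    case False
    then obtain e where "e edge_of P i" "z \<in> e" using frontier_edge[OF P.sp_polygon z(2)] by blast
    then have "on_edge S (g s1) (i, e)" using z(1) on_edge_iff by blast
    then show ?thesis using that s1 by blast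
  next
    case True
    have "\<epsilon> *\<^sub>R v \<noteq> 0" using v \<epsilon> by auto
    then obtain r where r: "0 < r" "z + r *\<^sub>R (\<epsilon> *\<^sub>R v) \<in> frontier (P i)"
      using ray_to_frontier[OF compact_imp_bounded[OF P.sp_compact] True] by metis
    let ?w = "z + r *\<^sub>R (\<epsilon> *\<^sub>R v)"
    have w: "?w \<in> P i" "?w \<notin> interior (P i)"
      using r(2) compact_imp_closed[OF P.sp_compact] by (auto simp: frontier_def)
    obtain e where e: "e edge_of P i" "?w \<in> e" using frontier_edge[OF P.sp_polygon w] by blast
    have "g (s1 + \<epsilon> * r) = pt S (i, z + ((s1 + \<epsilon> * r) - s1) *\<^sub>R v)"
      by (rule geodesic_continues[OF g, of s1 "s1 + \<epsilon> * r"]) (use z w in \<open>auto simp: mult.commute\<close>)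
    then have "on_edge S (g (s1 + \<epsilon> * r)) (i, e)" using e on_edge_iff by (auto simp: mult.commute)
    moreover have "\<epsilon> * (s1 + \<epsilon> * r - s0) > 0"
    proof -
      have "\<epsilon> * (s1 + \<epsilon> * r - s0) = \<epsilon> * (s1 - s0) + (\<epsilon> * \<epsilon>) * r" by (simp add: algebra_simps)
      then show ?thesis using s1 r(1) ee by simp
    qed
    ultimately show ?thesis using that by blast
  qed
qed

lemma strict_mono_enumeration_int:
  fixes A :: "int set"
  assumes up: "\<And>k. \<exists>n\<in>A. k < n" and down: "\<And>k. \<exists>n\<in>A. n < k"
  obtains \<phi> :: "int \<Rightarrow> int" where "strict_mono \<phi>" "range \<phi> = A"
proof -
  define B where "B = {k. int k \<in> A}"
  define C where "C = {k. - 1 - int k \<in> A}"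
  have iB: "infinite B" unfolding infinite_nat_iff_unbounded
  proof
    fix m
    obtain n where n: "n \<in> A" "int m < n" using up by blast
    then show "\<exists>n>m. n \<in> B" by (intro exI[of _ "nat n"]) (auto simp: B_def)
  qed
  have iC: "infinite C" unfolding infinite_nat_iff_unbounded
  proof
    fix m
    obtain n where n: "n \<in> A" "n < - 1 - int m" using down by blast
    then show "\<exists>n>m. n \<in> C" by (intro exI[of _ "nat (- 1 - n)"]) (auto simp: C_def)
  qed
  \<comment> \<open>The map k \<mapsto> - 1 - k exchanges negative and nonnegative integers; index
    \<open>- 1\<close> receives the largest negative member of \<open>A\<close>.\<close>
  define \<phi> where "\<phi> n = (if n \<ge> 0 then int (enumerate B (nat n)) else - 1 - int (enumerate C (nat (- 1 - n))))" for n :: int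
  have "strict_mono \<phi>"
  proof (rule strict_monoI)
    fix m n :: int assume mn: "m < n"
    have B: "enumerate B (nat m) < enumerate B (nat n)" if "m \<ge> 0"
      using strict_mono_enumerate[OF iB] mn that by (simp add: strict_mono_def)
    have C: "enumerate C (nat (- 1 - n)) < enumerate C (nat (- 1 - m))" if "n < 0"
      using strict_mono_enumerate[OF iC] mn that by (simp add: strict_mono_def)
    show "\<phi> m < \<phi> n" using mn B C by (auto simp: \<phi>_def)
  qed
  moreover have "range \<phi> = A"
  proof (intro subset_antisym subsetI)
    fix x assume "x \<in> range \<phi>"
    then show "x \<in> A" using enumerate_in_set[OF iB] enumerate_in_set[OF iC] by (auto simp: \<phi>_def B_def C_def)
  next
    fix x assume x: "x \<in> A"
    show "x \<in> range \<phi>"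
    proof (cases "x \<ge> 0")
      case True
      then have "nat x \<in> range (enumerate B)" using x range_enumerate[OF iB] by (simp add: B_def)
      then obtain k where "nat x = enumerate B k" by blast
      then have "\<phi> (int k) = x" using True by (simp add: \<phi>_def)
      then show ?thesis by (metis rangeI)
    next
      case False
      then have "nat (- 1 - x) \<in> range (enumerate C)" using x range_enumerate[OF iC] by (simp add: C_def)
      then obtain k where "nat (- 1 - x) = enumerate C k" by blast
      then have "\<phi> (- 1 - int k) = x" using False by (simp add: \<phi>_def)
      then show ?thesis by (metis rangeI)
    qed
  qed
  ultimately show ?thesis by (rule that)
qed

section \<open>Times and letters of the derived sequence\<close>

context traj
begin

lemma derived_sequence:
  "\<exists>\<phi> t'. strict_mono \<phi> \<and> range \<phi> = {n. marked S g t \<kappa> n} \<and> cutting_sequence S (V \<circ> g) t' (\<kappa> \<circ> \<phi>)"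
proof -
  \<comment> \<open>The derived trajectory crosses the \<open>n\<close>th letter at time \<tau>. For
    a horizontal letter this is the original time, for a gluing edge the time of meeting the
    diagonal.\<close>
  define R where "R n \<tau> \<longleftrightarrow> (if horizontal_letter (\<kappa> n) then \<tau> = t n else hit n \<tau>)" for n \<tau>
  define A where "A = {n. marked S g t \<kappa> n}"
  define T where "T n = (SOME \<tau>. R n \<tau>)" for n
  have T: "R n (T n)" if "n \<in> A" for n
  proof -
    have "\<exists>\<tau>. R n \<tau>" using that hit_exists[of n] unfolding R_def A_def by (metis mem_Collect_eq)
    then show ?thesis unfolding T_def by (rule someI_ex)
  qed
  have R_unique: "R n \<tau> \<Longrightarrow> R n \<tau>' \<Longrightarrow> \<tau> = \<tau>'" for n \<tau> \<tau>'
    using hit_unique unfolding R_def by (auto split: if_splits)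
  have bounds: "t (n - 1) < \<tau> \<and> \<tau> < t (n + 1)" if "R n \<tau>" for n \<tau>
    using that hit_times[of n \<tau>] unfolding R_def by (auto split: if_splits)
  \<comment> \<open>The bounds separate letters at least two indices apart, and neighbours of which
    one is horizontal; two neighbouring gluing edges require \<open>hit_order\<close>.\<close>
  have mono: "\<tau> < \<tau>'" if R: "R n \<tau>" "R m \<tau>'" and nm: "n < m" for n m \<tau> \<tau>'
  proof (cases "m = n + 1")
    case True
    show ?thesis
      using R bounds[OF R(1)] bounds[OF R(2)] hit_order[of n \<tau> \<tau>'] unfolding R_def True by (auto split: if_splits)
  next
    case False
    then have "t (n + 1) \<le> t (m - 1)" using nm strict_mono_less_eq[OF t_mono] by auto
    then show ?thesis using bounds[OF R(1)] bounds[OF R(2)] by linarith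
  qed
  define v where "v = Complex (M * Im (cis \<theta>) - Re (cis \<theta>)) (Im (cis \<theta>))"
  have geoV: "geodesic_on S UNIV (V \<circ> g) v"
    using V_geodesic[OF geo] by (simp add: is_interval_univ v_def)
  have v0: "v \<noteq> 0" using cos_pos by (auto simp: v_def complex_eq_iff)
  define K where "K = {s. \<exists>p. on_edge S ((V \<circ> g) s) p}"
  have gpt: "g s \<in> points S" for s using geodesic_point(1)[OF geo] by simp
  have letter: "\<exists>p. on_edge S (V (g \<tau>)) p \<and> \<kappa> n = letter_of S p" if R: "R n \<tau>" for n \<tau>
  proof (cases "horizontal_letter (\<kappa> n)")
    case True
    then have \<tau>: "\<tau> = t n" using R by (simp add: R_def)
    obtain k e where p: "on_edge S (g (t n)) (k, e)" using t_on_edge by (metis surj_pair)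
    have "e edge_of P k" using p on_edge_iff by simp
    then have "horizontal e" using True c_letter[OF p] horizontal_letter_iff by simp
    then have "on_edge S (V (g (t n))) (k, e)" using V_horizontal[OF gpt] p by simp
    then show ?thesis using c_letter[OF p] \<tau> by blast
  next
    case False
    then show ?thesis using R hit_letter[of n \<tau>] unfolding R_def by metis
  qed
  have surj: "\<exists>n\<in>A. s = T n" if s: "s \<in> K" for s
  proof -
    obtain p where "on_edge S (V (g s)) p" using s by (auto simp: K_def)
    then obtain k e where p: "on_edge S (V (g s)) (k, e)" by (metis surj_pair)
    have "\<exists>n\<in>A. R n s"
    proof (cases "horizontal e")
      case True
      then have p': "on_edge S (g s) (k, e)" using V_horizontal[OF gpt] p by simp
      then have "s \<in> range t" using t_range by blast
      then obtain n where n: "s = t n" by blast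
      have "e edge_of P k" using p on_edge_iff by simp
      then have "horizontal_letter (\<kappa> n)" using True c_letter[of n] p' n horizontal_letter_iff by simp
      then show ?thesis using n by (auto simp: A_def R_def marked_def)
    next
      case False
      obtain n where n: "hit n s" "marked S g t \<kappa> n" by (rule hit_of_crossing[OF p False])
      have "\<not> horizontal_letter (\<kappa> n)" using n(1) win_letter(2) unfolding hit_def by blast
      then show ?thesis using n by (auto simp: A_def R_def)
    qed
    then show ?thesis using R_unique T by blast
  qed
  \<comment> \<open>The derived trajectory meets edges after every time, and the letter
    \<open>n\<close> is crossed before \<open>t (n + 1)\<close>; so marked letters occur beyond
    every index.\<close>
  have up: "\<exists>n\<in>A. k < n" for k
  proof -
    obtain s p where s: "1 * (s - t (k + 1)) > 0" "on_edge S ((V \<circ> g) s) p"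
      by (rule geodesic_meets_edges[OF geoV v0, of 1 "t (k + 1)"]) auto
    have "s \<in> K" using s(2) unfolding K_def by blast
    then obtain n where n: "n \<in> A" "s = T n" using surj by blast
    have "t (k + 1) < s" using s(1) by simp
    also have "s < t (n + 1)" using bounds[OF T[OF n(1)]] n(2) by blast
    finally have "k + 1 < n + 1" by simp
    then show ?thesis using n(1) by (intro bexI[of _ n]) auto
  qed
  have down: "\<exists>n\<in>A. n < k" for k
  proof -
    obtain s p where s: "-1 * (s - t (k - 1)) > 0" "on_edge S ((V \<circ> g) s) p"
      by (rule geodesic_meets_edges[OF geoV v0, of "-1" "t (k - 1)"]) auto
    have "s \<in> K" using s(2) unfolding K_def by blast
    then obtain n where n: "n \<in> A" "s = T n" using surj by blast
    have "t (n - 1) < s" using bounds[OF T[OF n(1)]] n(2) by blast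
    also have "s < t (k - 1)" using s(1) by simp
    finally have "n - 1 < k - 1" by simp
    then show ?thesis using n(1) by (intro bexI[of _ n]) auto
  qed
  obtain \<phi> :: "int \<Rightarrow> int" where \<phi>: "strict_mono \<phi>" "range \<phi> = A"
    by (rule strict_mono_enumeration_int[OF up down])
  have \<phi>A: "\<phi> n \<in> A" for n using \<phi>(2) by (metis rangeI)
  have "cutting_sequence S (V \<circ> g) (T \<circ> \<phi>) (\<kappa> \<circ> \<phi>)"
    unfolding cutting_sequence_def
  proof (intro conjI allI)
    show "trajectory S (V \<circ> g)" unfolding trajectory_def using geoV v0 by blast
    show "strict_mono (T \<circ> \<phi>)"
    proof (rule strict_monoI)
      fix m n :: int assume "m < n"
      then have "\<phi> m < \<phi> n" using \<phi>(1) strict_monoD by blast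
      then show "(T \<circ> \<phi>) m < (T \<circ> \<phi>) n" using mono[OF T[OF \<phi>A] T[OF \<phi>A]] by simp
    qed
    have "T ` A = K"
    proof (intro subset_antisym subsetI)
      fix s assume "s \<in> T ` A"
      then obtain n where n: "n \<in> A" "s = T n" by blast
      then show "s \<in> K" using letter[OF T[OF n(1)]] unfolding K_def comp_def by blast
    qed (use surj in blast)
    then show "range (T \<circ> \<phi>) = {s. \<exists>p. on_edge S ((V \<circ> g) s) p}"
      unfolding K_def[symmetric] by (metis \<phi>(2) image_comp)
    show "\<exists>p. on_edge S ((V \<circ> g) ((T \<circ> \<phi>) n)) p \<and> (\<kappa> \<circ> \<phi>) n = letter_of S p" for n
      using letter[OF T[OF \<phi>A]] by simp
  qed
  then show ?thesis using \<phi> unfolding A_def by blast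
qed

end

theorem theorem4p2:
  fixes S :: "'i::finite polygon_surface"
    and M \<theta> :: real
    and V :: "('i \<times> complex) set \<Rightarrow> ('i \<times> complex) set"
    and g :: "real \<Rightarrow> ('i \<times> complex) set"
    and t :: "int \<Rightarrow> real"
    and c :: "int \<Rightarrow> ('i \<times> complex set) set"
  assumes "perfect_surface S M"
    and "is_flip_shear S M V"
    and "geodesic_on S UNIV g (cis \<theta>)"
    and "0 \<le> \<theta>" and "\<theta> < theta_S S"
    and "cutting_sequence S g t c"
  shows "\<exists>\<phi> t'. strict_mono \<phi> \<and> range \<phi> = {n. marked S g t c n} \<and>
                cutting_sequence S (V \<circ> g) t' (c \<circ> \<phi>)"
proof -
  interpret traj S M V g \<theta> t c by unfold_locales (fact assms)+
  show ?thesis by (rule derived_sequence)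
qed

end
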